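(* Assume (Pur) and (Erg) hold. Let $m$ be the period of $\mu$. Then the peripheral spectrum of $\Pi$ (as an operator on $C^\alpha(\mathrm P(\mathbb C^k),\mathbb C)$, $0<\alpha\le1$) is the set of $m$-th roots of unity: $$\{z\in\operatorname{spec}\Pi:|z|=1\}=\{e^{i\frac rm2\pi}: r=0,\dots,m-1\}.$$
   Context: Let $k\in\mathbb N=\{1,2,\dots\}$ be fixed; $\mathbb C^k$ carries its canonical inner product and norm $\|\cdot\|$. $\mathrm P(\mathbb C^k)$ is the projective space; $\hat x$ is the class of a nonzero vector $x$, and given $\hat x$, $x$ denotes a unit-norm representative. The metric is $d(\hat x,\hat y)=\sqrt{1-|\langle x,y\rangle|^2}$. For $v\in\mathrm M_k(\mathbb C)$ with $vx\ne0$, $v\cdot\hat x$ is the class of $vx$. For $0<\alpha\le1$, $C^\alpha(\mathrm P(\mathbb C^k),\mathbb C)$ is the Banach space of $\alpha$-Hölder functions with norm $\|f\|_\alpha=\|f\|_\infty+m_\alpha(f)$, $m_\alpha(f)=\sup_{\hat x\ne\hat y}|f(\hat x)-f(\hat y)|/d(\hat x,\hat y)^\alpha$. $\mu$ is a (not necessarily finite) Borel measure on $\mathrm M_k(\mathbb C)$ with $\int\|v\|^2d\mu(v)<\infty$ and $\int v^*v\,d\mu(v)=\mathrm{Id}_{\mathbb C^k}$. The Markov operator is $\Pi f(\hat x)=\int_{\mathrm M_k(\mathbb C)}f(v\cdot\hat x)\|vx\|^2d\mu(v)$ (integrand $0$ when $vx=0$). (Pur): any nonzero orthogonal projector $\pi$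 on $\mathbb C^k$ such that, for every $n\in\mathbb N$, $\pi v_1^*\cdots v_n^*v_n\cdots v_1\pi\propto\pi$ (proportionality constant $0$ allowed) for $\mu^{\otimes n}$-almost every $(v_1,\dots,v_n)$, is of rank one. (Erg): there exists a unique minimal subspace $E\ne\{0\}$ of $\mathbb C^k$ such that $vE\subset E$ for $\mu$-almost every $v$. An $\ell$-cycle of $\mu$ is a set of orthogonal subspaces $\{E_1,\dots,E_\ell\}$ of $E$ such that $E=E_1\oplus\cdots\oplus E_\ell$ and, for $\mu$-almost every $v$ and all $i\in\{1,\dots,\ell\}$, $vE_i\subset E_{i+1}$ with $E_{\ell+1}=E_1$. The period $m$ of $\mu$ is the maximal $\ell$ such that there exists an $\ell$-cycle of $\mu$. *)

theory Defs
  imports "HOL-Analysis.Analysis"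
begin

text \<open>The inner product of \<open>complex ^ 'k\<close> in the library is the real one, hence the Hermitian
  inner product is defined here. Complex subspaces are \<open>vec.subspace\<close>; the library's
  \<open>subspace\<close> is about real scalars.\<close>

definition cinner :: "complex ^ 'k \<Rightarrow> complex ^ 'k \<Rightarrow> complex" where
  "cinner x y = (\<Sum>i\<in>UNIV. cnj (x $ i) * y $ i)"

definition adj :: "complex ^ 'k ^ 'k \<Rightarrow> complex ^ 'k ^ 'k" where
  "adj A = (\<chi> i j. cnj (A $ j $ i))"

definition orth_projector :: "complex ^ 'k ^ 'k \<Rightarrow> bool" where
  "orth_projector p \<longleftrightarrow> p ** p = p \<and> adj p = p"

definition orth_spaces :: "(complex ^ 'k) set \<Rightarrow> (complex ^ 'k) set \<Rightarrow> bool" where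
  "orth_spaces F G \<longleftrightarrow> (\<forall>x\<in>F. \<forall>y\<in>G. cinner x y = 0)"

text \<open>\<open>mat_word v n\<close> is \<open>v\<^sub>n \<cdots> v\<^sub>1\<close>, with indices starting at 1.\<close>

primrec mat_word :: "(nat \<Rightarrow> complex ^ 'k ^ 'k) \<Rightarrow> nat \<Rightarrow> complex ^ 'k ^ 'k" where
  "mat_word v 0 = mat 1"
| "mat_word v (Suc n) = v (Suc n) ** mat_word v n"

definition proj_rel :: "complex ^ 'k \<Rightarrow> complex ^ 'k \<Rightarrow> bool" where
  "proj_rel x y \<longleftrightarrow> x \<noteq> 0 \<and> y \<noteq> 0 \<and> (\<exists>c. c \<noteq> 0 \<and> y = c *s x)"

lemma part_equivp_proj_rel: "part_equivp proj_rel"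
proof (rule part_equivpI)
  show "\<exists>x::complex ^ 'k. proj_rel x x"
    by (intro exI[of _ "1"]) (auto simp: proj_rel_def intro!: exI[of _ "1::complex"])
  show "symp (proj_rel :: complex ^ 'k \<Rightarrow> _)"
  proof (rule sympI)
    fix x y :: "complex ^ 'k" assume "proj_rel x y"
    then obtain c where "x \<noteq> 0" "y \<noteq> 0" "c \<noteq> 0" "y = c *s x"
      unfolding proj_rel_def by blast
    then show "proj_rel y x"
      unfolding proj_rel_def by (intro conjI exI[of _ "inverse c"]) (auto simp: vector_smult_assoc)
  qed
  show "transp (proj_rel :: complex ^ 'k \<Rightarrow> _)"
  proof (rule transpI)
    fix x y z :: "complex ^ 'k" assume "proj_rel x y" "proj_rel y z"
    then obtain c d where "x \<noteq> 0" "z \<noteq> 0" "c \<noteq> 0" "y = c *s x" "d \<noteq> 0" "z = d *s y"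
      unfolding proj_rel_def by blast
    then show "proj_rel x z"
      unfolding proj_rel_def by (intro conjI exI[of _ "d * c"]) (auto simp: vector_smult_assoc)
  qed
qed

text \<open>\<open>abs_proj x\<close> is the class of \<open>x\<close>; it is meaningful only for \<open>x \<noteq> 0\<close>.\<close>

quotient_type 'k proj = "complex ^ 'k" / partial: proj_rel
  by (rule part_equivp_proj_rel)

definition unit_rep :: "'k proj \<Rightarrow> complex ^ 'k" where
  "unit_rep X = (SOME x. norm x = 1 \<and> abs_proj x = X)"

lemma unit_rep: "norm (unit_rep X) = 1 \<and> abs_proj (unit_rep X) = X"
  unfolding unit_rep_def
proof (rule someI_ex)
  obtain x where x: "proj_rel x x" "abs_proj x = X"
    by (metis Quotient_proj Quotient_abs_rep Quotient_rep_reflp)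
  then have nz: "x \<noteq> 0" by (simp add: proj_rel_def)
  define u where "u = complex_of_real (inverse (norm x)) *s x"
  have u: "u = inverse (norm x) *\<^sub>R x"
    unfolding u_def vec_eq_iff vector_scaleR_component vector_smult_component
    by (simp add: scaleR_conv_of_real)
  then have "norm u = 1" using nz by simp
  moreover have "proj_rel x u"
    using nz u unfolding proj_rel_def
    by (intro conjI exI[of _ "complex_of_real (inverse (norm x))"]) (auto simp: u_def)
  then have "abs_proj u = X"
    using x(2) Quotient_rel_abs[OF Quotient_proj] by metis
  ultimately show "\<exists>x. norm x = 1 \<and> abs_proj x = X" by blast
qed

definition proj_dist :: "'k::finite proj \<Rightarrow> 'k proj \<Rightarrow> real" where
  "proj_dist X Y = sqrt (1 - (cmod (cinner (unit_rep X) (unit_rep Y)))\<^sup>2)"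

text \<open>Meaningful only if \<open>v *v unit_rep X \<noteq> 0\<close>.\<close>

definition proj_act :: "complex ^ 'k ^ 'k \<Rightarrow> 'k proj \<Rightarrow> 'k proj" where
  "proj_act v X = abs_proj (v *v unit_rep X)"

definition holder_space :: "real \<Rightarrow> ('k::finite proj \<Rightarrow> complex) set" where
  "holder_space \<alpha> = {f. \<exists>C. \<forall>X Y. cmod (f X - f Y) \<le> C * proj_dist X Y powr \<alpha>}"

text \<open>The element 0 is inserted for \<open>CARD('k) = 1\<close>, where there are no two distinct points and the
  supremum of the empty set of reals would be unspecified.\<close>

definition holder_seminorm :: "real \<Rightarrow> ('k::finite proj \<Rightarrow> complex) \<Rightarrow> real" where
  "holder_seminorm \<alpha> f =
     Sup (insert 0 {cmod (f X - f Y) / proj_dist X Y powr \<alpha> | X Y. X \<noteq> Y})"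

definition holder_norm :: "real \<Rightarrow> ('k::finite proj \<Rightarrow> complex) \<Rightarrow> real" where
  "holder_norm \<alpha> f = (SUP X. cmod (f X)) + holder_seminorm \<alpha> f"

text \<open>Since \<open>\<alpha>\<close> is a real parameter, the Hoelder space is not a type; so operators act on all
  functions and are considered on a set \<open>V\<close> of functions with a norm \<open>N\<close>.\<close>

definition bounded_op_on ::
  "('a \<Rightarrow> complex) set \<Rightarrow> (('a \<Rightarrow> complex) \<Rightarrow> real) \<Rightarrow> (('a \<Rightarrow> complex) \<Rightarrow> ('a \<Rightarrow> complex)) \<Rightarrow> bool"
  where
  "bounded_op_on V N T \<longleftrightarrow>
     (\<forall>f\<in>V. T f \<in> V) \<and>
     (\<forall>f\<in>V. \<forall>g\<in>V. T (\<lambda>x. f x + g x) = (\<lambda>x. T f x + T g x)) \<and>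
     (\<forall>c. \<forall>f\<in>V. T (\<lambda>x. c * f x) = (\<lambda>x. c * T f x)) \<and>
     (\<exists>C. \<forall>f\<in>V. N (T f) \<le> C * N f)"

definition op_spectrum ::
  "('a \<Rightarrow> complex) set \<Rightarrow> (('a \<Rightarrow> complex) \<Rightarrow> real) \<Rightarrow> (('a \<Rightarrow> complex) \<Rightarrow> ('a \<Rightarrow> complex)) \<Rightarrow> complex set"
  where
  "op_spectrum V N T =
     {z. \<not> (\<exists>R. bounded_op_on V N R \<and>
             (\<forall>f\<in>V. R (\<lambda>x. z * f x - T f x) = f \<and> (\<lambda>x. z * R f x - T (R f) x) = f))}"

definition markov_op ::
  "(complex ^ 'k ^ 'k) measure \<Rightarrow> ('k proj \<Rightarrow> complex) \<Rightarrow> 'k proj \<Rightarrow> complex" where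
  "markov_op \<mu> f X =
     (LINT v|\<mu>. (if v *v unit_rep X = 0 then 0
                 else f (proj_act v X) * of_real ((norm (v *v unit_rep X))\<^sup>2)))"

text \<open>The product measure \<open>\<mu>\<^sup>\<otimes>\<^sup>n\<close> on tuples indexed by \<open>{1..n}\<close>, by iterated binary products. The
  library's \<open>PiM\<close> is specified by its values on boxes only, which determine it when \<open>\<mu>\<close> is
  sigma-finite; here \<open>\<mu> {0} = \<infinity>\<close> is not excluded. See \<open>tensor_power_eq_PiM\<close> for the sigma-finite
  case.\<close>

primrec tensor_power :: "'a measure \<Rightarrow> nat \<Rightarrow> (nat \<Rightarrow> 'a) measure" where
  "tensor_power M 0 = PiM {1..0} (\<lambda>_. M)"
| "tensor_power M (Suc n) =
     distr (tensor_power M n \<Otimes>\<^sub>M M) (PiM {1..Suc n} (\<lambda>_. M)) (\<lambda>(w, v). w(Suc n := v))"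

lemma tensor_power_eq_PiM:
  assumes "sigma_finite_measure M"
  shows "tensor_power M n = PiM {1..n} (\<lambda>_. M)"
proof (induction n)
  case (Suc n)
  interpret M: sigma_finite_measure M by fact
  interpret P: product_sigma_finite "\<lambda>_::nat. M" by standard
  have ins: "{1..Suc n} = insert (Suc n) {1..n}" by auto
  have meas: "(\<lambda>(w, v). w(Suc n := v)) \<in>
      (PiM {1..n} (\<lambda>_. M) \<Otimes>\<^sub>M M) \<rightarrow>\<^sub>M PiM {1..Suc n} (\<lambda>_. M)"
    unfolding ins by (rule measurable_add_dim)
  have "distr (PiM {1..n} (\<lambda>_. M) \<Otimes>\<^sub>M M) (PiM {1..Suc n} (\<lambda>_. M)) (\<lambda>(w, v). w(Suc n := v))
      = PiM {1..Suc n} (\<lambda>_. M)"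
  proof (rule P.PiM_eqI)
    fix A :: "nat \<Rightarrow> 'a set" assume A: "\<And>i. i \<in> {1..Suc n} \<Longrightarrow> A i \<in> sets M"
    have sub: "A i \<subseteq> space M" if "i \<in> {1..Suc n}" for i
      using A[OF that] by (rule sets.sets_into_space)
    have box: "(\<lambda>(w, v). w(Suc n := v)) -` Pi\<^sub>E {1..Suc n} A \<inter> space (PiM {1..n} (\<lambda>_. M) \<Otimes>\<^sub>M M)
        = Pi\<^sub>E {1..n} A \<times> A (Suc n)" (is "?L = ?R")
    proof
      show "?L \<subseteq> ?R"
      proof
        fix p assume p: "p \<in> ?L"
        obtain w v where wv: "p = (w, v)" by (cases p)
        from p wv have w: "w \<in> extensional {1..n}" and u: "w(Suc n := v) \<in> Pi\<^sub>E {1..Suc n} A"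
          by (auto simp: space_pair_measure space_PiM PiE_def)
        have "w i \<in> A i" if "i \<in> {1..n}" for i
          using PiE_mem[OF u, of i] that by auto
        moreover have "v \<in> A (Suc n)" using PiE_mem[OF u, of "Suc n"] by auto
        ultimately show "p \<in> ?R" using w wv by (auto simp: PiE_def)
      qed
      show "?R \<subseteq> ?L"
        using sub by (fastforce simp: space_pair_measure space_PiM PiE_def extensional_def Pi_def)
    qed
    have S: "Pi\<^sub>E {1..Suc n} A \<in> sets (PiM {1..Suc n} (\<lambda>_. M))"
      using A by (intro sets_PiM_I_finite) auto
    have "emeasure (distr (PiM {1..n} (\<lambda>_. M) \<Otimes>\<^sub>M M) (PiM {1..Suc n} (\<lambda>_. M)) (\<lambda>(w, v). w(Suc n := v)))
        (Pi\<^sub>E {1..Suc n} A) = emeasure (PiM {1..n} (\<lambda>_. M) \<Otimes>\<^sub>M M) (Pi\<^sub>E {1..n} A \<times> A (Suc n))"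
      by (simp only: emeasure_distr[OF meas S] box)
    also have "\<dots> = emeasure (PiM {1..n} (\<lambda>_. M)) (Pi\<^sub>E {1..n} A) * emeasure M (A (Suc n))"
      using A by (intro M.emeasure_pair_measure_Times sets_PiM_I_finite) auto
    also have "emeasure (PiM {1..n} (\<lambda>_. M)) (Pi\<^sub>E {1..n} A) = (\<Prod>i\<in>{1..n}. emeasure M (A i))"
      using A by (intro P.emeasure_PiM) auto
    also have "\<dots> * emeasure M (A (Suc n)) = (\<Prod>i\<in>{1..Suc n}. emeasure M (A i))"
      by simp
    finally show "emeasure (distr (PiM {1..n} (\<lambda>_. M) \<Otimes>\<^sub>M M) (PiM {1..Suc n} (\<lambda>_. M))
        (\<lambda>(w, v). w(Suc n := v))) (Pi\<^sub>E {1..Suc n} A) = (\<Prod>i\<in>{1..Suc n}. emeasure M (A i))" .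
  qed simp_all
  then show ?case by (simp only: tensor_power.simps Suc.IH)
qed simp

text \<open>In (Pur), \<open>v\<^sub>1\<^sup>* \<cdots> v\<^sub>n\<^sup>* = (v\<^sub>n \<cdots> v\<^sub>1)\<^sup>*\<close>, and \<open>mat c ** p\<close> is the scalar multiple \<open>c p\<close>.\<close>

definition Pur :: "(complex ^ 'k ^ 'k) measure \<Rightarrow> bool" where
  "Pur \<mu> \<longleftrightarrow>
     (\<forall>p. orth_projector p \<and> p \<noteq> 0 \<and>
        (\<forall>n\<ge>1. AE v in tensor_power \<mu> n.
           \<exists>c. p ** adj (mat_word v n) ** mat_word v n ** p = mat c ** p)
        \<longrightarrow> rank p = 1)"

definition invariant_space :: "(complex ^ 'k ^ 'k) measure \<Rightarrow> (complex ^ 'k) set \<Rightarrow> bool" where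
  "invariant_space \<mu> E \<longleftrightarrow> vec.subspace E \<and> E \<noteq> {0} \<and> (AE v in \<mu>. (*v) v ` E \<subseteq> E)"

definition minimal_invariant_space :: "(complex ^ 'k ^ 'k) measure \<Rightarrow> (complex ^ 'k) set \<Rightarrow> bool" where
  "minimal_invariant_space \<mu> E \<longleftrightarrow>
     invariant_space \<mu> E \<and> (\<forall>F. invariant_space \<mu> F \<and> F \<subseteq> E \<longrightarrow> F = E)"

definition Erg :: "(complex ^ 'k ^ 'k) measure \<Rightarrow> bool" where
  "Erg \<mu> \<longleftrightarrow> (\<exists>!E. minimal_invariant_space \<mu> E)"

definition erg_space :: "(complex ^ 'k ^ 'k) measure \<Rightarrow> (complex ^ 'k) set" where
  "erg_space \<mu> = (THE E. minimal_invariant_space \<mu> E)"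

text \<open>The sum of the \<open>F i\<close> is automatically direct, by orthogonality. When
  \<open>\<integral> v\<^sup>* v d\<mu> = Id\<close>, no \<open>F i\<close> can be \<open>{0}\<close>: almost every \<open>v\<close> would vanish on the preceding
  space, and so, going round the cycle, all the \<open>F i\<close> would be \<open>{0}\<close>. Hence the lengths of cycles
  are at most the dimension of \<open>erg_space \<mu>\<close> and the maximum in \<open>period\<close> is that of a finite
  nonempty set.\<close>

definition is_cycle :: "(complex ^ 'k ^ 'k) measure \<Rightarrow> nat \<Rightarrow> (nat \<Rightarrow> (complex ^ 'k) set) \<Rightarrow> bool" where
  "is_cycle \<mu> l F \<longleftrightarrow>
     l \<ge> 1 \<and>
     (\<forall>i\<in>{1..l}. vec.subspace (F i) \<and> F i \<subseteq> erg_space \<mu>) \<and>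
     (\<forall>i\<in>{1..l}. \<forall>j\<in>{1..l}. i \<noteq> j \<longrightarrow> orth_spaces (F i) (F j)) \<and>
     erg_space \<mu> = {\<Sum>i=1..l. x i | x. \<forall>i\<in>{1..l}. x i \<in> F i} \<and>
     (AE v in \<mu>. \<forall>i\<in>{1..l}. (*v) v ` F i \<subseteq> F (if i = l then 1 else i + 1))"

definition period :: "(complex ^ 'k ^ 'k) measure \<Rightarrow> nat" where
  "period \<mu> = Max {l. \<exists>F. is_cycle \<mu> l F}"

end

theory Submission
  imports Defs "HOL-Complex_Analysis.Great_Picard"
begin

text \<open>
A function on projective space is extended to a function of degree two, so that \<open>\<Pi>\<close> becomes
\<open>F \<mapsto> (\<lambda>x. \<integral> F (v x) d\<mu>)\<close> and no product measures are needed. Iterating the same operator on pairs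
of vectors, starting with the area of the parallelogram they span, gives a sequence that decreases by
Cauchy--Schwarz; (Pur) says that it falls strictly below the initial value for every pair, and
compactness makes this uniform, so the averaged areas tend to zero. By Hoelder's inequality this
contraction yields a Doeblin--Fortet inequality, hence, with Arzela--Ascoli, spectral values of modulus
one are eigenvalues. The same contraction, applied to linear combinations of values of an
eigenfunction that vanish on all quadratic forms, shows that peripheral eigenfunctions are
quadratic forms \<open>\<langle>x, A x\<rangle>\<close>.

The space where \<open>A\<close> attains its norm is invariant, so it contains the space \<open>E\<close> of (Erg), and there
\<open>A\<close> is a multiple of an isometry with \<open>A v = z v A\<close> for all \<open>v\<close> in the support of \<open>\<mu>\<close>. The \<open>z\<close> admitting
such an isometry form a finite group, hence the group of all \<open>n\<close>-th roots of unity for some \<open>n\<close>; the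
eigenspaces of the isometries are cycles, and conversely a cycle of length \<open>l\<close> defines such an isometry
for \<open>z = exp (2 \<pi> \<i> / l)\<close>, so \<open>n\<close> is the period. Finally each such \<open>z\<close> is in the spectrum, because
the partial sums of the resolvent series of \<open>\<langle>x, U x\<rangle>\<close> grow linearly on \<open>E\<close>.
\<close>

section \<open>The Hermitian inner product\<close>

text \<open>As \<open>\<mu>\<close> need not be sigma-finite, Fubini's theorem does not apply to
  words v_n ... v_1. Almost-sure statements are therefore moved to the topological support, where
  closed conditions hold for every matrix and can be followed along a word one letter at a time;
  \<open>tensor_power\<close> enters only where (Pur) is contradicted.

  The area of x, y is d(x, y) |x| |y|, and increments of the extension are bounded by m
  area^\<alpha> (|x| |y|)^(1 - \<alpha>) + s |x - y| |x + y|. Every ingredient survives averaging: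
  |x| |y| and |x - y| |x + y| by Cauchy--Schwarz, since sums and differences are mapped linearly,
  and the geometric mean by Hoelder. So the iterates keep m and s, and only the area improves. For
  unit vectors with nonnegative inner product |x - y| |x + y| is twice the area; this is the origin
  of the term 2 s.

  The unit circle is treated without spectral projections: if there is no eigenfunction, compactness
  gives a lower bound for z - T, and Cesaro means of Neumann sums give surjectivity.\<close>

lemma cinner_add_left: "cinner (x + y) z = cinner x z + cinner y z"
  and cinner_add_right: "cinner x (y + z) = cinner x y + cinner x z"
  and cinner_diff_left: "cinner (x - y) z = cinner x z - cinner y z"
  and cinner_diff_right: "cinner x (y - z) = cinner x y - cinner x z"
  by (simp_all add: cinner_def algebra_simps sum.distrib sum_subtractf)

lemma cinner_scale_left: "cinner (c *s x) y = cnj c * cinner x y"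
  and cinner_scale_right: "cinner x (c *s y) = c * cinner x y"
  by (simp_all add: cinner_def sum_distrib_left algebra_simps)

lemma cinner_zero_left [simp]: "cinner 0 x = 0"
  and cinner_zero_right [simp]: "cinner x 0 = 0"
  by (simp_all add: cinner_def)

lemma cnj_cinner: "cnj (cinner x y) = cinner y x"
  by (simp add: cinner_def mult.commute)

lemma Re_cinner: "Re (cinner x y) = inner x y"
  by (simp add: cinner_def inner_vec_def inner_complex_def)

lemma cinner_self: "cinner x x = of_real ((norm x)\<^sup>2)"
proof (rule complex_eqI)
  show "Re (cinner x x) = Re (of_real ((norm x)\<^sup>2))"
    by (simp add: Re_cinner power2_norm_eq_inner)
  have "Im (cinner x x) = 0"
    using arg_cong[OF cnj_cinner[of x x], of Im] by simp
  then show "Im (cinner x x) = Im (of_real ((norm x)\<^sup>2))" by simp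
qed

lemma cinner_self_eq_0_iff: "cinner x x = 0 \<longleftrightarrow> x = 0"
  by (simp add: cinner_self)

lemma norm_vector_smult: "norm (c *s x) = cmod c * norm (x :: complex ^ 'k)"
proof -
  have "complex_of_real ((norm (c *s x))\<^sup>2) = c * cnj c * cinner x x"
    unfolding cinner_self[symmetric] by (simp add: cinner_scale_left cinner_scale_right)
  also have "\<dots> = of_real ((cmod c * norm x)\<^sup>2)"
    unfolding complex_norm_square[symmetric] cinner_self by (simp add: power_mult_distrib)
  finally have "(norm (c *s x))\<^sup>2 = (cmod c * norm x)\<^sup>2"
    using of_real_eq_iff by blast
  then show ?thesis by (simp add: power2_eq_iff_nonneg)
qed

lemma vector_smult_eq_0_iff: "c *s x = 0 \<longleftrightarrow> c = 0 \<or> x = (0 :: complex ^ 'k)"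
  by (metis norm_eq_zero norm_vector_smult mult_eq_0_iff)

lemma of_real_smult: "complex_of_real r *s x = r *\<^sub>R x"
  by (simp add: vec_eq_iff) (simp add: scaleR_conv_of_real)

lemma norm_add_squared:
  "(norm (x + y))\<^sup>2 = (norm x)\<^sup>2 + (norm y)\<^sup>2 + 2 * Re (cinner x y)" for x y :: "complex ^ 'k"
  unfolding Re_cinner power2_norm_eq_inner by (simp add: inner_add_left inner_add_right inner_commute)

lemma norm_diff_squared:
  "(norm (x - y))\<^sup>2 = (norm x)\<^sup>2 + (norm y)\<^sup>2 - 2 * Re (cinner x y)" for x y :: "complex ^ 'k"
  unfolding Re_cinner power2_norm_eq_inner by (simp add: inner_diff_left inner_diff_right inner_commute)

lemma phase_exists: "\<exists>c. cmod c = 1 \<and> cinner x (c *s y) = of_real (cmod (cinner x y))"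
proof (cases "cinner x y = 0")
  case False
  then have "cmod (cnj (sgn (cinner x y))) = 1" by (simp add: norm_sgn)
  moreover have "cnj (sgn (cinner x y)) * cinner x y = of_real (cmod (cinner x y))"
    using False by (simp add: sgn_eq complex_norm_square[symmetric] power2_eq_square mult.commute[of "cnj _"])
  ultimately show ?thesis by (metis cinner_scale_right)
qed (auto simp: cinner_scale_right intro: exI[of _ 1])

lemma cmod_cinner_le: "cmod (cinner x y) \<le> norm x * norm y"
proof -
  obtain c where c: "cmod c = 1" "cinner x (c *s y) = of_real (cmod (cinner x y))"
    using phase_exists by blast
  have "cmod (cinner x y) = inner x (c *s y)"
    using c(2) by (simp flip: Re_cinner)
  also have "\<dots> \<le> norm x * norm (c *s y)" by (rule norm_cauchy_schwarz)
  finally show ?thesis using c(1) by (simp add: norm_vector_smult)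
qed

lemma cinner_adj: "cinner (adj A *v x) y = cinner x (A *v y)"
proof -
  have "cinner (adj A *v x) y = (\<Sum>i\<in>UNIV. \<Sum>j\<in>UNIV. A $ j $ i * cnj (x $ j) * y $ i)"
    by (simp add: cinner_def adj_def matrix_vector_mult_def sum_distrib_right)
  also have "\<dots> = (\<Sum>j\<in>UNIV. \<Sum>i\<in>UNIV. A $ j $ i * cnj (x $ j) * y $ i)" by (rule sum.swap)
  also have "\<dots> = cinner x (A *v y)"
    by (simp add: cinner_def matrix_vector_mult_def sum_distrib_left mult_ac)
  finally show ?thesis .
qed

lemma adj_adj [simp]: "adj (adj A) = A"
  by (simp add: adj_def vec_eq_iff)

lemma cinner_ext: "(\<And>x. cinner x y = cinner x z) \<Longrightarrow> y = z"
proof -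
  assume "\<And>x. cinner x y = cinner x z"
  then have "cinner (y - z) (y - z) = 0" by (simp add: cinner_diff_right)
  then show "y = z" by (simp add: cinner_self_eq_0_iff)
qed

lemma mat_mult_vector: "(mat c ** A) *v x = c *s (A *v x)" for A :: "complex ^ 'k ^ 'k"
proof -
  have "mat c *v y = c *s y" for y :: "complex ^ 'k"
    by (simp add: matrix_vector_mult_def mat_def vec_eq_iff if_distrib if_distribR cong: if_cong)
  then show ?thesis by (simp add: matrix_vector_mul_assoc[symmetric])
qed

lemma norm_matrix_vector_le: "norm (A *v x) \<le> norm A * norm (x :: complex ^ 'k)"
  for A :: "complex ^ 'k ^ 'm"
proof -
  have "cmod ((A *v x) $ i) \<le> norm (A $ i) * norm x" for i
  proof -
    have "(A *v x) $ i = cinner (\<chi> j. cnj (A $ i $ j)) x"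
      by (simp add: matrix_vector_mult_def cinner_def)
    moreover have "norm (\<chi> j. cnj (A $ i $ j)) = norm (A $ i)" by (simp add: norm_vec_def)
    ultimately show ?thesis by (metis cmod_cinner_le)
  qed
  then have "norm (A *v x) \<le> L2_set (\<lambda>i. norm (A $ i) * norm x) UNIV"
    unfolding norm_vec_def[of "A *v x"] by (intro L2_set_mono) auto
  also have "\<dots> = norm A * norm x"
    by (simp add: norm_vec_def L2_set_left_distrib flip: L2_set_left_distrib)
  finally show ?thesis .
qed

lemma norm_matrix_squared: "(norm A)\<^sup>2 = (\<Sum>i\<in>UNIV. (norm (A *v axis i 1))\<^sup>2)"
  for A :: "complex ^ 'k ^ 'm"
proof -
  have "(norm A)\<^sup>2 = (\<Sum>j\<in>UNIV. \<Sum>i\<in>UNIV. (cmod (A $ j $ i))\<^sup>2)"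
    by (simp add: norm_vec_def L2_set_def sum_nonneg)
  also have "\<dots> = (\<Sum>i\<in>UNIV. \<Sum>j\<in>UNIV. (cmod (A $ j $ i))\<^sup>2)" by (rule sum.swap)
  also have "\<dots> = (\<Sum>i\<in>UNIV. (norm (A *v axis i 1))\<^sup>2)"
    by (simp add: norm_vec_def L2_set_def sum_nonneg matrix_vector_mult_def axis_def if_distrib cong: if_cong)
  finally show ?thesis .
qed

lemma continuous_on_cinner [continuous_intros]:
  "continuous_on S f \<Longrightarrow> continuous_on S g \<Longrightarrow> continuous_on S (\<lambda>x. cinner (f x) (g x))"
  unfolding cinner_def by (intro continuous_intros) auto

lemma continuous_on_matrix_vector_mult [continuous_intros]:
  fixes f :: "'a :: topological_space \<Rightarrow> complex ^ 'k ^ 'm"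
  shows "continuous_on S f \<Longrightarrow> continuous_on S g \<Longrightarrow> continuous_on S (\<lambda>x. f x *v g x)"
  unfolding matrix_vector_mult_def by (intro continuous_intros) auto

lemma continuous_on_smult [continuous_intros]:
  fixes f :: "'a :: topological_space \<Rightarrow> complex ^ 'k"
  shows "continuous_on S c \<Longrightarrow> continuous_on S f \<Longrightarrow> continuous_on S (\<lambda>x. c x *s f x)"
  unfolding vector_scalar_mult_def by (intro continuous_intros) auto

section \<open>The norm of the wedge product\<close>

definition wedge :: "complex ^ 'k \<Rightarrow> complex ^ 'k \<Rightarrow> complex ^ 'k ^ 'k" where
  "wedge x y = (\<chi> i j. x $ i * y $ j - x $ j * y $ i)"

text \<open>The entries of \<open>wedge\<close> are the Pluecker coordinates, each occurring twice
  up to sign, hence the factor \<open>sqrt 2\<close>. As a norm of a bilinear expression the area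
  inherits the triangle inequality.\<close>

definition area :: "complex ^ 'k \<Rightarrow> complex ^ 'k \<Rightarrow> real" where
  "area x y = norm (wedge x y) / sqrt 2"

text \<open>Lagrange's identity: the squared area is the Gram determinant.\<close>

lemma area_squared: "(area x y)\<^sup>2 = (norm x)\<^sup>2 * (norm y)\<^sup>2 - (cmod (cinner x y))\<^sup>2"
proof -
  have "complex_of_real ((norm (wedge x y))\<^sup>2)
      = (\<Sum>i\<in>UNIV. \<Sum>j\<in>UNIV. (x $ i * y $ j - x $ j * y $ i) * cnj (x $ i * y $ j - x $ j * y $ i))"
    unfolding complex_norm_square[symmetric]
    by (simp add: norm_vec_def L2_set_def sum_nonneg wedge_def)
  also have "\<dots> = (\<Sum>i\<in>UNIV. \<Sum>j\<in>UNIV. (cnj (x $ i) * x $ i) * (cnj (y $ j) * y $ j)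
        + (cnj (y $ i) * y $ i) * (cnj (x $ j) * x $ j)
        - (cnj (y $ i) * x $ i) * (cnj (x $ j) * y $ j) - (cnj (x $ i) * y $ i) * (cnj (y $ j) * x $ j))"
    by (intro sum.cong refl) (simp add: algebra_simps)
  also have "\<dots> = cinner x x * cinner y y + cinner y y * cinner x x
      - cinner y x * cinner x y - cinner x y * cinner y x"
    by (simp add: cinner_def sum_product sum.distrib sum_subtractf)
  also have "\<dots> = 2 * (cinner x x * cinner y y - cinner x y * cnj (cinner x y))"
    by (simp add: cnj_cinner algebra_simps)
  also have "\<dots> = of_real (2 * ((norm x)\<^sup>2 * (norm y)\<^sup>2 - (cmod (cinner x y))\<^sup>2))"
    by (simp add: cinner_self complex_norm_square del: of_real_power)
  finally have "(norm (wedge x y))\<^sup>2 = 2 * ((norm x)\<^sup>2 * (norm y)\<^sup>2 - (cmod (cinner x y))\<^sup>2)"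
    using of_real_eq_iff by blast
  then show ?thesis by (simp add: area_def power_divide)
qed

lemma area_nonneg [simp]: "area x y \<ge> 0"
  by (simp add: area_def)

lemma area_le: "area x y \<le> norm x * norm y"
  by (rule power2_le_imp_le) (simp_all add: area_squared power_mult_distrib)

lemma area_orthogonal: "cinner x y = 0 \<Longrightarrow> area x y = norm x * norm y"
  by (rule power2_eq_imp_eq) (simp_all add: area_squared power_mult_distrib)

lemma area_scale: "area (c *s x) (d *s y) = cmod c * cmod d * area x y"
  by (rule power2_eq_imp_eq)
    (simp_all add: area_squared power_mult_distrib norm_vector_smult cinner_scale_left cinner_scale_right norm_mult
      algebra_simps)

lemma area_commute: "area x y = area y x"
  by (rule power2_eq_imp_eq) (simp_all add: area_squared mult.commute cnj_cinner[of y x, symmetric])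

lemma area_add_left: "area (x + y) z \<le> area x z + area y z"
proof -
  have "wedge (x + y) z = wedge x z + wedge y z"
    by (simp add: wedge_def vec_eq_iff algebra_simps)
  then show ?thesis
    using norm_triangle_ineq[of "wedge x z" "wedge y z"]
    by (simp add: area_def add_divide_distrib[symmetric] divide_right_mono)
qed

lemma area_zero [simp]: "area 0 x = 0" "area x 0 = 0"
  by (simp_all add: area_def wedge_def vec_eq_iff flip: zero_vec_def)

lemma area_sum_left: "area (\<Sum>i\<in>I. f i) y \<le> (\<Sum>i\<in>I. area (f i) y)"
  by (induction I rule: infinite_finite_induct) (auto intro: order_trans[OF area_add_left])

lemma area_shear: "area x (y + c *s x) = area x y"
  by (simp add: area_def wedge_def algebra_simps)

lemma area_self [simp]: "area x x = 0"
  using area_shear[of x 0 1] by simp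

lemma continuous_on_area [continuous_intros]:
  "continuous_on S f \<Longrightarrow> continuous_on S g \<Longrightarrow> continuous_on S (\<lambda>x. area (f x) (g x))"
  unfolding area_def wedge_def by (intro continuous_intros) auto

text \<open>The squares of the two norms are 2 - 2t and 2 + 2t, with product 4 (1 - t^2). Since a
  phase makes any inner product real, this product measures projective distance.\<close>

lemma norm_diff_mult_norm_add:
  assumes "norm x = 1" "norm y = 1" "cinner x y = of_real t"
  shows "norm (x - y) * norm (x + y) = 2 * area x y"
proof (rule power2_eq_imp_eq)
  have "(norm (x - y) * norm (x + y))\<^sup>2 = (2 - 2 * t) * (2 + 2 * t)"
    by (simp add: power_mult_distrib norm_add_squared norm_diff_squared assms)
  also have "\<dots> = (2 * area x y)\<^sup>2"
    by (simp add: power_mult_distrib area_squared assms) (simp add: algebra_simps power2_eq_square)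
  finally show "(norm (x - y) * norm (x + y))\<^sup>2 = (2 * area x y)\<^sup>2" .
qed auto

lemma norm_diff_le_area:
  assumes "norm x = 1" "norm y = 1" "cinner x y = of_real t" "t \<ge> 0"
  shows "norm (x - y) \<le> 2 * area x y"
proof -
  have "(norm (x + y))\<^sup>2 = 2 + 2 * t" using assms by (simp add: norm_add_squared)
  then have "1 \<le> norm (x + y)"
    using assms(4) by (intro power2_le_imp_le[of 1]) auto
  then have "norm (x - y) * 1 \<le> norm (x - y) * norm (x + y)" by (intro mult_left_mono) auto
  then show ?thesis using norm_diff_mult_norm_add[OF assms(1-3)] by simp
qed

text \<open>The chain area <= |x| |y| <= mean of the squares is tight: the second step forces equal
  norms, the first orthogonality.\<close>

lemma area_eq_mean_imp:
  assumes "area x y = ((norm x)\<^sup>2 + (norm y)\<^sup>2) / 2"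
  shows "norm x = norm y" "cinner x y = 0"
proof -
  have "(norm x - norm y)\<^sup>2 \<le> 0"
    using assms area_le[of x y] by (simp add: power2_diff)
  then show *: "norm x = norm y" by simp
  have "(norm x * norm y)\<^sup>2 = (area x y)\<^sup>2" using assms * by (simp add: power2_eq_square)
  then show "cinner x y = 0" by (simp add: area_squared power_mult_distrib)
qed

section \<open>Projective space\<close>

lemma abs_proj_eq_iff:
  fixes x y :: "complex ^ 'k"
  assumes "x \<noteq> 0" "y \<noteq> 0"
  shows "abs_proj x = abs_proj y \<longleftrightarrow> (\<exists>c. c \<noteq> 0 \<and> y = c *s x)"
proof -
  have r: "proj_rel z z" if "z \<noteq> 0" for z :: "complex ^ 'k"
    using that by (auto simp: proj_rel_def intro!: exI[of _ 1])
  have "abs_proj x = abs_proj y \<longleftrightarrow> proj_rel x y"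
    using Quotient_rel[OF Quotient_proj, of x y] r[OF assms(1)] r[OF assms(2)] by blast
  then show ?thesis using assms by (auto simp: proj_rel_def)
qed

lemma abs_proj_scale: "c \<noteq> 0 \<Longrightarrow> x \<noteq> 0 \<Longrightarrow> abs_proj (c *s x) = abs_proj x"
  using abs_proj_eq_iff[of x "c *s x"] by (auto simp: vector_smult_eq_0_iff)

lemma norm_unit_rep [simp]: "norm (unit_rep X) = 1"
  and abs_proj_unit_rep [simp]: "abs_proj (unit_rep X) = X"
  by (simp_all add: unit_rep)

lemma unit_rep_nonzero [simp]: "unit_rep X \<noteq> 0"
  using norm_unit_rep[of X] by (metis norm_zero zero_neq_one)

lemma unit_rep_abs_proj:
  fixes x :: "complex ^ 'k"
  assumes "x \<noteq> 0"
  obtains c where "c \<noteq> 0" "x = c *s unit_rep (abs_proj x)" "cmod c = norm x"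
proof -
  obtain c where c: "c \<noteq> 0" "x = c *s unit_rep (abs_proj x)"
    using abs_proj_eq_iff[of "unit_rep (abs_proj x)" x] assms by auto
  moreover have "cmod c = norm x"
    using arg_cong[OF c(2), of norm] by (simp add: norm_vector_smult)
  ultimately show ?thesis using that by blast
qed

lemma proj_dist_eq_area: "proj_dist X Y = area (unit_rep X) (unit_rep Y)"
  unfolding proj_dist_def by (rule real_sqrt_unique) (simp_all add: area_squared)

lemma proj_dist_abs_proj:
  assumes "x \<noteq> 0" "y \<noteq> 0"
  shows "proj_dist (abs_proj x) (abs_proj y) = area x y / (norm x * norm y)"
proof -
  obtain c where c: "c \<noteq> 0" "x = c *s unit_rep (abs_proj x)" "cmod c = norm x"
    using unit_rep_abs_proj[OF assms(1)] .
  obtain d where d: "d \<noteq> 0" "y = d *s unit_rep (abs_proj y)" "cmod d = norm y"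
    using unit_rep_abs_proj[OF assms(2)] .
  have "area x y = cmod c * cmod d * area (unit_rep (abs_proj x)) (unit_rep (abs_proj y))"
    using area_scale c(2) d(2) by metis
  then show ?thesis using assms by (simp add: proj_dist_eq_area c(3) d(3))
qed

lemma proj_dist_nonneg [simp]: "0 \<le> proj_dist X Y"
  by (simp add: proj_dist_eq_area)

lemma proj_dist_le_1: "proj_dist X Y \<le> 1"
  using area_le[of "unit_rep X" "unit_rep Y"] by (simp add: proj_dist_eq_area)

lemma proj_dist_self [simp]: "proj_dist X X = 0"
  by (simp add: proj_dist_eq_area)

lemma proj_dist_eq_0_iff: "proj_dist X Y = 0 \<longleftrightarrow> X = Y"
proof
  assume *: "proj_dist X Y = 0"
  obtain c where c: "cmod c = 1"
    "cinner (unit_rep X) (c *s unit_rep Y) = of_real (cmod (cinner (unit_rep X) (unit_rep Y)))"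
    using phase_exists by blast
  have "norm (unit_rep X - c *s unit_rep Y) \<le> 2 * area (unit_rep X) (c *s unit_rep Y)"
    by (rule norm_diff_le_area[OF _ _ c(2)]) (simp_all add: norm_vector_smult c)
  also have "area (unit_rep X) (c *s unit_rep Y) = 0"
    using area_scale[of 1 "unit_rep X" c "unit_rep Y"] * by (simp add: proj_dist_eq_area)
  finally have "unit_rep X = c *s unit_rep Y" by simp
  moreover have "c \<noteq> 0" using c(1) by auto
  ultimately show "X = Y"
    by (metis abs_proj_scale abs_proj_unit_rep unit_rep_nonzero)
qed simp

section \<open>Weighted geometric means\<close>

lemma weighted_am_gm:
  fixes a b :: real
  assumes "0 < \<alpha>" "\<alpha> \<le> 1" "0 \<le> a" "0 \<le> b"
  shows "a powr \<alpha> * b powr (1 - \<alpha>) \<le> \<alpha> * a + (1 - \<alpha>) * b"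
proof (cases "a = 0 \<or> b = 0")
  case False
  then show ?thesis using Youngs_inequality_0[of \<alpha> "1 - \<alpha>" a b] assms by simp
qed (use assms in auto)

text \<open>Hoelder's inequality with exponents 1/\<alpha> and 1/(1 - \<alpha>), by weighted AM-GM
  after division by the bounds. Bounds \<open>A\<close>, \<open>B\<close> in place of the exact
  integrals let it be applied where only inequalities are known.\<close>

lemma
  fixes a b :: "'a \<Rightarrow> real"
  assumes \<alpha>: "0 < \<alpha>" "\<alpha> \<le> 1"
    and int: "integrable M a" "integrable M b"
    and nonneg: "\<And>x. 0 \<le> a x" "\<And>x. 0 \<le> b x"
  shows integrable_geometric_mean: "integrable M (\<lambda>x. a x powr \<alpha> * b x powr (1 - \<alpha>))"
    and integral_geometric_mean_le: "(LINT x|M. a x) \<le> A \<Longrightarrow> (LINT x|M. b x) \<le> B \<Longrightarrow>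
      (LINT x|M. a x powr \<alpha> * b x powr (1 - \<alpha>)) \<le> A powr \<alpha> * B powr (1 - \<alpha>)"
proof -
  have [measurable]: "a \<in> borel_measurable M" "b \<in> borel_measurable M"
    using int by auto
  show i: "integrable M (\<lambda>x. a x powr \<alpha> * b x powr (1 - \<alpha>))"
  proof (rule Bochner_Integration.integrable_bound)
    show "integrable M (\<lambda>x. \<alpha> * a x + (1 - \<alpha>) * b x)" using int by auto
    show "AE x in M. norm (a x powr \<alpha> * b x powr (1 - \<alpha>)) \<le> norm (\<alpha> * a x + (1 - \<alpha>) * b x)"
    proof (rule AE_I2)
      fix x
      show "norm (a x powr \<alpha> * b x powr (1 - \<alpha>)) \<le> norm (\<alpha> * a x + (1 - \<alpha>) * b x)"
        using weighted_am_gm[OF \<alpha> nonneg(1)[of x] nonneg(2)[of x]] by simp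
    qed
  qed measurable
  assume A: "(LINT x|M. a x) \<le> A" and B: "(LINT x|M. b x) \<le> B"
  have A0: "0 \<le> (LINT x|M. a x)" and B0: "0 \<le> (LINT x|M. b x)"
    using nonneg by (auto intro!: Bochner_Integration.integral_nonneg)
  show "(LINT x|M. a x powr \<alpha> * b x powr (1 - \<alpha>)) \<le> A powr \<alpha> * B powr (1 - \<alpha>)"
  \<comment> \<open>The normalisation divides by \<open>A\<close> and \<open>B\<close>. If one of
    them is 0, the integrand vanishes almost everywhere; for \<alpha> = 1 this relies on
    \<open>0 powr 0 = 0\<close>.\<close>
  proof (cases "A = 0 \<or> B = 0")
    case True
    have "AE x in M. a x powr \<alpha> * b x powr (1 - \<alpha>) = 0"
    proof (cases "A = 0")
      case True
      then have "(LINT x|M. a x) = 0" using A A0 by linarith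
      then have "AE x in M. a x = 0"
        using integral_nonneg_eq_0_iff_AE[OF int(1)] nonneg by simp
      then show ?thesis by eventually_elim auto
    next
      case False
      then have "(LINT x|M. b x) = 0" using \<open>A = 0 \<or> B = 0\<close> B B0 by linarith
      then have "AE x in M. b x = 0"
        using integral_nonneg_eq_0_iff_AE[OF int(2)] nonneg by simp
      then show ?thesis by eventually_elim auto
    qed
    then have "(LINT x|M. a x powr \<alpha> * b x powr (1 - \<alpha>)) = 0"
      by (rule integral_eq_zero_AE)
    then show ?thesis by simp
  next
    case False
    then have pos: "A > 0" "B > 0" using A A0 B B0 by auto
    define K where "K = A powr \<alpha> * B powr (1 - \<alpha>)"
    have K: "K \<ge> 0" by (simp add: K_def)
    have "(LINT x|M. a x powr \<alpha> * b x powr (1 - \<alpha>)) \<le>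
        (LINT x|M. K * (\<alpha> * (a x / A) + (1 - \<alpha>) * (b x / B)))"
    proof (rule integral_mono[OF i])
      show "integrable M (\<lambda>x. K * (\<alpha> * (a x / A) + (1 - \<alpha>) * (b x / B)))"
        using int by auto
      fix x
      have "a x powr \<alpha> * b x powr (1 - \<alpha>) = K * ((a x / A) powr \<alpha> * (b x / B) powr (1 - \<alpha>))"
        using pos nonneg by (simp add: K_def powr_divide)
      also have "\<dots> \<le> K * (\<alpha> * (a x / A) + (1 - \<alpha>) * (b x / B))"
        using pos nonneg \<alpha> by (intro mult_left_mono K weighted_am_gm) auto
      finally show "a x powr \<alpha> * b x powr (1 - \<alpha>) \<le> K * (\<alpha> * (a x / A) + (1 - \<alpha>) * (b x / B))" .
    qed
    also have "\<dots> = K * (\<alpha> * ((LINT x|M. a x) / A) + (1 - \<alpha>) * ((LINT x|M. b x) / B))"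
      using int by simp
    also have "\<dots> \<le> K * (\<alpha> * 1 + (1 - \<alpha>) * 1)"
      using pos A B \<alpha> by (intro mult_left_mono add_mono K) auto
    finally show ?thesis by (simp add: K_def)
  qed
qed

section \<open>The topological support\<close>

definition msupport :: "'a::topological_space measure \<Rightarrow> 'a set" where
  "msupport M = {x. \<forall>U. open U \<longrightarrow> x \<in> U \<longrightarrow> emeasure M U \<noteq> 0}"

lemma compl_msupport: "- msupport M = \<Union>{U. open U \<and> emeasure M U = 0}"
  by (auto simp: msupport_def)

lemma closed_msupport: "closed (msupport M)"
  unfolding closed_def compl_msupport by auto

text \<open>By Lindeloef's theorem the complement is a countable union of open null sets.\<close>

lemma AE_msupport:
  fixes M :: "'a::second_countable_topology measure"
  assumes "sets M = sets borel"
  shows "AE x in M. x \<in> msupport M"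
proof -
  obtain \<F> where \<F>: "\<F> \<subseteq> {U. open U \<and> emeasure M U = 0}" "countable \<F>"
    "\<Union>\<F> = \<Union>{U. open U \<and> emeasure M U = 0}"
    using Lindelof[of "{U. open U \<and> emeasure M U = 0}"] by blast
  have "(\<Union>U\<in>\<F>. U) \<in> null_sets M"
    using \<F> assms by (intro null_sets_UN' \<F>) (auto simp: null_sets_def)
  moreover have "(\<Union>U\<in>\<F>. U) = - msupport M" using \<F>(3) by (simp add: compl_msupport)
  ultimately have "AE x in M. x \<notin> - msupport M" by (metis AE_not_in)
  then show ?thesis by simp
qed

text \<open>An open null set misses the support by definition. This replaces exceptional sets, which
  cannot be tracked along uncountably many vectors, by one fixed set of matrices.\<close>

lemma AE_closed_iff:
  fixes M :: "'a::second_countable_topology measure"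
  assumes "sets M = sets borel" "closed {x. P x}"
  shows "(AE x in M. P x) \<longleftrightarrow> (\<forall>x\<in>msupport M. P x)"
proof
  assume "AE x in M. P x"
  moreover have "{x \<in> space M. \<not> P x} = - {x. P x}"
    using sets_eq_imp_space_eq[OF assms(1)] by auto
  moreover have "- {x. P x} \<in> sets M" using assms by auto
  ultimately have "emeasure M (- {x. P x}) = 0"
    using AE_iff_measurable by blast
  then show "\<forall>x\<in>msupport M. P x"
    using assms(2) unfolding msupport_def closed_def by blast
next
  assume "\<forall>x\<in>msupport M. P x"
  then show "AE x in M. P x" using AE_msupport[OF assms(1)] by auto
qed

text \<open>The criterion holds even where the iterated integral fails to define a measure: the library's
  product then is the zero measure.\<close>

lemma emeasure_pair_measure_eq_0I:
  assumes "X \<in> sets (A \<Otimes>\<^sub>M B)" "AE x in A. AE y in B. (x, y) \<notin> X"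
  shows "emeasure (A \<Otimes>\<^sub>M B) X = 0"
proof -
  have "(\<integral>\<^sup>+y. indicator X (x, y) \<partial>B) = 0" if "AE y in B. (x, y) \<notin> X" for x
  proof -
    have "(\<integral>\<^sup>+y. indicator X (x, y) \<partial>B) = (\<integral>\<^sup>+y. 0 \<partial>B)"
      by (rule nn_integral_cong_AE) (use that in eventually_elim, auto)
    then show ?thesis by simp
  qed
  then have "(\<integral>\<^sup>+x. (\<integral>\<^sup>+y. indicator X (x, y) \<partial>B) \<partial>A) = (\<integral>\<^sup>+x. 0 \<partial>A)"
    using assms(2) by (intro nn_integral_cong_AE) (auto elim: eventually_mono)
  then show ?thesis
    unfolding pair_measure_def emeasure_measure_of_conv by simp
qed

lemma sets_tensor_power: "sets (tensor_power M n) = sets (PiM {1..n} (\<lambda>_. M))"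
  by (cases n) simp_all

text \<open>In place of Fubini's theorem: when a tuple is extended by one entry, the exceptional set
  has null sections over almost every shorter tuple.\<close>

lemma AE_tensor_power:
  assumes "A \<in> sets M" "AE x in M. x \<in> A"
  shows "AE v in tensor_power M n. \<forall>i\<in>{1..n}. v i \<in> A"
proof (induction n)
  case (Suc n)
  let ?P = "tensor_power M n \<Otimes>\<^sub>M M" and ?N = "PiM {1..Suc n} (\<lambda>_. M)"
  let ?f = "\<lambda>(w, v). w(Suc n := v)"
  have ins: "{1..Suc n} = insert (Suc n) {1..n}" by auto
  have f: "?f \<in> ?P \<rightarrow>\<^sub>M ?N"
  proof -
    have "?f \<in> (PiM {1..n} (\<lambda>_. M) \<Otimes>\<^sub>M M) \<rightarrow>\<^sub>M ?N"
      unfolding ins by (rule measurable_add_dim)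
    then show ?thesis
      by (subst measurable_cong_sets[OF sets_pair_measure_cong[OF sets_tensor_power refl] refl])
  qed
  have [measurable]: "A \<in> sets M" by fact
  have m: "{w \<in> space ?N. \<forall>i\<in>{1..Suc n}. w i \<in> A} \<in> sets ?N"
    by measurable
  have m1: "{w \<in> space ?N. \<not> (\<forall>i\<in>{1..Suc n}. w i \<in> A)} \<in> sets ?N"
    by measurable
  have X: "{p \<in> space ?P. \<not> (\<forall>i\<in>{1..Suc n}. ?f p i \<in> A)} \<in> sets ?P" (is "?X \<in> _")
    using measurable_sets[OF f m1] measurable_space[OF f]
    by (simp add: vimage_def Collect_conj_eq[symmetric] Int_def conj_commute cong: conj_cong)
  have "AE w in tensor_power M n. AE v in M. (w, v) \<notin> ?X"
    using Suc.IH
  proof eventually_elim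
    case (elim w)
    show ?case using assms(2) by eventually_elim (use elim in auto)
  qed
  then have "emeasure ?P ?X = 0" by (rule emeasure_pair_measure_eq_0I[OF X])
  then have "AE p in ?P. \<forall>i\<in>{1..Suc n}. ?f p i \<in> A"
    using AE_iff_measurable[OF X refl] by simp
  then show ?case
    unfolding tensor_power.simps by (subst AE_distr_iff[OF f m])
qed simp

section \<open>Integration against a normalised measure on matrices\<close>

locale normalized =
  fixes \<mu> :: "(complex ^ 'k ^ 'k) measure"
  assumes sets_mu: "sets \<mu> = sets borel"
    and normalization: "(LINT v|\<mu>. adj v ** v) = mat 1"
begin

lemma measurable_continuous:
  fixes f :: "complex ^ 'k ^ 'k \<Rightarrow> 'b :: topological_space"
  shows "continuous_on UNIV f \<Longrightarrow> f \<in> borel_measurable \<mu>"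
  by (subst measurable_cong_sets[OF sets_mu refl]) (rule borel_measurable_continuous_onI)

text \<open>The integral of a non-integrable function is the default value 0, which differs from
  \<open>mat 1\<close>.\<close>

lemma integrable_adj_mult: "integrable \<mu> (\<lambda>v. adj v ** v)"
proof (rule ccontr)
  assume "\<not> ?thesis"
  then have "(mat 1 :: complex ^ 'k ^ 'k) = 0"
    using normalization by (simp add: not_integrable_integral_eq)
  then have "(mat 1 :: complex ^ 'k ^ 'k) $ i $ i = 0" for i by simp
  then show False by (simp add: mat_def)
qed

text \<open>For fixed vectors the integrand is a bounded real-linear functional of
  \<open>adj v ** v\<close>, so the matrix identity passes to all Hermitian products.\<close>

lemma integrable_cinner: "integrable \<mu> (\<lambda>v. cinner (v *v x) (v *v y))"
  and integral_cinner: "(LINT v|\<mu>. cinner (v *v x) (v *v y)) = cinner x y"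
proof -
  have l: "linear (\<lambda>A :: complex ^ 'k ^ 'k. cinner x (A *v y))"
  proof
    fix A B :: "complex ^ 'k ^ 'k" and r :: real
    show "cinner x ((A + B) *v y) = cinner x (A *v y) + cinner x (B *v y)"
      by (simp add: matrix_vector_mult_add_rdistrib cinner_add_right)
    have "(r *\<^sub>R A) *v y = complex_of_real r *s (A *v y)"
      unfolding of_real_smult
      by (simp add: matrix_vector_mult_def vec_eq_iff scaleR_sum_right)
    then show "cinner x ((r *\<^sub>R A) *v y) = r *\<^sub>R cinner x (A *v y)"
      by (simp add: cinner_scale_right scaleR_conv_of_real)
  qed
  then have bl: "bounded_linear (\<lambda>A :: complex ^ 'k ^ 'k. cinner x (A *v y))"
    by (simp add: linear_conv_bounded_linear)
  have eq: "cinner (v *v x) (v *v y) = cinner x ((adj v ** v) *v y)" for v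
    using cinner_adj[of "adj v" x "v *v y"] by (simp add: matrix_vector_mul_assoc)
  show "integrable \<mu> (\<lambda>v. cinner (v *v x) (v *v y))"
    unfolding eq by (rule integrable_bounded_linear[OF bl integrable_adj_mult])
  show "(LINT v|\<mu>. cinner (v *v x) (v *v y)) = cinner x y"
    unfolding eq integral_bounded_linear[OF bl integrable_adj_mult] by (simp add: normalization)
qed

lemma integrable_norm_squared: "integrable \<mu> (\<lambda>v. (norm (v *v x))\<^sup>2)"
  and integral_norm_squared: "(LINT v|\<mu>. (norm (v *v x))\<^sup>2) = (norm x)\<^sup>2"
proof -
  have eq: "(norm (v *v x))\<^sup>2 = Re (cinner (v *v x) (v *v x))" for v
    by (simp add: cinner_self del: of_real_power)
  show "integrable \<mu> (\<lambda>v. (norm (v *v x))\<^sup>2)"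
    unfolding eq by (intro integrable_Re integrable_cinner)
  show "(LINT v|\<mu>. (norm (v *v x))\<^sup>2) = (norm x)\<^sup>2"
    unfolding eq integral_Re[OF integrable_cinner] integral_cinner
    by (simp add: cinner_self del: of_real_power)
qed

text \<open>The norm is the Frobenius norm, a sum over columns, and the identity for vectors applies
  to each column. At \<open>mat 1\<close> it makes the squared norm of \<open>v\<close> a common
  majorant.\<close>

lemma integrable_matrix_norm_squared: "integrable \<mu> (\<lambda>v. (norm (v ** X))\<^sup>2)"
  and integral_matrix_norm_squared: "(LINT v|\<mu>. (norm (v ** X))\<^sup>2) = (norm X)\<^sup>2"
  for X :: "complex ^ 'k ^ 'k"
  unfolding norm_matrix_squared matrix_vector_mul_assoc[symmetric]
  by (auto intro!: Bochner_Integration.integrable_sum integrable_norm_squared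
      simp: Bochner_Integration.integral_sum integrable_norm_squared integral_norm_squared)

lemma integrable_norm2: "integrable \<mu> (\<lambda>v. (norm v)\<^sup>2)"
  using integrable_matrix_norm_squared[of "mat 1"] by simp

lemma integrable_dominated:
  fixes f :: "complex ^ 'k ^ 'k \<Rightarrow> 'b :: {banach, second_countable_topology}"
  assumes "continuous_on UNIV f" "\<And>v. norm (f v) \<le> C * (norm v)\<^sup>2"
  shows "integrable \<mu> f"
proof (rule Bochner_Integration.integrable_bound)
  show "integrable \<mu> (\<lambda>v. C * (norm v)\<^sup>2)" using integrable_norm2 by simp
  show "f \<in> borel_measurable \<mu>" by (rule measurable_continuous[OF assms(1)])
  show "AE v in \<mu>. norm (f v) \<le> norm (C * (norm v)\<^sup>2)"
    using assms(2) by (intro AE_I2 order_trans[OF _ norm_ge_zero[THEN abs_of_nonneg, THEN eq_refl]])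
      (metis abs_ge_self order_trans real_norm_def)
qed

lemma integrable_norm_mult: "integrable \<mu> (\<lambda>v. norm (v *v x) * norm (v *v y))"
proof (rule integrable_dominated)
  show "continuous_on UNIV (\<lambda>v. norm (v *v x) * norm (v *v y))"
    by (intro continuous_intros)
  fix v :: "complex ^ 'k ^ 'k"
  have "norm (v *v x) * norm (v *v y) \<le> (norm v * norm x) * (norm v * norm y)"
    by (intro mult_mono norm_matrix_vector_le) auto
  then show "norm (norm (v *v x) * norm (v *v y)) \<le> norm x * norm y * (norm v)\<^sup>2"
    by (simp add: power2_eq_square mult_ac)
qed

text \<open>Cauchy--Schwarz, as the case of exponent 1/2 of the geometric mean inequality.\<close>

lemma integral_norm_mult_le: "(LINT v|\<mu>. norm (v *v x) * norm (v *v y)) \<le> norm x * norm y"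
proof -
  have r: "((norm z)\<^sup>2) powr (1/2) = norm z" for z :: "complex ^ 'k"
    by (simp add: powr_half_sqrt)
  show ?thesis
    using integral_geometric_mean_le[of "1/2" \<mu> "\<lambda>v. (norm (v *v x))\<^sup>2" "\<lambda>v. (norm (v *v y))\<^sup>2"
        "(norm x)\<^sup>2" "(norm y)\<^sup>2"]
    by (simp add: integrable_norm_squared integral_norm_squared r)
qed

lemma AE_support_iff: "closed {v. P v} \<Longrightarrow> (AE v in \<mu>. P v) \<longleftrightarrow> (\<forall>v\<in>msupport \<mu>. P v)"
  by (rule AE_closed_iff[OF sets_mu])

lemma AE_support: "AE v in \<mu>. v \<in> msupport \<mu>"
  by (rule AE_msupport[OF sets_mu])

text \<open>For a continuous integrand, vanishing is a closed condition. The equality cases of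
  averaged inequalities are turned into pointwise statements in this way.\<close>

lemma integral_eq_0_support:
  fixes f :: "complex ^ 'k ^ 'k \<Rightarrow> real"
  assumes "integrable \<mu> f" "continuous_on UNIV f" "\<And>v. 0 \<le> f v" "(LINT v|\<mu>. f v) = 0"
    and "v \<in> msupport \<mu>"
  shows "f v = 0"
proof -
  have "AE v in \<mu>. f v = 0"
    using integral_nonneg_eq_0_iff_AE[OF assms(1)] assms(3,4) by auto
  moreover have "closed {v. f v = 0}"
    using continuous_closed_preimage_constant[OF assms(2), of 0] by simp
  ultimately show ?thesis using assms(5) by (simp add: AE_support_iff)
qed

end

section \<open>Orthonormal pairs and projectors of rank two\<close>

lemma orthonormal_pair_projector:
  fixes x y :: "complex ^ 'k"
  assumes "norm x = 1" "norm y = 1" "cinner x y = 0"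
  obtains p where "orth_projector p" "p \<noteq> 0" "rank p \<noteq> 1"
    "\<And>z. p *v z = cinner x z *s x + cinner y z *s y"
proof
  define p :: "complex ^ 'k ^ 'k" where "p = (\<chi> i j. x $ i * cnj (x $ j) + y $ i * cnj (y $ j))"
  show p: "p *v z = cinner x z *s x + cinner y z *s y" for z
    by (simp add: p_def matrix_vector_mult_def vec_eq_iff cinner_def sum_distrib_left sum.distrib
        distrib_left mult_ac)
  have yx: "cinner y x = 0" using assms(3) cnj_cinner[of x y] by simp
  have px: "p *v x = x" and py: "p *v y = y"
    unfolding p using assms yx by (simp_all add: cinner_self)
  have "p ** p = p"
    unfolding matrix_eq matrix_vector_mul_assoc[symmetric]
    by (simp add: p cinner_add_right cinner_scale_right cinner_self assms yx)
  moreover have "adj p = p"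
    by (simp add: adj_def p_def vec_eq_iff mult.commute)
  ultimately show "orth_projector p" by (simp add: orth_projector_def)
  show "p \<noteq> 0" using px assms(1) by auto
  show "rank p \<noteq> 1"
  proof
    \<comment> \<open>Rows that are multiples of one vector \<open>w\<close> confine the image to
      the line through \<open>vec_lambda c\<close>, yet the image contains the orthonormal
      \<open>x\<close> and \<open>y\<close>.\<close>
    assume "rank p = 1"
    then have d: "vec.dim (rows p) = 1" by (simp add: row_rank_def_gen)
    obtain B where B: "B \<subseteq> rows p" "vec.independent B" "rows p \<subseteq> vec.span B" "card B = vec.dim (rows p)"
      using vec.basis_exists by blast
    then obtain w where w: "B = {w}" using d card_1_singletonE by metis
    have "\<exists>c. row i p = c *s w" for i
    proof -
      have "row i p \<in> vec.span {w}" using B(3) w by (auto simp: rows_def)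
      then show ?thesis by (auto simp: vec.span_singleton)
    qed
    then obtain c where c: "\<And>i. row i p = c i *s w" by metis
    have "p $ i $ j = c i * w $ j" for i j
      using arg_cong[OF c[of i], of "\<lambda>r. r $ j"] by (simp add: row_def)
    then have "p *v z = (\<Sum>j\<in>UNIV. w $ j * z $ j) *s vec_lambda c" for z
      by (simp add: matrix_vector_mult_def vec_eq_iff sum_distrib_left mult_ac)
    then obtain a b where ab: "x = a *s vec_lambda c" "y = b *s vec_lambda c"
      using px py by metis
    have "cnj a * b * cinner (vec_lambda c) (vec_lambda c) = 0"
      using assms(3) by (auto simp: ab cinner_scale_left cinner_scale_right)
    then show False
      using assms by (auto simp: ab cinner_self)
  qed
qed

text \<open>\<open>W\<close> sends an orthonormal basis of the plane to orthogonal vectors of equal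
  length, so it is a multiple of an isometry there. This is the relation tested in (Pur).\<close>

lemma orthonormal_pair_conformal:
  fixes x y :: "complex ^ 'k"
  assumes p: "orth_projector p" "\<And>z. p *v z = cinner x z *s x + cinner y z *s y"
    and W: "cinner (W *v x) (W *v y) = 0" "norm (W *v x) = norm (W *v y)"
  shows "p ** adj W ** W ** p = mat (of_real ((norm (W *v x))\<^sup>2)) ** p"
proof -
  have W': "cinner (W *v y) (W *v x) = 0" using W(1) cnj_cinner[of "W *v x" "W *v y"] by simp
  have adjp: "cinner u (p *v z) = cinner (p *v u) z" for u z
    using cinner_adj[of p u z] p(1) by (simp add: orth_projector_def)
  have "(p ** adj W ** W ** p) *v z = (mat (of_real ((norm (W *v x))\<^sup>2)) ** p) *v z" for z
  proof (rule cinner_ext)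
    fix u
    have "cinner u ((p ** adj W ** W ** p) *v z) = cinner (W *v (p *v u)) (W *v (p *v z))"
      using cinner_adj[of "adj W" "p *v u" "W *v (p *v z)"]
      by (simp add: matrix_vector_mul_assoc[symmetric] adjp)
    also have "\<dots> = of_real ((norm (W *v x))\<^sup>2) * (cnj (cinner x u) * cinner x z + cnj (cinner y u) * cinner y z)"
      using W W' by (simp add: p(2) matrix_vector_right_distrib vector_scalar_commute cinner_add_left cinner_add_right
          cinner_scale_left cinner_scale_right cinner_self algebra_simps)
    also have "\<dots> = cinner u ((mat (of_real ((norm (W *v x))\<^sup>2)) ** p) *v z)"
      by (simp add: mat_mult_vector p(2) cinner_add_right cinner_scale_right cnj_cinner algebra_simps)
    finally show "cinner u ((p ** adj W ** W ** p) *v z)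
        = cinner u ((mat (of_real ((norm (W *v x))\<^sup>2)) ** p) *v z)" .
  qed
  then show ?thesis by (simp add: matrix_eq)
qed

section \<open>Contraction of areas\<close>

context normalized
begin

text \<open>The area of the images under v_n ... v_1, averaged by iterated integrals with the first
  letter v_1 outermost.\<close>

primrec area_iter :: "nat \<Rightarrow> complex ^ 'k \<Rightarrow> complex ^ 'k \<Rightarrow> real" where
  "area_iter 0 x y = area x y"
| "area_iter (Suc n) x y = (LINT v|\<mu>. area_iter n (v *v x) (v *v y))"

text \<open>Continuity and bounds go together: integrability at one step rests on both from the step
  before, and dominated convergence then restores continuity.\<close>

lemma area_iter_aux:
  "continuous_on UNIV (\<lambda>p. area_iter n (fst p) (snd p)) \<and>
   (\<forall>x y. 0 \<le> area_iter n x y \<and> area_iter n x y \<le> norm x * norm y)"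
proof (induction n)
  case 0
  have "continuous_on UNIV (\<lambda>p::(complex ^ 'k) \<times> (complex ^ 'k). area (fst p) (snd p))"
    by (intro continuous_intros)
  then show ?case by (simp add: area_le)
next
  case (Suc n)
  then have c: "continuous_on UNIV (\<lambda>p. area_iter n (fst p) (snd p))"
    and nn: "\<And>x y. 0 \<le> area_iter n x y" and le: "\<And>x y. area_iter n x y \<le> norm x * norm y"
    by auto
  have cv: "continuous_on UNIV (\<lambda>v :: complex ^ 'k ^ 'k. area_iter n (v *v x) (v *v y))" for x y
    using continuous_on_compose2[OF c, of UNIV "\<lambda>v. (v *v x, v *v y)"]
    by (simp add: continuous_intros)
  have int: "integrable \<mu> (\<lambda>v. area_iter n (v *v x) (v *v y))" for x y
    by (rule Bochner_Integration.integrable_bound[OF integrable_norm_mult[of x y]])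
      (auto intro!: measurable_continuous cv AE_I2 simp: nn le)
  have "0 \<le> area_iter (Suc n) x y \<and> area_iter (Suc n) x y \<le> norm x * norm y" for x y
  proof
    show "0 \<le> area_iter (Suc n) x y" by (simp add: nn)
    have "area_iter (Suc n) x y \<le> (LINT v|\<mu>. norm (v *v x) * norm (v *v y))"
      unfolding area_iter.simps by (intro integral_mono int integrable_norm_mult le)
    then show "area_iter (Suc n) x y \<le> norm x * norm y"
      using integral_norm_mult_le order_trans by blast
  qed
  moreover have "continuous_on UNIV (\<lambda>p. area_iter (Suc n) (fst p) (snd p))"
  proof (rule continuous_on_sequentiallyI)
    fix u :: "nat \<Rightarrow> (complex ^ 'k) \<times> (complex ^ 'k)" and a
    assume u: "u \<longlonglongrightarrow> a"
    have "Bseq u" using u convergent_imp_Bseq convergent_def by blast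
    then obtain K where K: "\<And>i. norm (u i) \<le> K" by (auto simp: Bseq_def)
    have K0: "K \<ge> 0" using K[of 0] norm_ge_zero order_trans by blast
    have "(\<lambda>i. LINT v|\<mu>. area_iter n (v *v fst (u i)) (v *v snd (u i)))
        \<longlonglongrightarrow> (LINT v|\<mu>. area_iter n (v *v fst a) (v *v snd a))"
    proof (rule integral_dominated_convergence[where w = "\<lambda>v. K * K * (norm v)\<^sup>2"])
      show "AE v in \<mu>. (\<lambda>i. area_iter n (v *v fst (u i)) (v *v snd (u i)))
          \<longlonglongrightarrow> area_iter n (v *v fst a) (v *v snd a)"
      proof (rule AE_I2)
        fix v
        have "isCont (\<lambda>p. area_iter n (fst p) (snd p)) (v *v fst a, v *v snd a)"
          using c by (simp add: continuous_on_eq_continuous_at)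
        moreover have "(\<lambda>i. (v *v fst (u i), v *v snd (u i))) \<longlonglongrightarrow> (v *v fst a, v *v snd a)"
          using u by (intro tendsto_Pair bounded_linear.tendsto[OF matrix_vector_mul_bounded_linear]
              tendsto_fst tendsto_snd)
        ultimately show "(\<lambda>i. area_iter n (v *v fst (u i)) (v *v snd (u i)))
            \<longlonglongrightarrow> area_iter n (v *v fst a) (v *v snd a)"
          using isCont_tendsto_compose by force
      qed
      fix i
      show "AE v in \<mu>. norm (area_iter n (v *v fst (u i)) (v *v snd (u i))) \<le> K * K * (norm v)\<^sup>2"
      proof (rule AE_I2)
        fix v
        have "area_iter n (v *v fst (u i)) (v *v snd (u i)) \<le> norm (v *v fst (u i)) * norm (v *v snd (u i))"
          by (rule le)
        also have "\<dots> \<le> (norm v * K) * (norm v * K)"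
        proof -
          have "norm (fst (u i)) \<le> K" "norm (snd (u i)) \<le> K"
            using K[of i] norm_fst_le[of "fst (u i)" "snd (u i)"] norm_snd_le[of "snd (u i)" "fst (u i)"]
            by simp_all
          then show ?thesis
            by (intro mult_mono order_trans[OF norm_matrix_vector_le] mult_left_mono)
              (auto simp: K0)
        qed
        finally show "norm (area_iter n (v *v fst (u i)) (v *v snd (u i))) \<le> K * K * (norm v)\<^sup>2"
          by (simp add: nn power2_eq_square mult_ac)
      qed
    qed (use integrable_norm2 in \<open>auto intro!: measurable_continuous cv\<close>)
    then show "(\<lambda>i. area_iter (Suc n) (fst (u i)) (snd (u i))) \<longlonglongrightarrow> area_iter (Suc n) (fst a) (snd a)"
      by simp
  qed
  ultimately show ?case by blast
qed

lemma area_iter_nonneg: "0 \<le> area_iter n x y"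
  and area_iter_le_norm: "area_iter n x y \<le> norm x * norm y"
  and continuous_area_iter: "continuous_on UNIV (\<lambda>p. area_iter n (fst p) (snd p))"
  using area_iter_aux by auto

lemma continuous_area_iter_matrix:
  "continuous_on UNIV (\<lambda>v :: complex ^ 'k ^ 'k. area_iter n (v *v x) (v *v y))"
  using continuous_on_compose2[OF continuous_area_iter, of UNIV "\<lambda>v. (v *v x, v *v y)"]
  by (simp add: continuous_intros)

lemma integrable_area_iter: "integrable \<mu> (\<lambda>v. area_iter n (v *v x) (v *v y))"
  by (rule Bochner_Integration.integrable_bound[OF integrable_norm_mult[of x y]])
    (auto intro!: measurable_continuous continuous_area_iter_matrix AE_I2
      simp: area_iter_nonneg area_iter_le_norm)

lemma area_iter_scale: "area_iter n (c *s x) (d *s y) = cmod c * cmod d * area_iter n x y"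
  by (induction n arbitrary: x y) (simp_all add: area_scale vector_scalar_commute)

lemma area_iter_shear: "area_iter n x (y + c *s x) = area_iter n x y"
  by (induction n arbitrary: x y) (simp_all add: area_shear vector_scalar_commute matrix_vector_right_distrib)

lemma area_iter_zero [simp]: "area_iter n 0 y = 0" "area_iter n x 0 = 0"
  using area_iter_scale[of n 0 0 1 y] area_iter_scale[of n 1 x 0 0] by simp_all

text \<open>By shear invariance and homogeneity, bounds by the area need only be checked on orthonormal
  pairs.\<close>

lemma area_iter_le_areaI:
  assumes "\<And>x y. norm x = 1 \<Longrightarrow> norm y = 1 \<Longrightarrow> cinner x y = 0 \<Longrightarrow> area_iter n x y \<le> r"
    and "0 \<le> r"
  shows "area_iter n x y \<le> r * area x y"
proof (cases "x = 0")
  case False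
  define c where "c = - cinner x y / cinner x x"
  define z where "z = y + c *s x"
  have xz: "cinner x z = 0"
    using False by (simp add: z_def c_def cinner_add_right cinner_diff_right cinner_scale_right cinner_self_eq_0_iff)
  have "area_iter n x z \<le> r * area x z"
  proof (cases "z = 0")
    case False
    define a where "a = complex_of_real (inverse (norm x))"
    define b where "b = complex_of_real (inverse (norm z))"
    have "norm (a *s x) = 1" "norm (b *s z) = 1"
      using False \<open>x \<noteq> 0\<close> by (simp_all add: a_def b_def norm_vector_smult norm_inverse)
    moreover have "cinner (a *s x) (b *s z) = 0"
      by (simp add: cinner_scale_left cinner_scale_right xz)
    ultimately have "area_iter n (a *s x) (b *s z) \<le> r" by (rule assms(1))
    moreover have "cmod a = 1 / norm x" "cmod b = 1 / norm z"
      by (simp_all add: a_def b_def norm_inverse divide_inverse)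
    ultimately have "area_iter n x z / (norm x * norm z) \<le> r"
      by (simp add: area_iter_scale)
    then show ?thesis
      using False \<open>x \<noteq> 0\<close> by (simp add: area_orthogonal[OF xz] field_simps)
  qed simp
  then show ?thesis by (simp add: z_def area_iter_shear area_shear)
qed simp

text \<open>Orthonormal pairs have area 1, which is exactly the Cauchy--Schwarz bound after
  averaging; shear invariance carries this to all pairs. Later steps integrate the
  inequality.\<close>

lemma area_iter_Suc_le: "area_iter (Suc n) x y \<le> area_iter n x y"
proof (induction n arbitrary: x y)
  case 0
  have "area_iter (Suc 0) x y \<le> 1 * area x y"
  proof (rule area_iter_le_areaI)
    fix x y :: "complex ^ 'k" assume "norm x = 1" "norm y = 1"
    then show "area_iter (Suc 0) x y \<le> 1" using area_iter_le_norm[of "Suc 0" x y] by simp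
  qed simp
  then show ?case by simp
next
  case (Suc n)
  have "(LINT v|\<mu>. area_iter (Suc n) (v *v x) (v *v y)) \<le> (LINT v|\<mu>. area_iter n (v *v x) (v *v y))"
    by (intro integral_mono integrable_area_iter Suc.IH)
  then show ?case by simp
qed

lemma area_iter_mono: "m \<le> n \<Longrightarrow> area_iter n x y \<le> area_iter m x y"
  by (rule lift_Suc_antimono_le[of "\<lambda>n. area_iter n x y", OF area_iter_Suc_le])

section \<open>The equality case and uniform decay\<close>

text \<open>The mean of the squares takes the place of the product of the norms because averaging
  preserves it exactly, so that equality passes to the integrand.\<close>

lemma area_iter_le_mean: "area_iter n x y \<le> ((norm x)\<^sup>2 + (norm y)\<^sup>2) / 2"
  using area_iter_le_norm[of n x y] sum_squares_bound[of "norm x" "norm y"] by simp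

text \<open>The gap to the mean is a nonnegative continuous function of \<open>v\<close> whose
  integral is the gap of the pair \<open>x\<close>, \<open>y\<close> at index \<open>Suc n\<close>,
  that is, 0.\<close>

lemma area_iter_eq_mean_support:
  assumes "area_iter (Suc n) x y = ((norm x)\<^sup>2 + (norm y)\<^sup>2) / 2" "v \<in> msupport \<mu>"
  shows "area_iter n (v *v x) (v *v y) = ((norm (v *v x))\<^sup>2 + (norm (v *v y))\<^sup>2) / 2"
proof -
  let ?f = "\<lambda>v. ((norm (v *v x))\<^sup>2 + (norm (v *v y))\<^sup>2) / 2 - area_iter n (v *v x) (v *v y)"
  have "integrable \<mu> ?f"
    by (intro Bochner_Integration.integrable_diff integrable_divide Bochner_Integration.integrable_add
        integrable_norm_squared integrable_area_iter)
  moreover have "continuous_on UNIV ?f"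
    by (intro continuous_intros continuous_area_iter_matrix) auto
  moreover have "\<And>v. 0 \<le> ?f v" using area_iter_le_mean by simp
  moreover have "(LINT v|\<mu>. ?f v) = 0"
    using assms(1) by (simp add: integrable_norm_squared integrable_area_iter integral_norm_squared)
  ultimately have "?f v = 0"
    by (rule integral_eq_0_support[OF _ _ _ _ assms(2)])
  then show ?thesis by simp
qed

text \<open>Equality descends letter by letter and uses up one averaging each time; at
  \<open>m = n\<close> only the plain area is left.\<close>

lemma conformal_word:
  assumes "area_iter n x y = ((norm x)\<^sup>2 + (norm y)\<^sup>2) / 2" "\<forall>i\<in>{1..n}. v i \<in> msupport \<mu>" "m \<le> n"
  shows "area_iter (n - m) (mat_word v m *v x) (mat_word v m *v y)
      = ((norm (mat_word v m *v x))\<^sup>2 + (norm (mat_word v m *v y))\<^sup>2) / 2"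
  using assms(3)
proof (induction m)
  case (Suc m)
  then have "n - m = Suc (n - Suc m)" by simp
  with Suc have "area_iter (Suc (n - Suc m)) (mat_word v m *v x) (mat_word v m *v y)
      = ((norm (mat_word v m *v x))\<^sup>2 + (norm (mat_word v m *v y))\<^sup>2) / 2"
    by simp
  from area_iter_eq_mean_support[OF this, of "v (Suc m)"] show ?case
    using assms(2) Suc.prems by (simp add: matrix_vector_mul_assoc)
qed (use assms(1) in simp)

text \<open>Otherwise the value 1 persists for all n, so every word in the support is conformal on
  the plane of \<open>x\<close> and \<open>y\<close>, and the projector onto that plane contradicts
  (Pur).\<close>

lemma Pur_area_iter_less:
  assumes "Pur \<mu>" "norm x = 1" "norm y = 1" "cinner x y = 0"
  shows "\<exists>n. area_iter n x y < 1"
proof (rule ccontr)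
  assume "\<not> ?thesis"
  then have eq: "area_iter n x y = ((norm x)\<^sup>2 + (norm y)\<^sup>2) / 2" for n
    using area_iter_le_norm[of n x y] assms(2,3) by (auto simp: not_less intro!: antisym)
  obtain p where p: "orth_projector p" "p \<noteq> 0" "rank p \<noteq> 1"
    "\<And>z. p *v z = cinner x z *s x + cinner y z *s y"
    by (rule orthonormal_pair_projector[OF assms(2-4)]) blast
  have "AE v in tensor_power \<mu> n. \<exists>c. p ** adj (mat_word v n) ** mat_word v n ** p = mat c ** p" for n
  proof -
    have "AE v in tensor_power \<mu> n. \<forall>i\<in>{1..n}. v i \<in> msupport \<mu>"
      by (rule AE_tensor_power[OF _ AE_support]) (simp add: sets_mu closed_msupport)
    then show ?thesis
    proof eventually_elim
      case (elim v)
      then have "area (mat_word v n *v x) (mat_word v n *v y)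
          = ((norm (mat_word v n *v x))\<^sup>2 + (norm (mat_word v n *v y))\<^sup>2) / 2"
        using conformal_word[OF eq elim, of n] by simp
      then show ?case
        using orthonormal_pair_conformal[OF p(1,4)] area_eq_mean_imp by blast
    qed
  qed
  then show False using assms(1) p unfolding Pur_def by blast
qed

text \<open>Dini's argument on the compact set of orthonormal pairs: the closed sets where the
  decreasing functions \<open>area_iter n\<close> are still at least 1 are nested and have empty
  intersection.\<close>

lemma Pur_area_iter_uniform:
  assumes "Pur \<mu>"
  obtains N r where "0 \<le> r" "r < 1" "\<And>x y. area_iter N x y \<le> r * area x y"
proof -
  define K where "K = {p :: (complex ^ 'k) \<times> (complex ^ 'k). norm (fst p) = 1 \<and> norm (snd p) = 1
    \<and> cinner (fst p) (snd p) = 0}"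
  have "closed K" unfolding K_def
    by (intro closed_Collect_conj closed_Collect_eq continuous_intros)
  moreover have "bounded K"
  proof -
    have "K \<subseteq> sphere 0 1 \<times> sphere 0 1" by (auto simp: K_def)
    moreover have "bounded (sphere 0 1 \<times> sphere (0 :: complex ^ 'k) 1 :: ((complex ^ 'k) \<times> (complex ^ 'k)) set)"
      by (intro bounded_Times compact_imp_bounded compact_sphere)
    ultimately show ?thesis by (rule bounded_subset[rotated])
  qed
  ultimately have K: "compact K" by (simp add: compact_eq_bounded_closed)
  have "\<exists>N. \<forall>p\<in>K. area_iter N (fst p) (snd p) < 1"
  proof (rule ccontr)
    assume contr: "\<not> ?thesis"
    define F where "F n = K \<inter> {p. area_iter n (fst p) (snd p) \<ge> 1}" for n
    have "\<Inter>(range F) \<noteq> {}"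
    proof (rule compact_nest)
      fix n
      have "closed {p. 1 \<le> area_iter n (fst p) (snd p)}"
        by (intro closed_Collect_le continuous_area_iter continuous_intros)
      then show "compact (F n)" unfolding F_def by (rule compact_Int_closed[OF K])
      show "F n \<noteq> {}" using contr by (force simp: F_def not_less)
    next
      fix m n :: nat assume "m \<le> n"
      then show "F n \<subseteq> F m"
        using area_iter_mono by (fastforce simp: F_def intro: order_trans)
    qed
    then obtain p where "p \<in> F n" for n by blast
    then have "norm (fst p) = 1" "norm (snd p) = 1" "cinner (fst p) (snd p) = 0"
      "\<not> (\<exists>n. area_iter n (fst p) (snd p) < 1)"
      by (auto simp: F_def K_def not_less)
    then show False using Pur_area_iter_less[OF assms] by blast
  qed
  then obtain N where N: "\<And>p. p \<in> K \<Longrightarrow> area_iter N (fst p) (snd p) < 1" by blast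
  have "\<exists>r. 0 \<le> r \<and> r < 1 \<and> (\<forall>p\<in>K. area_iter N (fst p) (snd p) \<le> r)"
  \<comment> \<open>In dimension one there are no orthonormal pairs, and r = 0 will do.\<close>
  proof (cases "K = {}")
    case False
    obtain p where "p \<in> K" "\<forall>q\<in>K. area_iter N (fst q) (snd q) \<le> area_iter N (fst p) (snd p)"
      using continuous_attains_sup[OF K False continuous_on_subset[OF continuous_area_iter]] by blast
    then show ?thesis using N area_iter_nonneg by blast
  qed (auto intro: exI[of _ 0])
  then obtain r where r: "0 \<le> r" "r < 1" "\<And>p. p \<in> K \<Longrightarrow> area_iter N (fst p) (snd p) \<le> r" by blast
  have "area_iter N x y \<le> r * area x y" for x y
    by (rule area_iter_le_areaI[OF _ r(1)]) (use r(3)[of "(_, _)"] in \<open>auto simp: K_def\<close>)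
  then show ?thesis using that r by blast
qed

lemma area_iter_add_le:
  assumes "\<And>x y. area_iter N x y \<le> r * area x y"
  shows "area_iter (n + N) x y \<le> r * area_iter n x y"
proof (induction n arbitrary: x y)
  case (Suc n)
  have "(LINT v|\<mu>. area_iter (n + N) (v *v x) (v *v y)) \<le> (LINT v|\<mu>. r * area_iter n (v *v x) (v *v y))"
    by (intro integral_mono integrable_area_iter integrable_mult_right Suc.IH)
  then show ?case by simp
qed (simp add: assms)

lemma Pur_area_iter_small:
  assumes "Pur \<mu>" "0 < \<epsilon>"
  obtains n where "\<And>x y. area_iter n x y \<le> \<epsilon> * area x y"
proof -
  obtain r N where r: "0 \<le> r" "r < 1" "\<And>x y. area_iter N x y \<le> r * area x y"
    using Pur_area_iter_uniform[OF assms(1)] by metis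
  have *: "area_iter (j * N) x y \<le> r ^ j * area x y" for j x y
  proof (induction j)
    case (Suc j)
    have "area_iter (j * N + N) x y \<le> r * area_iter (j * N) x y"
      by (rule area_iter_add_le[OF r(3)])
    also have "\<dots> \<le> r * (r ^ j * area x y)" by (intro mult_left_mono Suc r(1))
    finally show ?case by (simp add: add.commute mult.assoc)
  qed simp
  obtain j where "r ^ j < \<epsilon>" using real_arch_pow_inv[OF assms(2) r(2)] by blast
  then have "r ^ j * area x y \<le> \<epsilon> * area x y" for x y :: "complex ^ 'k"
    by (intro mult_right_mono) auto
  then have "area_iter (j * N) x y \<le> \<epsilon> * area x y" for x y
    by (rule order_trans[OF *])
  then show ?thesis using that by blast
qed

end

section \<open>Homogeneous extension of functions on projective space\<close>

definition hom_ext :: "('k proj \<Rightarrow> complex) \<Rightarrow> complex ^ 'k \<Rightarrow> complex" where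
  "hom_ext f x = (if x = 0 then 0 else f (abs_proj x) * of_real ((norm x)\<^sup>2))"

lemma hom_ext_zero [simp]: "hom_ext f 0 = 0"
  by (simp add: hom_ext_def)

lemma hom_ext_scale: "hom_ext f (c *s x) = of_real ((cmod c)\<^sup>2) * hom_ext f x"
  by (auto simp: hom_ext_def vector_smult_eq_0_iff abs_proj_scale norm_vector_smult power_mult_distrib)

lemma hom_ext_unit_rep [simp]: "hom_ext f (unit_rep X) = f X"
  by (simp add: hom_ext_def)

lemma hom_ext_add: "hom_ext (\<lambda>X. f X + g X) x = hom_ext f x + hom_ext g x"
  and hom_ext_cmult: "hom_ext (\<lambda>X. c * f X) x = c * hom_ext f x"
  by (simp_all add: hom_ext_def algebra_simps)

lemma markov_op_eq: "markov_op \<mu> f X = (LINT v|\<mu>. hom_ext f (v *v unit_rep X))"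
  unfolding markov_op_def hom_ext_def proj_act_def ..

lemma hom_ext_markov_op: "hom_ext (markov_op \<mu> f) x = (LINT v|\<mu>. hom_ext f (v *v x))"
proof (cases "x = 0")
  case False
  then obtain c where c: "x = c *s unit_rep (abs_proj x)" "cmod c = norm x"
    by (metis unit_rep_abs_proj)
  have "(LINT v|\<mu>. hom_ext f (v *v x)) = (LINT v|\<mu>. of_real ((norm x)\<^sup>2) * hom_ext f (v *v unit_rep (abs_proj x)))"
    by (subst c(1)) (simp add: vector_scalar_commute hom_ext_scale c(2))
  then show ?thesis using False by (simp add: hom_ext_def[of "markov_op \<mu> f"] markov_op_eq)
qed simp

text \<open>The bounds \<open>s\<close> for the supremum and \<open>m\<close> for the seminorm are
  kept apart because iteration contracts only the second. Numerical bounds can be propagated without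
  forming suprema.\<close>

definition holder_bd :: "real \<Rightarrow> real \<Rightarrow> real \<Rightarrow> ('k::finite proj \<Rightarrow> complex) \<Rightarrow> bool" where
  "holder_bd \<alpha> s m f \<longleftrightarrow> 0 \<le> m \<and> (\<forall>X. cmod (f X) \<le> s) \<and>
     (\<forall>X Y. cmod (f X - f Y) \<le> m * proj_dist X Y powr \<alpha>)"

lemma holder_bdD:
  assumes "holder_bd \<alpha> s m f"
  shows "0 \<le> m" "0 \<le> s" "cmod (f X) \<le> s" "cmod (f X - f Y) \<le> m * proj_dist X Y powr \<alpha>"
  using assms norm_ge_zero order_trans unfolding holder_bd_def by blast+

lemma holder_bd_mono: "holder_bd \<alpha> s m f \<Longrightarrow> s \<le> s' \<Longrightarrow> m \<le> m' \<Longrightarrow> holder_bd \<alpha> s' m' f"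
  unfolding holder_bd_def
  by (meson mult_right_mono order_trans powr_ge_zero)

lemma holder_bd_add:
  assumes "holder_bd \<alpha> s m f" "holder_bd \<alpha> s' m' g"
  shows "holder_bd \<alpha> (s + s') (m + m') (\<lambda>X. f X + g X)"
  unfolding holder_bd_def
proof (intro conjI allI)
  show "0 \<le> m + m'" using assms by (simp add: holder_bd_def)
  fix X Y
  show "cmod (f X + g X) \<le> s + s'"
    using holder_bdD(3)[OF assms(1), of X] holder_bdD(3)[OF assms(2), of X] norm_triangle_ineq[of "f X" "g X"]
    by linarith
  have "cmod (f X + g X - (f Y + g Y)) \<le> cmod (f X - f Y) + cmod (g X - g Y)"
    by (rule norm_diff_triangle_ineq)
  then show "cmod (f X + g X - (f Y + g Y)) \<le> (m + m') * proj_dist X Y powr \<alpha>"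
    using holder_bdD(4)[OF assms(1), of X Y] holder_bdD(4)[OF assms(2), of X Y]
    by (simp add: distrib_right)
qed

lemma holder_bd_cmult:
  assumes "holder_bd \<alpha> s m f"
  shows "holder_bd \<alpha> (cmod c * s) (cmod c * m) (\<lambda>X. c * f X)"
  using assms unfolding holder_bd_def
  by (auto simp: norm_mult mult_left_mono mult.assoc right_diff_distrib[symmetric])

lemma holder_bd_0: "holder_bd \<alpha> 0 0 (\<lambda>X. 0)"
  by (simp add: holder_bd_def)

lemma holder_bd_sum:
  assumes "\<And>i. i \<in> I \<Longrightarrow> holder_bd \<alpha> (s i) (m i) (f i)"
  shows "holder_bd \<alpha> (\<Sum>i\<in>I. s i) (\<Sum>i\<in>I. m i) (\<lambda>X. \<Sum>i\<in>I. f i X)"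
  using assms
  by (induction I rule: infinite_finite_induct) (auto intro: holder_bd_add simp: holder_bd_0)

lemma abs_norm_squared_diff_le: "\<bar>(norm x)\<^sup>2 - (norm y)\<^sup>2\<bar> \<le> norm (x - y) * norm (x + y)"
  for x y :: "'a :: real_inner"
proof -
  have "(norm x)\<^sup>2 - (norm y)\<^sup>2 = inner (x - y) (x + y)"
    by (simp add: power2_norm_eq_inner inner_diff_left inner_add_right inner_commute[of y x])
  then show ?thesis using Cauchy_Schwarz_ineq2[of "x - y" "x + y"] by simp
qed

lemma norm_hom_ext_le:
  assumes "holder_bd \<alpha> s m f"
  shows "cmod (hom_ext f x) \<le> s * (norm x)\<^sup>2"
  using holder_bdD(2,3)[OF assms] by (auto simp: hom_ext_def norm_mult norm_power mult_right_mono)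

text \<open>Split into a change of direction, weighted with the smaller squared norm, and a change
  of length. Both terms are written in a shape that averaging over \<open>v\<close>
  reproduces.\<close>

lemma hom_ext_diff_le:
  fixes x y :: "complex ^ 'k"
  assumes f: "holder_bd \<alpha> s m f" and \<alpha>: "0 < \<alpha>" "\<alpha> \<le> 1"
  shows "cmod (hom_ext f x - hom_ext f y) \<le>
    m * (area x y powr \<alpha> * (norm x * norm y) powr (1 - \<alpha>)) + s * (norm (x - y) * norm (x + y))"
proof -
  have *: "cmod (hom_ext f x - hom_ext f y) \<le>
      m * (area x y powr \<alpha> * (norm x * norm y) powr (1 - \<alpha>)) + s * (norm (x - y) * norm (x + y))"
    if le: "norm x \<le> norm y" for x y :: "complex ^ 'k"
  proof (cases "x = 0")
    case True
    have "cmod (hom_ext f y) \<le> s * (norm y)\<^sup>2" by (rule norm_hom_ext_le[OF f])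
    then show ?thesis using True by (simp add: power2_eq_square)
  next
    case False
    then have y: "y \<noteq> 0" using le by auto
    let ?t = "norm x * norm y"
    have t: "?t > 0" using False y by simp
    have "hom_ext f x - hom_ext f y = (f (abs_proj x) - f (abs_proj y)) * of_real ((norm x)\<^sup>2)
        + f (abs_proj y) * of_real ((norm x)\<^sup>2 - (norm y)\<^sup>2)"
      using False y by (simp add: hom_ext_def algebra_simps)
    then have "cmod (hom_ext f x - hom_ext f y) \<le>
        cmod (f (abs_proj x) - f (abs_proj y)) * (norm x)\<^sup>2
        + cmod (f (abs_proj y)) * \<bar>(norm x)\<^sup>2 - (norm y)\<^sup>2\<bar>"
      using norm_triangle_ineq[of "(f (abs_proj x) - f (abs_proj y)) * of_real ((norm x)\<^sup>2)"
          "f (abs_proj y) * of_real ((norm x)\<^sup>2 - (norm y)\<^sup>2)"]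
      unfolding norm_mult norm_of_real by simp
    also have "\<dots> \<le> (m * (area x y / ?t) powr \<alpha>) * ?t + s * (norm (x - y) * norm (x + y))"
    proof (intro add_mono mult_mono abs_norm_squared_diff_le)
      show "cmod (f (abs_proj x) - f (abs_proj y)) \<le> m * (area x y / ?t) powr \<alpha>"
        using holder_bdD(4)[OF f, of "abs_proj x" "abs_proj y"] by (simp add: proj_dist_abs_proj False y)
      show "(norm x)\<^sup>2 \<le> norm x * norm y" using le by (simp add: power2_eq_square mult_left_mono)
    qed (use holder_bdD[OF f] in auto)
    also have "(m * (area x y / ?t) powr \<alpha>) * ?t = m * (area x y powr \<alpha> * ?t powr (1 - \<alpha>))"
      using t False y by (simp add: powr_divide powr_diff)
    finally show ?thesis .
  qed
  show ?thesis
  proof (cases "norm x \<le> norm y")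
    case False
    then show ?thesis
      using *[of y x] by (simp add: area_commute[of y x] norm_minus_commute add.commute mult.commute[of "norm y"])
  qed (rule *)
qed

lemma continuous_hom_ext:
  assumes f: "holder_bd \<alpha> s m f" and \<alpha>: "0 < \<alpha>" "\<alpha> \<le> 1"
  shows "continuous_on UNIV (hom_ext f)"
proof -
  have "isCont (hom_ext f) x" for x
  proof -
    \<comment> \<open>The factor with exponent 1 - \<alpha> is replaced by
      \<open>1 + norm y * norm x\<close>, since for \<alpha> = 1 it is discontinuous at 0.\<close>
    let ?b = "\<lambda>y. m * (area y x powr \<alpha> * (1 + norm y * norm x)) + s * (norm (y - x) * norm (y + x))"
    have "continuous_on UNIV ?b"
      by (intro continuous_intros continuous_on_powr') (use \<alpha> in auto)
    then have "isCont ?b x" by (simp add: continuous_on_eq_continuous_at)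
    then have b: "?b \<midarrow>x\<rightarrow> 0" using \<alpha> by (simp add: isCont_def)
    have "cmod (hom_ext f y - hom_ext f x) \<le> ?b y" for y
    proof -
      have "(norm y * norm x) powr (1 - \<alpha>) \<le> 1 + norm y * norm x"
      proof (cases "\<alpha> = 1")
        case False
        have "(1 - \<alpha>) * (norm y * norm x) \<le> 1 * (norm y * norm x)"
          using \<alpha> by (intro mult_right_mono) auto
        then show ?thesis
          using weighted_am_gm[of "1 - \<alpha>" "norm y * norm x" 1] \<alpha> False by simp
      qed simp
      then have "area y x powr \<alpha> * (norm y * norm x) powr (1 - \<alpha>) \<le> area y x powr \<alpha> * (1 + norm y * norm x)"
        by (intro mult_left_mono) auto
      then show ?thesis
        using hom_ext_diff_le[OF f \<alpha>, of y x] mult_left_mono[OF _ holder_bdD(1)[OF f]]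
        by (meson add_mono order_refl order_trans)
    qed
    then have "((\<lambda>y. hom_ext f y - hom_ext f x) \<longlongrightarrow> 0) (at x)"
      by (intro Lim_null_comparison[OF _ b] always_eventually) auto
    then show ?thesis unfolding isCont_def by (rule LIM_zero_cancel)
  qed
  then show ?thesis by (simp add: continuous_on_eq_continuous_at)
qed

text \<open>The bound is evaluated at unit representatives with nonnegative inner product.\<close>

lemma holder_bd_of_hom_ext:
  fixes f :: "'k::finite proj \<Rightarrow> complex"
  assumes \<alpha>: "0 < \<alpha>" "\<alpha> \<le> 1" and pos: "0 \<le> m" "0 \<le> \<epsilon>"
    and s: "\<And>X. cmod (f X) \<le> s"
    and d: "\<And>x y. cmod (hom_ext f x - hom_ext f y) \<le>
      m * (A x y powr \<alpha> * (norm x * norm y) powr (1 - \<alpha>)) + s * (norm (x - y) * norm (x + y))"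
    and A: "\<And>x y. 0 \<le> A x y" "\<And>x y. A x y \<le> \<epsilon> * area x y"
  shows "holder_bd \<alpha> s (m * \<epsilon> powr \<alpha> + 2 * s) f"
  unfolding holder_bd_def
proof (intro conjI allI)
  have s0: "0 \<le> s" using s norm_ge_zero order_trans by blast
  then show "0 \<le> m * \<epsilon> powr \<alpha> + 2 * s" using pos by simp
  show "cmod (f X) \<le> s" for X by (rule s)
  fix X Y :: "'k proj"
  define x where "x = unit_rep X"
  obtain c where c: "cmod c = 1" "cinner x (c *s unit_rep Y) = of_real (cmod (cinner x (unit_rep Y)))"
    using phase_exists by blast
  define y where "y = c *s unit_rep Y"
  have ar: "area x y = proj_dist X Y"
    using area_scale[of 1 x c "unit_rep Y"] c(1) by (simp add: x_def y_def proj_dist_eq_area)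
  have n: "norm x = 1" "norm y = 1" by (simp_all add: x_def y_def c norm_vector_smult)
  have "f X - f Y = hom_ext f x - hom_ext f y"
    by (simp add: x_def y_def hom_ext_scale c)
  \<comment> \<open>For phase-aligned unit vectors the second term is twice the distance; as
    distances are at most 1, it is absorbed into the \<alpha>-th power with coefficient
    \<open>2 * s\<close>.\<close>
  then have "cmod (f X - f Y) \<le> m * A x y powr \<alpha> + s * (2 * proj_dist X Y)"
    using d[of x y] norm_diff_mult_norm_add[OF n c(2)[folded y_def]] by (simp add: n ar)
  also have "\<dots> \<le> m * (\<epsilon> * proj_dist X Y) powr \<alpha> + s * (2 * proj_dist X Y powr \<alpha>)"
  proof (intro add_mono mult_left_mono powr_mono2 s0 pos)
    show "A x y \<le> \<epsilon> * proj_dist X Y" using A(2)[of x y] by (simp add: ar)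
    show "proj_dist X Y \<le> proj_dist X Y powr \<alpha>"
      using \<alpha> proj_dist_le_1[of X Y] powr_mono'[of \<alpha> 1 "proj_dist X Y"] by simp
  qed (use \<alpha> A in auto)
  also have "\<dots> = (m * \<epsilon> powr \<alpha> + 2 * s) * proj_dist X Y powr \<alpha>"
    using pos by (simp add: powr_mult algebra_simps)
  finally show "cmod (f X - f Y) \<le> (m * \<epsilon> powr \<alpha> + 2 * s) * proj_dist X Y powr \<alpha>" .
qed

section \<open>The Doeblin--Fortet inequality\<close>

locale normalized_holder = normalized \<mu> for \<mu> :: "(complex ^ 'k ^ 'k) measure" +
  fixes \<alpha> :: real
  assumes \<alpha>: "0 < \<alpha>" "\<alpha> \<le> 1"
begin

abbreviation "T \<equiv> markov_op \<mu>"

lemma continuous_hom_ext_matrix: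
  fixes x :: "complex ^ 'k"
  assumes "holder_bd \<alpha> s m f"
  shows "continuous_on UNIV (\<lambda>v :: complex ^ 'k ^ 'k. hom_ext f (v *v x))"
  by (rule continuous_on_compose2[OF continuous_hom_ext[OF assms \<alpha>]]) (auto intro!: continuous_intros)

lemma integrable_hom_ext:
  fixes x :: "complex ^ 'k"
  assumes "holder_bd \<alpha> s m f"
  shows "integrable \<mu> (\<lambda>v. hom_ext f (v *v x))"
proof (rule Bochner_Integration.integrable_bound)
  show "integrable \<mu> (\<lambda>v. s * (norm (v *v x))\<^sup>2)" using integrable_norm_squared by simp
  show "AE v in \<mu>. norm (hom_ext f (v *v x)) \<le> norm (s * (norm (v *v x))\<^sup>2)"
    using norm_hom_ext_le[OF assms] holder_bdD(2)[OF assms] by (auto simp: abs_mult)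
qed (intro measurable_continuous continuous_hom_ext_matrix[OF assms])

lemma markov_op_add:
  assumes "holder_bd \<alpha> s m f" "holder_bd \<alpha> s' m' g"
  shows "T (\<lambda>X. f X + g X) = (\<lambda>X. T f X + T g X)"
  by (simp add: fun_eq_iff markov_op_eq hom_ext_add integrable_hom_ext[OF assms(1)] integrable_hom_ext[OF assms(2)])

lemma markov_op_cmult: "T (\<lambda>X. c * f X) = (\<lambda>X. c * T f X)"
  by (simp add: fun_eq_iff markov_op_eq hom_ext_cmult)

lemma norm_markov_op_le:
  assumes f: "holder_bd \<alpha> s m f" and b: "\<And>X. cmod (f X) \<le> e"
  shows "cmod (T f X) \<le> e"
proof -
  have le: "cmod (hom_ext f x) \<le> e * (norm x)\<^sup>2" for x
    using b order_trans[OF norm_ge_zero b] by (auto simp: hom_ext_def norm_mult norm_power mult_right_mono)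
  have "cmod (T f X) \<le> (LINT v|\<mu>. cmod (hom_ext f (v *v unit_rep X)))"
    unfolding markov_op_eq by (rule integral_norm_bound)
  also have "\<dots> \<le> (LINT v|\<mu>. e * (norm (v *v unit_rep X))\<^sup>2)"
    using integrable_hom_ext[OF f] integrable_norm_squared le by (intro integral_mono) auto
  finally show ?thesis by (simp add: integral_norm_squared)
qed

text \<open>Only \<open>area_iter\<close> changes with n; \<open>m\<close> and \<open>s\<close>
  remain those of \<open>f\<close>. The two claims go together because they give the Hoelder bound
  of the iterate on which the next integral depends.\<close>

lemma markov_op_iterate_aux:
  assumes f: "holder_bd \<alpha> s m f"
  shows "(\<forall>X. cmod ((T ^^ n) f X) \<le> s) \<and>
    (\<forall>x y. cmod (hom_ext ((T ^^ n) f) x - hom_ext ((T ^^ n) f) y) \<le>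
      m * (area_iter n x y powr \<alpha> * (norm x * norm y) powr (1 - \<alpha>)) + s * (norm (x - y) * norm (x + y)))"
proof (induction n)
  case 0
  then show ?case using hom_ext_diff_le[OF f \<alpha>] holder_bdD[OF f] by simp
next
  case (Suc n)
  let ?g = "(T ^^ n) f"
  have m: "0 \<le> m" and s: "0 \<le> s" using holder_bdD[OF f] by auto
  have g: "holder_bd \<alpha> s (m * 1 powr \<alpha> + 2 * s) ?g"
    by (rule holder_bd_of_hom_ext[where A = "area_iter n"])
      (use Suc \<alpha> m area_iter_nonneg area_iter_mono[of 0 n] in auto)
  have "cmod (T ?g X) \<le> s" for X
    using norm_markov_op_le[OF g] Suc by blast
  moreover have "cmod (hom_ext (T ?g) x - hom_ext (T ?g) y) \<le>
      m * (area_iter (Suc n) x y powr \<alpha> * (norm x * norm y) powr (1 - \<alpha>)) + s * (norm (x - y) * norm (x + y))" for x y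
  proof -
    let ?a = "\<lambda>v :: complex ^ 'k ^ 'k. area_iter n (v *v x) (v *v y)"
    let ?b = "\<lambda>v :: complex ^ 'k ^ 'k. norm (v *v x) * norm (v *v y)"
    let ?c = "\<lambda>v :: complex ^ 'k ^ 'k. norm (v *v (x - y)) * norm (v *v (x + y))"
    have i: "integrable \<mu> (\<lambda>v. ?a v powr \<alpha> * ?b v powr (1 - \<alpha>))"
      by (intro integrable_geometric_mean \<alpha> integrable_area_iter integrable_norm_mult area_iter_nonneg) auto
    have "hom_ext (T ?g) x - hom_ext (T ?g) y = (LINT v|\<mu>. hom_ext ?g (v *v x) - hom_ext ?g (v *v y))"
      by (simp add: hom_ext_markov_op integrable_hom_ext[OF g])
    also have "cmod \<dots> \<le> (LINT v|\<mu>. cmod (hom_ext ?g (v *v x) - hom_ext ?g (v *v y)))"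
      by (rule integral_norm_bound)
    also have "\<dots> \<le> (LINT v|\<mu>. m * (?a v powr \<alpha> * ?b v powr (1 - \<alpha>)) + s * ?c v)"
      using Suc
      by (intro integral_mono integrable_norm Bochner_Integration.integrable_diff integrable_hom_ext[OF g]
          Bochner_Integration.integrable_add integrable_mult_right i integrable_norm_mult)
        (auto simp: matrix_vector_right_distrib matrix_vector_mult_diff_distrib)
    also have "\<dots> = m * (LINT v|\<mu>. ?a v powr \<alpha> * ?b v powr (1 - \<alpha>)) + s * (LINT v|\<mu>. ?c v)"
      using i integrable_norm_mult by simp
    also have "\<dots> \<le> m * (area_iter (Suc n) x y powr \<alpha> * (norm x * norm y) powr (1 - \<alpha>))
        + s * (norm (x - y) * norm (x + y))"
      by (intro add_mono mult_left_mono m s integral_norm_mult_le integral_geometric_mean_le \<alpha>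
          integrable_area_iter integrable_norm_mult area_iter_nonneg) auto
    finally show ?thesis .
  qed
  ultimately show ?case by simp
qed

lemma holder_bd_markov_iterate:
  assumes "holder_bd \<alpha> s m f" "0 \<le> \<epsilon>" "\<And>x y. area_iter n x y \<le> \<epsilon> * area x y"
  shows "holder_bd \<alpha> s (m * \<epsilon> powr \<alpha> + 2 * s) ((T ^^ n) f)"
  by (rule holder_bd_of_hom_ext[where A = "area_iter n"])
    (use markov_op_iterate_aux[OF assms(1)] \<alpha> assms holder_bdD(1)[OF assms(1)] area_iter_nonneg in auto)

lemma holder_bd_markov_power:
  assumes "holder_bd \<alpha> s m f"
  shows "holder_bd \<alpha> s (m + 2 * s) ((T ^^ n) f)"
  using holder_bd_markov_iterate[OF assms, of 1 n] area_iter_mono[of 0 n] by simp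

lemma holder_bd_markov_op: "holder_bd \<alpha> s m f \<Longrightarrow> holder_bd \<alpha> s (m + 2 * s) (T f)"
  using holder_bd_markov_power[of s m f 1] by simp

text \<open>Areas enter with the power \<alpha>, so they have to be contracted by
  \<open>\<epsilon> powr (1 / \<alpha>)\<close>. The number n does not depend on
  \<open>f\<close>.\<close>

lemma Doeblin_Fortet:
  assumes "Pur \<mu>" "0 < \<epsilon>"
  obtains n where "\<And>s m f. holder_bd \<alpha> s m f \<Longrightarrow> holder_bd \<alpha> s (m * \<epsilon> + 2 * s) ((T ^^ n) f)"
proof -
  obtain n where n: "\<And>x y. area_iter n x y \<le> \<epsilon> powr (1 / \<alpha>) * area x y"
    using Pur_area_iter_small[OF assms(1), of "\<epsilon> powr (1 / \<alpha>)"] assms(2) by auto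
  have "(\<epsilon> powr (1 / \<alpha>)) powr \<alpha> = \<epsilon>" using assms(2) \<alpha> by (simp add: powr_powr)
  then show ?thesis
    using that[of n] holder_bd_markov_iterate[OF _ _ n] by simp
qed

lemma markov_power_add:
  assumes "holder_bd \<alpha> s m f" "holder_bd \<alpha> s' m' g"
  shows "(T ^^ n) (\<lambda>X. f X + g X) = (\<lambda>X. (T ^^ n) f X + (T ^^ n) g X)"
  by (induction n) (simp_all add: markov_op_add[OF holder_bd_markov_power[OF assms(1)] holder_bd_markov_power[OF assms(2)]])

lemma markov_power_cmult: "(T ^^ n) (\<lambda>X. c * f X) = (\<lambda>X. c * (T ^^ n) f X)"
  by (induction n) (simp_all add: markov_op_cmult)

end

section \<open>Hoelder spaces\<close>

lemma holder_bd_imp_holder_space: "holder_bd \<alpha> s m f \<Longrightarrow> f \<in> holder_space \<alpha>"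
  by (auto simp: holder_bd_def holder_space_def)

lemma holder_norm_le:
  assumes "holder_bd \<alpha> s m f"
  shows "holder_norm \<alpha> f \<le> s + m"
  unfolding holder_norm_def
proof (rule add_mono)
  show "(SUP X. cmod (f X)) \<le> s"
    using holder_bdD(3)[OF assms] by (intro cSUP_least) auto
  show "holder_seminorm \<alpha> f \<le> m"
    unfolding holder_seminorm_def
  proof (rule cSup_least)
    fix t assume "t \<in> insert 0 {cmod (f X - f Y) / proj_dist X Y powr \<alpha> |X Y. X \<noteq> Y}"
    then consider "t = 0" | X Y where "X \<noteq> Y" "t = cmod (f X - f Y) / proj_dist X Y powr \<alpha>" by blast
    then show "t \<le> m"
    proof cases
      case 2
      have "proj_dist X Y > 0"
        using 2(1) proj_dist_eq_0_iff[of X Y] proj_dist_nonneg[of X Y] by linarith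
      then show ?thesis using 2(2) holder_bdD(4)[OF assms, of X Y] by (simp add: pos_divide_le_eq)
    qed (use holder_bdD(1)[OF assms] in simp)
  qed simp
qed

text \<open>Boundedness follows from the Hoelder condition because the diameter is at most 1. Taking
  the full norm for both bounds is coarse but convenient.\<close>

lemma holder_bd_holder_norm:
  fixes f :: "'k::finite proj \<Rightarrow> complex"
  assumes "f \<in> holder_space \<alpha>" "0 < \<alpha>"
  shows "holder_bd \<alpha> (holder_norm \<alpha> f) (holder_norm \<alpha> f) f"
proof -
  obtain C where C: "cmod (f X - f Y) \<le> C * proj_dist X Y powr \<alpha>" for X Y
    using assms(1) unfolding holder_space_def by blast
  have d1: "proj_dist X Y powr \<alpha> \<le> 1" for X Y :: "'k proj"
    using powr_mono2[of \<alpha> "proj_dist X Y" 1] proj_dist_le_1[of X Y] assms(2) by simp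
  have "cmod (f X) \<le> cmod (f undefined) + \<bar>C\<bar>" for X
  proof -
    have "C * proj_dist X undefined powr \<alpha> \<le> \<bar>C\<bar> * 1"
      by (intro mult_mono d1) auto
    then show ?thesis
      using C[of X undefined] norm_triangle_sub[of "f X" "f undefined"] by linarith
  qed
  then have "bdd_above (range (\<lambda>X. cmod (f X)))" by (intro bdd_aboveI2)
  then have S: "cmod (f X) \<le> (SUP X. cmod (f X))" for X by (rule cSUP_upper[rotated]) simp
  let ?A = "insert 0 {cmod (f X - f Y) / proj_dist X Y powr \<alpha> |X Y. X \<noteq> Y}"
  have pd: "proj_dist X Y > 0" if "X \<noteq> Y" for X Y :: "'k proj"
    using that proj_dist_eq_0_iff[of X Y] proj_dist_nonneg[of X Y] by linarith
  have bdd: "bdd_above ?A"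
  proof (rule bdd_aboveI)
    fix t assume "t \<in> ?A"
    then show "t \<le> \<bar>C\<bar>"
    proof (clarsimp, elim disjE exE conjE, simp)
      fix X Y :: "'k proj" assume "X \<noteq> Y" "t = cmod (f X - f Y) / proj_dist X Y powr \<alpha>"
      moreover have "C * proj_dist X Y powr \<alpha> \<le> \<bar>C\<bar> * proj_dist X Y powr \<alpha>"
        by (intro mult_right_mono) auto
      ultimately show "t \<le> \<bar>C\<bar>"
        using order_trans[OF C[of X Y]] pd[of X Y] by (simp add: pos_divide_le_eq)
    qed
  qed
  have m: "cmod (f X - f Y) \<le> holder_seminorm \<alpha> f * proj_dist X Y powr \<alpha>" for X Y
  proof (cases "X = Y")
    case False
    have "cmod (f X - f Y) / proj_dist X Y powr \<alpha> \<le> holder_seminorm \<alpha> f"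
      unfolding holder_seminorm_def using False by (intro cSup_upper[OF _ bdd]) blast
    then show ?thesis using pd[OF False] by (simp add: pos_divide_le_eq)
  qed simp
  have m0: "0 \<le> holder_seminorm \<alpha> f"
    unfolding holder_seminorm_def by (rule cSup_upper[OF _ bdd]) simp
  have s0: "0 \<le> (SUP X. cmod (f X))" using S norm_ge_zero order_trans by blast
  have "holder_bd \<alpha> (SUP X. cmod (f X)) (holder_seminorm \<alpha> f) f"
    unfolding holder_bd_def using S m m0 by blast
  then show ?thesis
    by (rule holder_bd_mono) (use s0 m0 in \<open>simp_all add: holder_norm_def\<close>)
qed

lemma holder_norm_nonneg:
  assumes "f \<in> holder_space \<alpha>" "0 < \<alpha>"
  shows "0 \<le> holder_norm \<alpha> f"
  using holder_bdD(1)[OF holder_bd_holder_norm[OF assms]] .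

lemma holder_bd_limit:
  assumes "\<And>n. holder_bd \<alpha> s m (h n)" "\<And>X. (\<lambda>n. h n X) \<longlonglongrightarrow> g X"
  shows "holder_bd \<alpha> s m g"
  unfolding holder_bd_def
proof (intro conjI allI)
  show "0 \<le> m" by (rule holder_bdD(1)[OF assms(1)])
  fix X Y
  show "cmod (g X) \<le> s"
    by (rule LIMSEQ_le_const2[OF tendsto_norm[OF assms(2)]]) (use holder_bdD(3)[OF assms(1)] in blast)
  show "cmod (g X - g Y) \<le> m * proj_dist X Y powr \<alpha>"
    by (rule LIMSEQ_le_const2[OF tendsto_norm[OF tendsto_diff[OF assms(2) assms(2)]]])
      (use holder_bdD(4)[OF assms(1)] in blast)
qed

lemma area_le_norm_diff: "norm x = 1 \<Longrightarrow> area x y \<le> norm (x - y)"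
  using area_shear[of x "y - x" 1] area_le[of x "y - x"] by (simp add: norm_minus_commute)

text \<open>Functions are lifted to the compact unit sphere for Arzela--Ascoli; the distance of two
  classes is at most that of their unit representatives, so the lifts are equicontinuous. The limit
  is read off at \<open>unit_rep\<close>.\<close>

lemma holder_bd_compact:
  fixes h :: "nat \<Rightarrow> 'k::finite proj \<Rightarrow> complex"
  assumes h: "\<And>n. holder_bd \<alpha> s m (h n)" and \<alpha>: "0 < \<alpha>"
  obtains r g where "strict_mono (r :: nat \<Rightarrow> nat)" "holder_bd \<alpha> s m g"
    "\<And>e. 0 < e \<Longrightarrow> \<exists>N. \<forall>n\<ge>N. \<forall>X. cmod (h (r n) X - g X) < e"
proof -
  have m: "0 \<le> m" by (rule holder_bdD(1)[OF h])
  have eq: "\<exists>d>0. \<forall>n y. y \<in> sphere 0 1 \<and> norm (x - y) < d \<longrightarrow>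
      cmod (h n (abs_proj x) - h n (abs_proj y)) < e"
    if x: "x \<in> sphere 0 1" and e: "0 < e" for x :: "complex ^ 'k" and e
  \<comment> \<open>The denominator \<open>m + 1\<close> covers the case m = 0.\<close>
  proof (intro exI[of _ "(e / (m + 1)) powr (1 / \<alpha>)"] conjI allI impI)
    show "(e / (m + 1)) powr (1 / \<alpha>) > 0" using e m by simp
    fix n and y :: "complex ^ 'k" assume y: "y \<in> sphere 0 1 \<and> norm (x - y) < (e / (m + 1)) powr (1 / \<alpha>)"
    have nz: "x \<noteq> 0" "y \<noteq> 0" "norm x = 1" "norm y = 1" using x y by auto
    have "cmod (h n (abs_proj x) - h n (abs_proj y)) \<le> m * proj_dist (abs_proj x) (abs_proj y) powr \<alpha>"
      by (rule holder_bdD(4)[OF h])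
    also have "\<dots> \<le> m * norm (x - y) powr \<alpha>"
      using area_le_norm_diff[OF nz(3), of y] \<alpha> nz
      by (intro mult_left_mono powr_mono2 m) (auto simp: proj_dist_abs_proj)
    also have "\<dots> \<le> (m + 1) * norm (x - y) powr \<alpha>" by (intro mult_right_mono) auto
    also have "\<dots> < (m + 1) * ((e / (m + 1)) powr (1 / \<alpha>)) powr \<alpha>"
      using y m \<alpha> by (intro mult_strict_left_mono powr_less_mono2) auto
    also have "\<dots> = e" using e m \<alpha> by (simp add: powr_powr)
    finally show "cmod (h n (abs_proj x) - h n (abs_proj y)) < e" .
  qed
  obtain g r where g: "strict_mono (r :: nat \<Rightarrow> nat)"
    "\<And>e. 0 < e \<Longrightarrow> \<exists>N. \<forall>n x. n \<ge> N \<and> x \<in> sphere (0 :: complex ^ 'k) 1 \<longrightarrow> norm (h (r n) (abs_proj x) - g x) < e"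
    by (rule Arzela_Ascoli[OF compact_sphere[of "0 :: complex ^ 'k" 1], of "\<lambda>n x. h n (abs_proj x)" s])
      (use eq holder_bdD(3)[OF h] in auto)
  have u: "\<exists>N. \<forall>n\<ge>N. \<forall>X. cmod (h (r n) X - g (unit_rep X)) < e" if e: "0 < e" for e
  proof -
    obtain N where N: "\<And>n x. n \<ge> N \<Longrightarrow> norm x = 1 \<Longrightarrow> norm (h (r n) (abs_proj x) - g x) < e"
      using g(2)[OF e] by auto
    have "cmod (h (r n) X - g (unit_rep X)) < e" if "n \<ge> N" for n X
      using N[OF that norm_unit_rep[of X]] by simp
    then show ?thesis by blast
  qed
  have "(\<lambda>n. h (r n) X) \<longlonglongrightarrow> g (unit_rep X)" for X
  proof (rule LIMSEQ_I)
    fix e :: real assume "0 < e"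
    then show "\<exists>N. \<forall>n\<ge>N. cmod (h (r n) X - g (unit_rep X)) < e" using u by blast
  qed
  then have "holder_bd \<alpha> s m (\<lambda>X. g (unit_rep X))"
    by (rule holder_bd_limit[where h = "\<lambda>n. h (r n)", OF h])
  then show ?thesis using that g(1) u by blast
qed

section \<open>The Fredholm alternative on the unit circle\<close>

context normalized_holder
begin

abbreviation "V \<equiv> holder_space \<alpha>"
abbreviation "N \<equiv> holder_norm \<alpha>"

lemma bd_norm: "f \<in> V \<Longrightarrow> holder_bd \<alpha> (N f) (N f) f"
  using holder_bd_holder_norm \<alpha> by blast

lemma T_in_V: "f \<in> V \<Longrightarrow> T f \<in> V"
  by (rule holder_bd_imp_holder_space[OF holder_bd_markov_op[OF bd_norm]])

lemma V_add: "f \<in> V \<Longrightarrow> g \<in> V \<Longrightarrow> (\<lambda>X. f X + g X) \<in> V"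
  by (rule holder_bd_imp_holder_space[OF holder_bd_add[OF bd_norm bd_norm]])

lemma V_cmult: "f \<in> V \<Longrightarrow> (\<lambda>X. c * f X) \<in> V"
  by (rule holder_bd_imp_holder_space[OF holder_bd_cmult[OF bd_norm]])

lemma V_diff: "f \<in> V \<Longrightarrow> g \<in> V \<Longrightarrow> (\<lambda>X. f X - g X) \<in> V"
  using V_add[of f "\<lambda>X. - 1 * g X", OF _ V_cmult] by simp

lemma V_sum: "(\<And>i. i \<in> I \<Longrightarrow> f i \<in> V) \<Longrightarrow> (\<lambda>X. \<Sum>i\<in>I. f i X) \<in> V"
  by (induction I rule: infinite_finite_induct)
    (auto intro!: V_add holder_bd_imp_holder_space[OF holder_bd_0])

lemma T_power_in_V: "f \<in> V \<Longrightarrow> (T ^^ n) f \<in> V"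
  by (induction n) (auto intro: T_in_V)

lemma T_add: "f \<in> V \<Longrightarrow> g \<in> V \<Longrightarrow> T (\<lambda>X. f X + g X) = (\<lambda>X. T f X + T g X)"
  by (rule markov_op_add[OF bd_norm bd_norm])

lemma T_diff: "f \<in> V \<Longrightarrow> g \<in> V \<Longrightarrow> T (\<lambda>X. f X - g X) = (\<lambda>X. T f X - T g X)"
  using T_add[of f "\<lambda>X. - 1 * g X", OF _ V_cmult] markov_op_cmult[of "- 1" g] by simp

text \<open>\<open>T\<close> does not increase the supremum norm, so uniform convergence
  suffices.\<close>

lemma T_tendsto:
  assumes "\<And>n. h n \<in> V" "g \<in> V" "\<And>e. 0 < e \<Longrightarrow> \<exists>K. \<forall>n\<ge>K. \<forall>X. cmod (h n X - g X) < e"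
  shows "(\<lambda>n. T (h n) X) \<longlonglongrightarrow> T g X"
proof (rule LIMSEQ_I)
  fix e :: real assume "0 < e"
  then obtain K where K: "\<And>n X. n \<ge> K \<Longrightarrow> cmod (h n X - g X) < e / 2" using assms(3)[of "e / 2"] by auto
  have "cmod (T (h n) X - T g X) < e" if "n \<ge> K" for n
  proof -
    have "cmod (T (\<lambda>X. h n X - g X) X) \<le> e / 2"
      by (rule norm_markov_op_le[OF bd_norm[OF V_diff[OF assms(1,2)]]]) (use K[OF that] in \<open>simp add: less_imp_le\<close>)
    then show ?thesis using \<open>0 < e\<close> by (simp add: T_diff assms)
  qed
  then show "\<exists>K. \<forall>n\<ge>K. norm (T (h n) X - T g X) < e" by auto
qed

text \<open>With g = (z - T) f this iterates f = z^-1 (T f + g).\<close>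

lemma resolvent_expansion:
  assumes f: "f \<in> V" and z: "z \<noteq> 0"
  shows "f X = inverse z ^ n * (T ^^ n) f X
    + (\<Sum>j<n. inverse z ^ Suc j * (T ^^ j) (\<lambda>X. z * f X - T f X) X)"
proof (induction n)
  case (Suc n)
  let ?g = "\<lambda>X. z * f X - T f X"
  have g: "?g \<in> V" by (intro V_diff V_cmult T_in_V f)
  have "f = (\<lambda>X. inverse z * (T f X + ?g X))" using z by (auto simp: field_simps)
  then have "(T ^^ n) f = (T ^^ n) (\<lambda>X. inverse z * (T f X + ?g X))" by simp
  also have "\<dots> = (\<lambda>X. inverse z * ((T ^^ Suc n) f X + (T ^^ n) ?g X))"
    using markov_power_add[OF bd_norm[OF T_in_V[OF f]] bd_norm[OF g], of n]
    by (simp add: markov_power_cmult funpow_swap1)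
  finally have "(T ^^ n) f X = inverse z * ((T ^^ Suc n) f X + (T ^^ n) ?g X)"
    by (rule fun_cong)
  then have "inverse z ^ n * (T ^^ n) f X
      = inverse z ^ Suc n * (T ^^ Suc n) f X + inverse z ^ Suc n * (T ^^ n) ?g X"
    by (simp add: algebra_simps)
  then show ?case using Suc by simp
qed simp

text \<open>In the expansion to order \<open>k\<close> the leading term has a small seminorm by
  Doeblin--Fortet, and the others are controlled by the defect (z - T) f. What remains is the
  supremum norm, for which compactness is available.\<close>

lemma holder_norm_apriori:
  assumes "Pur \<mu>"
  shows "\<exists>K. \<forall>f\<in>V. \<forall>z \<sigma>. cmod z = 1 \<longrightarrow> (\<forall>X. cmod (f X) \<le> \<sigma>) \<longrightarrow>
    N f \<le> 4 * \<sigma> + K * N (\<lambda>X. z * f X - T f X)"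
proof -
  obtain k where k: "\<And>s m f. holder_bd \<alpha> s m f \<Longrightarrow> holder_bd \<alpha> s (m * (1/4) + 2 * s) ((T ^^ k) f)"
    by (rule Doeblin_Fortet[OF assms, of "1/4"]) auto
  have "N f \<le> 4 * \<sigma> + (6 * k) * N (\<lambda>X. z * f X - T f X)"
    if f: "f \<in> V" and z: "cmod z = 1" and \<sigma>: "\<And>X. cmod (f X) \<le> \<sigma>" for f z \<sigma>
  proof -
    let ?g = "\<lambda>X. z * f X - T f X"
    have g: "?g \<in> V" by (intro V_diff V_cmult T_in_V f)
    have z0: "z \<noteq> 0" and w: "cmod (inverse z) = 1" using z by (auto simp: norm_inverse)
    have "holder_bd \<alpha> \<sigma> (N f) f"
      using bd_norm[OF f] \<sigma> by (simp add: holder_bd_def)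
    then have "holder_bd \<alpha> \<sigma> (N f * (1/4) + 2 * \<sigma>) ((T ^^ k) f)" by (rule k)
    from holder_bd_cmult[OF this, of "inverse z ^ k"]
    have 1: "holder_bd \<alpha> \<sigma> (N f * (1/4) + 2 * \<sigma>) (\<lambda>X. inverse z ^ k * (T ^^ k) f X)"
      using w by (simp add: norm_power)
    have "holder_bd \<alpha> (N ?g) (N ?g + 2 * N ?g) (\<lambda>X. inverse z ^ Suc j * (T ^^ j) ?g X)" for j
      using holder_bd_cmult[OF holder_bd_markov_power[OF bd_norm[OF g]], of "inverse z ^ Suc j"] w
      by (simp add: norm_power norm_mult)
    then have "holder_bd \<alpha> (\<Sum>j<k. N ?g) (\<Sum>j<k. N ?g + 2 * N ?g)
        (\<lambda>X. \<Sum>j<k. inverse z ^ Suc j * (T ^^ j) ?g X)"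
      by (intro holder_bd_sum)
    from holder_bd_add[OF 1 this]
    have "holder_bd \<alpha> (\<sigma> + (\<Sum>j<k. N ?g)) (N f * (1/4) + 2 * \<sigma> + (\<Sum>j<k. N ?g + 2 * N ?g)) f"
      by (simp only: resolvent_expansion[OF f z0, of _ k, symmetric])
    from holder_norm_le[OF this]
    \<comment> \<open>The bound reads N f <= N f / 4 + 3 \<sigma> + 4 k N g. Solving for N f gives
      the coefficients 4 and 16 k / 3 <= 6 k.\<close>
    have "N f \<le> 4 * \<sigma> + 4 * (4 * (k * N ?g)) / 3" by simp
    moreover have "0 \<le> k * N ?g" using holder_norm_nonneg[OF g] \<alpha> by simp
    ultimately show ?thesis by simp
  qed
  then show ?thesis by blast
qed

text \<open>Normalised counterexamples with vanishing defect have a uniform limit, which is an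
  eigenfunction and therefore 0; the a priori bound then pushes their Hoelder norm below 1.\<close>

lemma bounded_below:
  assumes "Pur \<mu>" "cmod z = 1"
    and no_eigen: "\<And>f. f \<in> V \<Longrightarrow> (\<And>X. T f X = z * f X) \<Longrightarrow> f = (\<lambda>X. 0)"
  obtains C where "\<And>f. f \<in> V \<Longrightarrow> N f \<le> C * N (\<lambda>X. z * f X - T f X)"
proof -
  let ?D = "\<lambda>f X. z * f X - T f X"
  have DV: "?D f \<in> V" if "f \<in> V" for f
    by (intro V_diff V_cmult T_in_V that)
  have "\<exists>C. \<forall>f\<in>V. N f \<le> C * N (?D f)"
  proof (rule ccontr)
    assume "\<not> ?thesis"
    then have "\<forall>n::nat. \<exists>f\<in>V. real (Suc n) * N (?D f) < N f" by (meson not_le)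
    then obtain f where f: "\<And>n. f n \<in> V" "\<And>n. real (Suc n) * N (?D (f n)) < N (f n)" by metis
    have N0: "0 \<le> N (?D (f n))" for n using holder_norm_nonneg[OF DV[OF f(1)]] \<alpha> by simp
    have Npos: "0 < N (f n)" for n
      using f(2)[of n] N0[of n] by (smt (verit) mult_nonneg_nonneg of_nat_0_le_iff)
    have Dle: "N (?D (f n)) / N (f n) \<le> inverse (real (Suc n))" for n
      using f(2)[of n] Npos[of n] by (simp add: field_simps)
    define h where "h n = (\<lambda>X. of_real (1 / N (f n)) * f n X)" for n
    have h: "holder_bd \<alpha> 1 1 (h n)" for n
      using holder_bd_cmult[OF bd_norm[OF f(1)[of n]], of "of_real (1 / N (f n))"] Npos[of n]
      by (simp add: h_def norm_divide)
    have hV: "h n \<in> V" for n using h holder_bd_imp_holder_space by blast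
    have Dh: "?D (h n) X = of_real (1 / N (f n)) * ?D (f n) X" for n X
      unfolding h_def markov_op_cmult by (simp only: right_diff_distrib mult.left_commute)
    have Dh_le: "cmod (?D (h n) X) \<le> inverse (real (Suc n))" for n X
    proof -
      have "cmod (?D (h n) X) \<le> N (?D (f n)) / N (f n)"
        unfolding Dh using holder_bdD(3)[OF bd_norm[OF DV[OF f(1)[of n]]], of X] Npos[of n]
        by (simp add: norm_mult norm_divide divide_right_mono)
      then show ?thesis using Dle order_trans by blast
    qed
    obtain r g where r: "strict_mono (r :: nat \<Rightarrow> nat)" and g: "holder_bd \<alpha> 1 1 g"
      and u: "\<And>e. 0 < e \<Longrightarrow> \<exists>K. \<forall>n\<ge>K. \<forall>X. cmod (h (r n) X - g X) < e"
      using holder_bd_compact[of \<alpha> 1 1 h] h \<alpha> by blast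
    have gV: "g \<in> V" using g holder_bd_imp_holder_space by blast
    have "g = (\<lambda>X. 0)"
    proof (rule no_eigen[OF gV])
      fix X
      have hg: "(\<lambda>n. h (r n) X) \<longlonglongrightarrow> g X"
        by (rule LIMSEQ_I) (use u in blast)
      have "(\<lambda>n. T (h (r n)) X) \<longlonglongrightarrow> T g X"
        by (rule T_tendsto[where h = "\<lambda>n. h (r n)", OF hV gV u])
      then have "(\<lambda>n. ?D (h (r n)) X) \<longlonglongrightarrow> z * g X - T g X"
        by (intro tendsto_intros hg)
      moreover have "(\<lambda>n. ?D (h (r n)) X) \<longlonglongrightarrow> 0"
      proof (rule Lim_null_comparison)
        show "\<forall>\<^sub>F n in sequentially. norm (?D (h (r n)) X) \<le> inverse (real (Suc (r n)))"
          using Dh_le by simp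
        show "(\<lambda>n. inverse (real (Suc (r n)))) \<longlonglongrightarrow> 0"
          using LIMSEQ_subseq_LIMSEQ[OF LIMSEQ_inverse_real_of_nat r] by (simp add: o_def)
      qed
      ultimately show "T g X = z * g X" using LIMSEQ_unique by fastforce
    qed
    \<comment> \<open>With \<sigma> = N f / 8 the a priori term 4 \<sigma> is half of the norm. The
      defect will contribute at most a quarter, so that N f <= 3/4 N f.\<close>
    then obtain K where K: "\<And>n X. n \<ge> K \<Longrightarrow> cmod (h (r n) X) < 1 / 8"
      using u[of "1/8"] by auto
    obtain B where B': "\<forall>f\<in>V. \<forall>z \<sigma>. cmod z = 1 \<longrightarrow> (\<forall>X. cmod (f X) \<le> \<sigma>) \<longrightarrow>
        N f \<le> 4 * \<sigma> + B * N (\<lambda>X. z * f X - T f X)"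
      using holder_norm_apriori[OF assms(1)] by (rule exE)
    have B: "N f \<le> 4 * \<sigma> + B * N (?D f)" if "f \<in> V" "\<And>X. cmod (f X) \<le> \<sigma>" for f \<sigma>
      using B' that assms(2) by simp
    obtain n0 where n0: "real n0 > 4 * \<bar>B\<bar>" using reals_Archimedean2 by blast
    define n where "n = max K n0"
    have rn: "n \<le> r n" using r by (rule seq_suble)
    let ?f = "f (r n)"
    have "cmod (?f X) \<le> N ?f / 8" for X
    proof -
      have "cmod (h (r n) X) = cmod (?f X) / N ?f"
        using Npos[of "r n"] by (simp add: h_def norm_mult norm_divide)
      then show ?thesis using K[of n X] Npos[of "r n"] by (simp add: n_def pos_divide_less_eq)
    qed
    then have "N ?f \<le> 4 * (N ?f / 8) + B * N (?D ?f)"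
      by (rule B[OF f(1)])
    moreover have "B * N (?D ?f) \<le> \<bar>B\<bar> * N (?D ?f)"
      by (intro mult_right_mono N0) simp
    moreover have "\<bar>B\<bar> * N (?D ?f) \<le> N ?f / 4"
    proof -
      have "4 * \<bar>B\<bar> \<le> real (Suc (r n))" using n0 rn by (simp add: n_def)
      then have "4 * \<bar>B\<bar> * N (?D ?f) \<le> real (Suc (r n)) * N (?D ?f)" by (intro mult_right_mono N0)
      then show ?thesis using f(2)[of "r n"] by simp
    qed
    ultimately show False using Npos[of "r n"] by linarith
  qed
  then show ?thesis using that by blast
qed

section \<open>Solving the resolvent equation on the unit circle\<close>

definition partial_resolvent :: "complex \<Rightarrow> ('k proj \<Rightarrow> complex) \<Rightarrow> nat \<Rightarrow> 'k proj \<Rightarrow> complex" where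
  "partial_resolvent z g n X = (\<Sum>j<n. inverse z ^ Suc j * (T ^^ j) g X)"

lemma partial_resolvent_in_V: "g \<in> V \<Longrightarrow> partial_resolvent z g n \<in> V"
  unfolding partial_resolvent_def[abs_def] by (rule V_sum, rule V_cmult, rule T_power_in_V)

lemma partial_resolvent_eq:
  assumes "g \<in> V" "z \<noteq> 0"
  shows "z * partial_resolvent z g n X - T (partial_resolvent z g n) X = g X - inverse z ^ n * (T ^^ n) g X"
proof (induction n)
  case 0
  have "T (\<lambda>X. 0) X = 0" using markov_op_cmult[of 0 "\<lambda>X. 0"] by (simp add: fun_eq_iff)
  then show ?case by (simp add: partial_resolvent_def[abs_def])
next
  case (Suc n)
  have "partial_resolvent z g (Suc n) = (\<lambda>X. partial_resolvent z g n X + inverse z ^ Suc n * (T ^^ n) g X)"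
    by (simp add: partial_resolvent_def fun_eq_iff)
  then have 1: "T (partial_resolvent z g (Suc n)) X
      = T (partial_resolvent z g n) X + inverse z ^ Suc n * (T ^^ Suc n) g X"
    by (simp add: T_add partial_resolvent_in_V assms V_cmult T_power_in_V markov_op_cmult del: power_Suc)
  have 2: "z * partial_resolvent z g (Suc n) X = z * partial_resolvent z g n X + inverse z ^ n * (T ^^ n) g X"
    using assms(2) by (simp add: partial_resolvent_def algebra_simps)
  have "z * partial_resolvent z g (Suc n) X - T (partial_resolvent z g (Suc n)) X
      = (z * partial_resolvent z g n X - T (partial_resolvent z g n) X)
        + (inverse z ^ n * (T ^^ n) g X - inverse z ^ Suc n * (T ^^ Suc n) g X)"
    unfolding 1 2 by (simp only: diff_diff_eq add_diff_eq diff_add_eq)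
  then show ?case unfolding Suc by simp
qed

lemma holder_bd_partial_resolvent_defect:
  assumes "g \<in> V" "cmod z = 1"
  shows "holder_bd \<alpha> (2 * N g) (4 * N g) (\<lambda>X. g X - inverse z ^ n * (T ^^ n) g X)"
proof -
  have "cmod (- (inverse z ^ n)) = 1" using assms(2) by (simp add: norm_power norm_inverse)
  then show ?thesis
    using holder_bd_add[OF bd_norm[OF assms(1)]
        holder_bd_cmult[OF holder_bd_markov_power[OF bd_norm[OF assms(1)], of n], of "- (inverse z ^ n)"]]
    by (simp add: algebra_simps)
qed

text \<open>Bounded partial sums of the Neumann series are approximate solutions of the resolvent equation in
  the Cesaro mean.\<close>

lemma resolvent_equation_solvable:
  assumes g: "g \<in> V" and z: "cmod z = 1"
    and C: "\<And>f. f \<in> V \<Longrightarrow> N f \<le> C * N (\<lambda>X. z * f X - T f X)"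
  shows "\<exists>f\<in>V. \<forall>X. z * f X - T f X = g X"
proof -
  have z0: "z \<noteq> 0" using z by auto
  let ?a = "partial_resolvent z g"
  have a: "?a n \<in> V" for n by (rule partial_resolvent_in_V[OF g])
  \<comment> \<open>The defect of the n-th partial sum is \<open>g\<close> minus a rotated iterate
    of \<open>g\<close>, bounded in the Hoelder norm uniformly in n; the lower bound for z - T
    transfers this to the partial sum.\<close>
  have "N (?a n) \<le> \<bar>C\<bar> * (2 * N g + 4 * N g)" for n
  proof -
    have "N (?a n) \<le> C * N (\<lambda>X. g X - inverse z ^ n * (T ^^ n) g X)"
      using C[OF a[of n]] by (simp add: partial_resolvent_eq[OF g z0])
    also have "\<dots> \<le> \<bar>C\<bar> * (2 * N g + 4 * N g)"
    proof (rule mult_mono)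
      show "N (\<lambda>X. g X - inverse z ^ n * (T ^^ n) g X) \<le> 2 * N g + 4 * N g"
        by (rule holder_norm_le[OF holder_bd_partial_resolvent_defect[OF g z]])
      show "0 \<le> N (\<lambda>X. g X - inverse z ^ n * (T ^^ n) g X)"
        using holder_norm_nonneg[OF holder_bd_imp_holder_space[OF holder_bd_partial_resolvent_defect[OF g z]]] \<alpha> by simp
    qed auto
    finally show ?thesis .
  qed
  then obtain B where B: "\<And>n. N (?a n) \<le> B" by blast
  have aB: "holder_bd \<alpha> B B (?a n)" for n
    by (rule holder_bd_mono[OF bd_norm[OF a]]) (rule B)+
  define b where "b n = (\<lambda>X. \<Sum>i<n. ?a i X)" for n
  have bV: "b n \<in> V" for n unfolding b_def by (intro V_sum a)
  \<comment> \<open>The defects of the partial sums add up to n g minus z times the n-th partial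
    sum, so division by n leaves an error of order 1/n.\<close>
  have beq: "z * b n X - T (b n) X = of_nat n * g X - z * ?a n X" for n X
  proof (induction n)
    case 0
    have "T (\<lambda>X. 0) X = 0" using markov_op_cmult[of 0 "\<lambda>X. 0"] by (simp add: fun_eq_iff)
    then show ?case by (simp add: b_def partial_resolvent_def)
  next
    case (Suc n)
    have "b (Suc n) = (\<lambda>X. b n X + ?a n X)" by (simp add: b_def)
    then have "z * b (Suc n) X - T (b (Suc n)) X
        = (of_nat n * g X - z * ?a n X) + (g X - inverse z ^ n * (T ^^ n) g X)"
      using Suc partial_resolvent_eq[OF g z0, of n X] by (simp add: T_add bV a algebra_simps)
    also have "z * ?a n X + inverse z ^ n * (T ^^ n) g X = z * ?a (Suc n) X"
      using z0 by (simp add: partial_resolvent_def algebra_simps)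
    then have "(of_nat n * g X - z * ?a n X) + (g X - inverse z ^ n * (T ^^ n) g X)
        = of_nat (Suc n) * g X - z * ?a (Suc n) X"
      by (simp add: algebra_simps)
    finally show ?case .
  qed
  define f where "f n = (\<lambda>X. of_real (1 / real (Suc n)) * b (Suc n) X)" for n
  have f: "holder_bd \<alpha> B B (f n)" for n
  proof -
    have "holder_bd \<alpha> (\<Sum>i<Suc n. B) (\<Sum>i<Suc n. B) (b (Suc n))"
      unfolding b_def by (rule holder_bd_sum) (rule aB)
    from holder_bd_cmult[OF this, of "of_real (1 / real (Suc n))"] show ?thesis
      by (simp add: f_def norm_divide del: of_nat_Suc)
  qed
  have fV: "f n \<in> V" for n using f holder_bd_imp_holder_space by blast
  have feq: "z * f n X - T (f n) X = g X - of_real (1 / real (Suc n)) * z * ?a (Suc n) X" for n X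
  proof -
    have "z * f n X - T (f n) X = of_real (1 / real (Suc n)) * (z * b (Suc n) X - T (b (Suc n)) X)"
      unfolding f_def markov_op_cmult by (simp only: right_diff_distrib mult.left_commute)
    then show ?thesis
      unfolding beq by (simp add: right_diff_distrib del: of_nat_Suc)
  qed
  obtain r h where r: "strict_mono (r :: nat \<Rightarrow> nat)" and h: "holder_bd \<alpha> B B h"
    and u: "\<And>e. 0 < e \<Longrightarrow> \<exists>K. \<forall>n\<ge>K. \<forall>X. cmod (f (r n) X - h X) < e"
    using holder_bd_compact[of \<alpha> B B f] f \<alpha> by blast
  have hV: "h \<in> V" using h holder_bd_imp_holder_space by blast
  have "z * h X - T h X = g X" for X
  proof -
    have "(\<lambda>n. f (r n) X) \<longlonglongrightarrow> h X"
      by (rule LIMSEQ_I) (use u in blast)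
    moreover have "(\<lambda>n. T (f (r n)) X) \<longlonglongrightarrow> T h X"
      by (rule T_tendsto[where h = "\<lambda>n. f (r n)", OF fV hV u])
    ultimately have 1: "(\<lambda>n. z * f (r n) X - T (f (r n)) X) \<longlonglongrightarrow> z * h X - T h X"
      by (intro tendsto_intros)
    have "(\<lambda>n. of_real (1 / real (Suc (r n))) * z * ?a (Suc (r n)) X) \<longlonglongrightarrow> 0"
    proof (rule Lim_null_comparison)
      show "\<forall>\<^sub>F n in sequentially. norm (of_real (1 / real (Suc (r n))) * z * ?a (Suc (r n)) X)
          \<le> inverse (real (Suc (r n))) * B"
        using holder_bdD(3)[OF aB] z
        by (intro always_eventually allI) (simp add: norm_mult norm_divide norm_inverse divide_inverse mult_left_mono del: of_nat_Suc)
      show "(\<lambda>n. inverse (real (Suc (r n))) * B) \<longlonglongrightarrow> 0"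
        using LIMSEQ_subseq_LIMSEQ[OF LIMSEQ_inverse_real_of_nat r]
        by (intro tendsto_mult_left_zero) (simp add: o_def)
    qed
    then have "(\<lambda>n. z * f (r n) X - T (f (r n)) X) \<longlonglongrightarrow> g X - 0"
      unfolding feq by (intro tendsto_intros)
    then show ?thesis using LIMSEQ_unique[OF 1] by simp
  qed
  then show ?thesis using hV by blast
qed

text \<open>Without eigenfunctions z - T is bounded below and onto. An inverse is picked by choice;
  uniqueness of solutions makes it linear, and the lower bound makes it bounded.\<close>

lemma spectrum_imp_eigenfunction:
  assumes "Pur \<mu>" "cmod z = 1" "z \<in> op_spectrum V N T"
  obtains f where "f \<in> V" "f \<noteq> (\<lambda>X. 0)" "\<And>X. T f X = z * f X"
proof (rule ccontr)
  assume "\<not> thesis"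
  then have no_eigen: "f = (\<lambda>X. 0)" if "f \<in> V" "\<And>X. T f X = z * f X" for f
    using that \<open>\<And>f. f \<in> V \<Longrightarrow> f \<noteq> (\<lambda>X. 0) \<Longrightarrow> (\<And>X. T f X = z * f X) \<Longrightarrow> thesis\<close> by blast
  obtain C where C: "\<And>f. f \<in> V \<Longrightarrow> N f \<le> C * N (\<lambda>X. z * f X - T f X)"
    using bounded_below[OF assms(1,2) no_eigen] by blast
  define R where "R g = (SOME f. f \<in> V \<and> (\<forall>X. z * f X - T f X = g X))" for g
  have R: "R g \<in> V \<and> (\<forall>X. z * R g X - T (R g) X = g X)" if "g \<in> V" for g
    unfolding R_def by (rule someI_ex[of "\<lambda>f. f \<in> V \<and> (\<forall>X. z * f X - T f X = g X)"]) (use resolvent_equation_solvable[OF that assms(2) C] in blast)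
  have uniq: "f = f'" if "f \<in> V" "f' \<in> V" "\<And>X. z * f X - T f X = z * f' X - T f' X" for f f'
  proof -
    have "(\<lambda>X. f X - f' X) = (\<lambda>X. 0)"
    proof (rule no_eigen)
      fix X show "T (\<lambda>X. f X - f' X) X = z * (f X - f' X)"
        unfolding T_diff[OF that(1,2)] using that(3)[of X] by algebra
    qed (intro V_diff that)
    then show ?thesis by (simp add: fun_eq_iff)
  qed
  have "bounded_op_on V N R"
    unfolding bounded_op_on_def
  proof (intro conjI ballI allI exI[of _ C])
    fix f g :: "'k proj \<Rightarrow> complex" assume f: "f \<in> V" and g: "g \<in> V"
    show "R f \<in> V" using R[OF f] by blast
    show "R (\<lambda>X. f X + g X) = (\<lambda>X. R f X + R g X)"
    proof (rule uniq)
      fix X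
      show "z * R (\<lambda>X. f X + g X) X - T (R (\<lambda>X. f X + g X)) X
          = z * (R f X + R g X) - T (\<lambda>X. R f X + R g X) X"
        using R[OF f] R[OF g] R[OF V_add[OF f g]] by (simp add: T_add algebra_simps)
    qed (simp_all add: R f g V_add)
  next
    fix c and f :: "'k proj \<Rightarrow> complex" assume f: "f \<in> V"
    show "R (\<lambda>X. c * f X) = (\<lambda>X. c * R f X)"
    proof (rule uniq)
      fix X
      have "z * (c * R f X) - c * T (R f) X = c * (z * R f X - T (R f) X)" by (simp add: algebra_simps)
      then show "z * R (\<lambda>X. c * f X) X - T (R (\<lambda>X. c * f X)) X
          = z * (c * R f X) - T (\<lambda>X. c * R f X) X"
        using R[OF f] R[OF V_cmult[OF f]] by (simp add: markov_op_cmult)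
    qed (simp_all add: R f V_cmult)
  next
    fix f :: "'k proj \<Rightarrow> complex" assume f: "f \<in> V"
    show "N (R f) \<le> C * N f" using C[of "R f"] R[OF f] by simp
  qed
  moreover have "R (\<lambda>X. z * f X - T f X) = f \<and> (\<lambda>X. z * R f X - T (R f) X) = f" if f: "f \<in> V" for f
  proof
    have "(\<lambda>X. z * f X - T f X) \<in> V" by (intro V_diff V_cmult T_in_V f)
    then show "R (\<lambda>X. z * f X - T f X) = f" by (intro uniq) (use R f in auto)
    show "(\<lambda>X. z * R f X - T (R f) X) = f" using R[OF f] by auto
  qed
  ultimately show False using assms(3) unfolding op_spectrum_def by blast
qed

text \<open>A bounded inverse would bound the partial sums, because their defects are bounded; at
  \<open>X\<close> they equal n z^-1 g X. The relation is asked for at a single point since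
  \<open>g\<close> need not be an eigenfunction elsewhere.\<close>

lemma in_spectrumI:
  assumes "cmod z = 1" "g \<in> V" "\<And>j. (T ^^ j) g X = z ^ j * g X" "g X \<noteq> 0"
  shows "z \<in> op_spectrum V N T"
proof (rule ccontr)
  assume "z \<notin> op_spectrum V N T"
  then obtain R C where R: "\<And>f. f \<in> V \<Longrightarrow> R (\<lambda>X. z * f X - T f X) = f"
    and C: "\<And>f. f \<in> V \<Longrightarrow> N (R f) \<le> C * N f"
    unfolding op_spectrum_def bounded_op_on_def by blast
  have z0: "z \<noteq> 0" using assms(1) by auto
  let ?a = "partial_resolvent z g"
  have a: "?a n \<in> V" for n by (rule partial_resolvent_in_V[OF assms(2)])
  have bound: "real n * cmod (g X) \<le> \<bar>C\<bar> * (2 * N g + 4 * N g)" for n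
  proof -
    let ?d = "\<lambda>X. g X - inverse z ^ n * (T ^^ n) g X"
    have d: "holder_bd \<alpha> (2 * N g) (4 * N g) ?d"
      by (rule holder_bd_partial_resolvent_defect[OF assms(2,1)])
    have dV: "?d \<in> V" using d by (rule holder_bd_imp_holder_space)
    have "inverse z ^ Suc j * (z ^ j * g X) = inverse z * g X" for j
      using z0 by (simp add: power_inverse)
    then have "(\<Sum>j<n. inverse z ^ Suc j * (z ^ j * g X)) = (\<Sum>j<n. inverse z * g X)"
      by (intro sum.cong refl)
    then have "?a n X = of_nat n * (inverse z * g X)"
      by (simp add: partial_resolvent_def assms(3) del: power_Suc)
    then have "real n * cmod (g X) = cmod (?a n X)"
      using assms(1) by (simp add: norm_mult norm_inverse)
    also have "\<dots> \<le> N (?a n)" by (rule holder_bdD(3)[OF bd_norm[OF a]])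
    also have "\<dots> \<le> C * N ?d"
      using R[OF a[of n]] C[OF dV] by (simp add: partial_resolvent_eq[OF assms(2) z0])
    also have "\<dots> \<le> \<bar>C\<bar> * (2 * N g + 4 * N g)"
      using holder_norm_le[OF d] holder_norm_nonneg[OF dV] \<alpha> by (intro mult_mono) auto
    finally show ?thesis .
  qed
  obtain n where "real n * cmod (g X) > \<bar>C\<bar> * (2 * N g + 4 * N g)"
    using reals_Archimedean3[of "cmod (g X)"] assms(4) by (metis zero_less_norm_iff)
  then show False using bound[of n] by simp
qed

end

section \<open>Peripheral eigenfunctions are quadratic forms\<close>

lemma complex_polarization:
  "(\<Sum>l<4. (- \<i>) ^ l * of_real ((cmod (p + \<i> ^ l * q))\<^sup>2)) = 4 * (cnj p * q)"
proof -
  have "{..<4} = {0, 1, 2, 3 :: nat}" by auto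
  then show ?thesis
    unfolding complex_norm_square by (simp add: power3_eq_cube algebra_simps)
qed

lemma norm_matrix_vector_squared:
  fixes X :: "complex ^ 'k ^ 'm"
  shows "(norm (X *v w))\<^sup>2 = (\<Sum>i\<in>UNIV. (cmod (\<Sum>j\<in>UNIV. X $ i $ j * w $ j))\<^sup>2)"
  by (simp add: norm_vec_def L2_set_def sum_nonneg matrix_vector_mult_def)

lemma matrix_vector_eq_sum:
  fixes X :: "complex ^ 'k ^ 'm"
  shows "X *v w = (\<Sum>i\<in>UNIV. w $ i *s (X *v axis i 1))"
  by (simp add: vec_eq_iff matrix_vector_mult_def axis_def if_distrib sum_distrib_left mult_ac cong: if_cong)

lemma area_scale_left: "area (c *s x) y = cmod c * area x y"
  using area_scale[of c x 1 y] by simp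

context normalized_holder
begin

text \<open>For n = 0 this sums the areas of all pairs of columns, so it vanishes exactly when
  \<open>X\<close> has rank at most one.\<close>

definition frame_area :: "nat \<Rightarrow> complex ^ 'k ^ 'k \<Rightarrow> real" where
  "frame_area n X = (\<Sum>i\<in>UNIV. \<Sum>j\<in>UNIV. area_iter n (X *v axis i 1) (X *v axis j 1))"

lemma frame_area_nonneg: "0 \<le> frame_area n X"
  unfolding frame_area_def by (intro sum_nonneg area_iter_nonneg)

lemma frame_area_mult:
  "frame_area n (v ** X) = (\<Sum>i\<in>UNIV. \<Sum>j\<in>UNIV. area_iter n (v *v (X *v axis i 1)) (v *v (X *v axis j 1)))"
  by (simp add: frame_area_def matrix_vector_mul_assoc)

lemma integrable_frame_area: "integrable \<mu> (\<lambda>v. frame_area n (v ** X))"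
  and integral_frame_area: "(LINT v|\<mu>. frame_area n (v ** X)) = frame_area (Suc n) X"
  unfolding frame_area_mult
  by (auto intro!: Bochner_Integration.integrable_sum integrable_area_iter
      simp: Bochner_Integration.integral_sum integrable_area_iter frame_area_def)

text \<open>For a matrix of rank one with image spanned by \<open>u\<close>, the combination would vanish, since
  \<open>hom_ext f\<close> is a multiple of the squared norm there.\<close>

lemma quadratic_combination_le:
  fixes a :: "'i \<Rightarrow> complex" and w :: "'i \<Rightarrow> complex ^ 'k"
  assumes f: "holder_bd \<alpha> s m f" and L: "finite L"
    and vanish: "\<And>\<eta> :: complex ^ 'k. (\<Sum>l\<in>L. a l * of_real ((cmod (\<Sum>j\<in>UNIV. \<eta> $ j * w l $ j))\<^sup>2)) = 0"
  obtains C where "0 \<le> C"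
    "\<And>X. cmod (\<Sum>l\<in>L. a l * hom_ext f (X *v w l)) \<le> C * (frame_area 0 X powr \<alpha> * ((norm X)\<^sup>2) powr (1 - \<alpha>))"
proof -
  have m: "0 \<le> m" by (rule holder_bdD(1)[OF f])
  define c where "c l = (\<Sum>i\<in>UNIV. cmod (w l $ i))" for l
  have c0: "0 \<le> c l" for l unfolding c_def by (intro sum_nonneg) auto
  define C where "C = (\<Sum>l\<in>L. cmod (a l) * (m * (c l)\<^sup>2))"
  have C: "0 \<le> C" unfolding C_def by (intro sum_nonneg mult_nonneg_nonneg m) auto
  have "cmod (\<Sum>l\<in>L. a l * hom_ext f (X *v w l)) \<le> C * (frame_area 0 X powr \<alpha> * ((norm X)\<^sup>2) powr (1 - \<alpha>))" for X
  proof -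
    \<comment> \<open>The longest column gives the reference direction \<open>u\<close>, so that
      each \<open>X *v w l\<close> is at most a fixed multiple of \<open>u\<close> in
      length.\<close>
    obtain p where p: "\<And>i. norm (X *v axis i 1) \<le> norm (X *v axis p 1)"
    proof -
      let ?M = "range (\<lambda>i. norm (X *v axis i 1))"
      have "Max ?M \<in> ?M" by (rule Max_in) auto
      then obtain p where p: "Max ?M = norm (X *v axis p 1)" by blast
      have "norm (X *v axis i 1) \<le> Max ?M" for i by (rule Max_ge) auto
      then show ?thesis using that unfolding p by blast
    qed
    define u where "u = X *v axis p 1"
    show ?thesis
    proof (cases "u = 0")
      case True
      then have "X *v axis i 1 = 0" for i using p[of i] by (simp add: u_def)
      then have "X *v w l = 0" for l by (subst matrix_vector_eq_sum) (simp add: vector_smult_eq_0_iff)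
      then show ?thesis using C by simp
    next
      case False
      have uX: "(norm u)\<^sup>2 \<le> (norm X)\<^sup>2"
        unfolding norm_matrix_squared u_def by (rule member_le_sum) auto
      let ?Q = "frame_area 0 X"
      have est: "cmod (hom_ext f (X *v w l) - of_real ((norm (X *v w l))\<^sup>2) * f (abs_proj u))
          \<le> m * (c l)\<^sup>2 * (?Q powr \<alpha> * ((norm X)\<^sup>2) powr (1 - \<alpha>))" for l
      proof (cases "X *v w l = 0")
        case True
        then show ?thesis using m by simp
      next
        case y0: False
        define y where "y = X *v w l"
        have y: "y \<noteq> 0" using y0 by (simp add: y_def)
        define t where "t = norm y * norm u"
        have t: "t > 0" using y False by (simp add: t_def)
        have ny: "norm y \<le> c l * norm u"
        proof -
          have "norm y \<le> (\<Sum>i\<in>UNIV. norm (w l $ i *s (X *v axis i 1)))"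
            unfolding y_def by (subst matrix_vector_eq_sum) (rule norm_sum)
          also have "\<dots> \<le> (\<Sum>i\<in>UNIV. cmod (w l $ i) * norm u)"
            unfolding norm_vector_smult u_def by (intro sum_mono mult_left_mono p) auto
          finally show ?thesis by (simp add: c_def sum_distrib_right)
        qed
        then have cl: "0 < c l" using y c0[of l] by (cases "c l = 0") (auto simp: less_le)
        have ay: "area y u \<le> c l * ?Q"
        proof -
          have "area y u \<le> (\<Sum>i\<in>UNIV. area (w l $ i *s (X *v axis i 1)) u)"
            unfolding y_def by (subst matrix_vector_eq_sum) (rule area_sum_left)
          also have "\<dots> \<le> (\<Sum>i\<in>UNIV. cmod (w l $ i) * ?Q)"
            unfolding area_scale_left
          proof (intro sum_mono mult_left_mono)
            fix i
            have "area (X *v axis i 1) u \<le> (\<Sum>j\<in>UNIV. area_iter 0 (X *v axis i 1) (X *v axis j 1))"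
              unfolding u_def area_iter.simps by (rule member_le_sum) auto
            also have "\<dots> \<le> ?Q"
              unfolding frame_area_def by (rule member_le_sum) (auto intro: sum_nonneg)
            finally show "area (X *v axis i 1) u \<le> ?Q" .
          qed auto
          finally show ?thesis by (simp add: c_def sum_distrib_right)
        qed
        have "hom_ext f y - of_real ((norm y)\<^sup>2) * f (abs_proj u)
            = (f (abs_proj y) - f (abs_proj u)) * of_real ((norm y)\<^sup>2)"
          using y by (simp add: hom_ext_def algebra_simps)
        then have "cmod (hom_ext f y - of_real ((norm y)\<^sup>2) * f (abs_proj u))
            = cmod (f (abs_proj y) - f (abs_proj u)) * (norm y)\<^sup>2"
          by (simp only: norm_mult norm_of_real abs_of_nonneg zero_le_power2)
        also have "\<dots> \<le> (m * (area y u / t) powr \<alpha>) * (c l * t)"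
        proof (intro mult_mono)
          show "cmod (f (abs_proj y) - f (abs_proj u)) \<le> m * (area y u / t) powr \<alpha>"
            using holder_bdD(4)[OF f, of "abs_proj y" "abs_proj u"] by (simp add: proj_dist_abs_proj False y t_def)
          have "norm y * norm y \<le> norm y * (c l * norm u)" using ny by (intro mult_left_mono) auto
          then show "(norm y)\<^sup>2 \<le> c l * t" by (simp add: t_def power2_eq_square mult_ac)
        qed (use m in auto)
        also have "\<dots> = m * c l * (area y u powr \<alpha> * t powr (1 - \<alpha>))"
          using t by (simp add: powr_divide powr_diff)
        also have "\<dots> \<le> m * c l * ((c l * ?Q) powr \<alpha> * (c l * (norm u)\<^sup>2) powr (1 - \<alpha>))"
        proof (intro mult_left_mono mult_mono powr_mono2)
          have "norm y * norm u \<le> (c l * norm u) * norm u" using ny by (intro mult_right_mono) auto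
          then show "t \<le> c l * (norm u)\<^sup>2" by (simp add: t_def power2_eq_square mult_ac)
        qed (use ay m cl \<alpha> t in auto)
        also have "\<dots> = m * c l * (c l * (?Q powr \<alpha> * ((norm u)\<^sup>2) powr (1 - \<alpha>)))"
        proof -
          have "c l = c l powr \<alpha> * c l powr (1 - \<alpha>)" using cl by (simp add: powr_add[symmetric])
          then show ?thesis using cl frame_area_nonneg[of 0 X] by (simp add: powr_mult)
        qed
        also have "\<dots> \<le> m * c l * (c l * (?Q powr \<alpha> * ((norm X)\<^sup>2) powr (1 - \<alpha>)))"
          using m cl uX \<alpha> by (intro mult_left_mono powr_mono2) auto
        finally show ?thesis by (simp add: y_def power2_eq_square mult_ac)
      qed
      \<comment> \<open>The squared norm of \<open>X *v w l\<close> is a sum, over the rows of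
        \<open>X\<close>, of the quadratic forms in \<open>vanish\<close>.\<close>
      have "(\<Sum>l\<in>L. a l * of_real ((norm (X *v w l))\<^sup>2)) = 0"
      proof -
        have "(\<Sum>l\<in>L. a l * of_real ((norm (X *v w l))\<^sup>2))
            = (\<Sum>l\<in>L. \<Sum>i\<in>UNIV. a l * of_real ((cmod (\<Sum>j\<in>UNIV. X $ i $ j * w l $ j))\<^sup>2))"
          by (simp add: norm_matrix_vector_squared sum_distrib_left)
        also have "\<dots> = (\<Sum>i\<in>UNIV. \<Sum>l\<in>L. a l * of_real ((cmod (\<Sum>j\<in>UNIV. X $ i $ j * w l $ j))\<^sup>2))"
          by (rule sum.swap)
        finally show ?thesis by (simp only: vanish) simp
      qed
      then have "(\<Sum>l\<in>L. a l * hom_ext f (X *v w l))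
          = (\<Sum>l\<in>L. a l * (hom_ext f (X *v w l) - of_real ((norm (X *v w l))\<^sup>2) * f (abs_proj u)))"
        by (simp add: right_diff_distrib sum_subtractf mult.assoc[symmetric] sum_distrib_right[symmetric]
            del: of_real_power)
      also have "cmod \<dots> \<le> (\<Sum>l\<in>L. cmod (a l * (hom_ext f (X *v w l) - of_real ((norm (X *v w l))\<^sup>2) * f (abs_proj u))))"
        by (rule norm_sum)
      also have "\<dots> \<le> (\<Sum>l\<in>L. cmod (a l) * (m * (c l)\<^sup>2 * (?Q powr \<alpha> * ((norm X)\<^sup>2) powr (1 - \<alpha>))))"
        unfolding norm_mult[of "a _"] by (intro sum_mono mult_left_mono est) auto
      also have "\<dots> = C * (?Q powr \<alpha> * ((norm X)\<^sup>2) powr (1 - \<alpha>))"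
        by (simp add: C_def sum_distrib_right mult.assoc)
      finally show ?thesis .
    qed
  qed
  then show ?thesis using that C by blast
qed

text \<open>The combination extends to a function \<Psi> of matrices that averaging multiplies by z.
  As z has modulus one, averaging does not diminish it at \<open>mat 1\<close>, while the frame area
  bounding it there tends to 0.\<close>

lemma eigenfunction_combination_eq_0:
  fixes a :: "'i \<Rightarrow> complex" and w :: "'i \<Rightarrow> complex ^ 'k"
  assumes "Pur \<mu>" and f: "holder_bd \<alpha> s m f" and z: "cmod z = 1" and eig: "\<And>X. T f X = z * f X"
    and L: "finite L"
    and vanish: "\<And>\<eta> :: complex ^ 'k. (\<Sum>l\<in>L. a l * of_real ((cmod (\<Sum>j\<in>UNIV. \<eta> $ j * w l $ j))\<^sup>2)) = 0"
  shows "(\<Sum>l\<in>L. a l * hom_ext f (w l)) = 0"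
proof -
  define \<Psi> where "\<Psi> X = (\<Sum>l\<in>L. a l * hom_ext f (X *v w l))" for X
  obtain C where C: "0 \<le> C"
    "\<And>X. cmod (\<Psi> X) \<le> C * (frame_area 0 X powr \<alpha> * ((norm X)\<^sup>2) powr (1 - \<alpha>))"
    using quadratic_combination_le[OF f L vanish] unfolding \<Psi>_def by metis
  have zF: "z * hom_ext f x = (LINT v|\<mu>. hom_ext f (v *v x))" for x
  proof -
    have "T f = (\<lambda>X. z * f X)" by (rule ext) (rule eig)
    then show ?thesis using hom_ext_markov_op[of \<mu> f x] by (simp add: hom_ext_cmult)
  qed
  have intF: "integrable \<mu> (\<lambda>v. hom_ext f (v *v x))" for x by (rule integrable_hom_ext[OF f])
  have \<Psi>v: "\<Psi> (v ** X) = (\<Sum>l\<in>L. a l * hom_ext f (v *v (X *v w l)))" for v X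
    by (simp add: \<Psi>_def matrix_vector_mul_assoc)
  have int\<Psi>: "integrable \<mu> (\<lambda>v. \<Psi> (v ** X))" for X
    unfolding \<Psi>v by (intro Bochner_Integration.integrable_sum integrable_mult_right intF)
  have z\<Psi>: "z * \<Psi> X = (LINT v|\<mu>. \<Psi> (v ** X))" for X
    unfolding \<Psi>v by (simp add: Bochner_Integration.integral_sum intF zF[symmetric] \<Psi>_def sum_distrib_left mult_ac)
  have bound: "cmod (\<Psi> X) \<le> C * (frame_area n X powr \<alpha> * ((norm X)\<^sup>2) powr (1 - \<alpha>))" for n X
  proof (induction n arbitrary: X)
    case (Suc n)
    have i: "integrable \<mu> (\<lambda>v. frame_area n (v ** X) powr \<alpha> * ((norm (v ** X))\<^sup>2) powr (1 - \<alpha>))"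
      by (intro integrable_geometric_mean \<alpha> integrable_frame_area integrable_matrix_norm_squared frame_area_nonneg) auto
    have "cmod (\<Psi> X) = cmod (LINT v|\<mu>. \<Psi> (v ** X))" using z by (simp add: z\<Psi>[symmetric] norm_mult)
    also have "\<dots> \<le> (LINT v|\<mu>. cmod (\<Psi> (v ** X)))" by (rule integral_norm_bound)
    also have "\<dots> \<le> (LINT v|\<mu>. C * (frame_area n (v ** X) powr \<alpha> * ((norm (v ** X))\<^sup>2) powr (1 - \<alpha>)))"
      by (intro integral_mono integrable_norm int\<Psi> integrable_mult_right i Suc.IH)
    also have "\<dots> = C * (LINT v|\<mu>. frame_area n (v ** X) powr \<alpha> * ((norm (v ** X))\<^sup>2) powr (1 - \<alpha>))"
      by simp
    also have "\<dots> \<le> C * (frame_area (Suc n) X powr \<alpha> * ((norm X)\<^sup>2) powr (1 - \<alpha>))"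
      by (intro mult_left_mono C integral_geometric_mean_le \<alpha> integrable_frame_area
          integrable_matrix_norm_squared frame_area_nonneg)
        (auto simp: integral_frame_area integral_matrix_norm_squared)
    finally show ?case .
  qed (rule C)
  let ?I = "mat 1 :: complex ^ 'k ^ 'k"
  define K where "K = C * (frame_area 0 ?I powr \<alpha> * ((norm ?I)\<^sup>2) powr (1 - \<alpha>))"
  have K: "0 \<le> K" using C by (simp add: K_def)
  have small: "cmod (\<Psi> ?I) \<le> K * \<delta>" if \<delta>: "0 < \<delta>" for \<delta>
  proof -
    obtain n where n: "\<And>x y. area_iter n x y \<le> \<delta> powr (1 / \<alpha>) * area x y"
      using Pur_area_iter_small[OF assms(1), of "\<delta> powr (1 / \<alpha>)"] \<delta> by auto
    have "frame_area n ?I \<le> \<delta> powr (1 / \<alpha>) * frame_area 0 ?I"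
      unfolding frame_area_def sum_distrib_left using n by (intro sum_mono) simp
    then have "frame_area n ?I powr \<alpha> \<le> (\<delta> powr (1 / \<alpha>) * frame_area 0 ?I) powr \<alpha>"
      using \<alpha> frame_area_nonneg by (intro powr_mono2) auto
    also have "\<dots> = \<delta> * frame_area 0 ?I powr \<alpha>"
      using \<delta> \<alpha> frame_area_nonneg by (simp add: powr_mult powr_powr)
    finally have "C * (frame_area n ?I powr \<alpha> * ((norm ?I)\<^sup>2) powr (1 - \<alpha>))
        \<le> C * (\<delta> * frame_area 0 ?I powr \<alpha> * ((norm ?I)\<^sup>2) powr (1 - \<alpha>))"
      by (intro mult_left_mono mult_right_mono C) auto
    then show ?thesis using bound[of ?I n] by (simp add: K_def mult_ac)
  qed
  have "cmod (\<Psi> ?I) \<le> 0"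
  proof (rule ccontr)
    assume "\<not> ?thesis"
    then have pos: "0 < cmod (\<Psi> ?I)" by simp
    then have "cmod (\<Psi> ?I) \<le> K * (cmod (\<Psi> ?I) / (2 * (K + 1)))" using K by (intro small) simp
    also have "\<dots> = cmod (\<Psi> ?I) * (K / (2 * (K + 1)))" by simp
    also have "\<dots> \<le> cmod (\<Psi> ?I) * (1 / 2)"
      using K by (intro mult_left_mono) (simp_all add: divide_simps)
    also have "\<dots> < cmod (\<Psi> ?I)" using pos by simp
    finally show False by simp
  qed
  then show ?thesis by (simp add: \<Psi>_def)
qed

text \<open>Polarisation at the vectors \<open>axis i 1 + \<i> ^ l *s axis j 1\<close> dictates the
  entries of \<open>A\<close>. The difference of \<open>hom_ext f\<close> and the form at
  \<open>x\<close> is then a finite combination of values, and the same combination annihilates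
  every squared modulus of a linear functional.\<close>

lemma eigenfunction_quadratic:
  assumes "Pur \<mu>" "f \<in> V" "cmod z = 1" "\<And>X. T f X = z * f X"
  obtains A where "\<And>x. hom_ext f x = cinner x (A *v x)"
proof -
  let ?F = "hom_ext f"
  define A :: "complex ^ 'k ^ 'k" where
    "A = (\<chi> i j. (\<Sum>l<4. (- \<i>) ^ l * ?F (axis i 1 + \<i> ^ l *s axis j 1)) / 4)"
  have "?F x = cinner x (A *v x)" for x
  proof -
    define S where "S = (UNIV :: 'k set) \<times> (UNIV :: 'k set) \<times> {..<4::nat}"
    define b where "b = (\<lambda>(i, j, l). - (cnj (x $ i) * x $ j * (- \<i>) ^ l / 4))"
    define v where "v = (\<lambda>(i, j, l). axis i 1 + \<i> ^ l *s axis j (1::complex) :: complex ^ 'k)"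
    \<comment> \<open>\<open>None\<close> indexes the point \<open>x\<close> with coefficient 1,
      \<open>Some (i, j, l)\<close> the polarisation points with the coefficients of the subtracted
      form.\<close>
    define a where "a q = (case q of None \<Rightarrow> 1 | Some t \<Rightarrow> b t)" for q
    define w where "w q = (case q of None \<Rightarrow> x | Some t \<Rightarrow> v t)" for q
    let ?L = "insert None (Some ` S)"
    have S: "finite S" by (simp add: S_def)
    have split: "(\<Sum>q\<in>?L. a q * G (w q)) = G x - (\<Sum>i\<in>UNIV. \<Sum>j\<in>UNIV. cnj (x $ i) * x $ j *
        ((\<Sum>l<4. (- \<i>) ^ l * G (axis i 1 + \<i> ^ l *s axis j 1)) / 4))" for G :: "complex ^ 'k \<Rightarrow> complex"
    proof -
      have "(\<Sum>q\<in>?L. a q * G (w q)) = G x + (\<Sum>t\<in>S. b t * G (v t))"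
        using S by (simp add: sum.reindex a_def w_def)
      also have "(\<Sum>t\<in>S. b t * G (v t))
          = (\<Sum>i\<in>UNIV. \<Sum>j\<in>UNIV. \<Sum>l<4. b (i, j, l) * G (v (i, j, l)))"
        unfolding S_def by (simp add: sum.cartesian_product split_def)
      also have "\<dots> = - (\<Sum>i\<in>UNIV. \<Sum>j\<in>UNIV. cnj (x $ i) * x $ j *
        ((\<Sum>l<4. (- \<i>) ^ l * G (axis i 1 + \<i> ^ l *s axis j 1)) / 4))"
        by (simp add: b_def v_def sum_negf[symmetric] sum_distrib_left sum_divide_distrib mult.assoc)
      finally show ?thesis by simp
    qed
    have "(\<Sum>q\<in>?L. a q * ?F (w q)) = 0"
    proof (rule eigenfunction_combination_eq_0[OF assms(1) bd_norm[OF assms(2)] assms(3,4)])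
      fix \<eta> :: "complex ^ 'k"
      have ax: "(\<Sum>j\<in>UNIV. \<eta> $ j * (axis i 1 + c *s axis j' 1) $ j) = \<eta> $ i + c * \<eta> $ j'" for i j' c
      proof -
        have 1: "(\<Sum>j\<in>UNIV. \<eta> $ j * axis i 1 $ j) = \<eta> $ i" for i
          by (simp add: axis_def if_distrib cong: if_cong)
        have "(\<Sum>j\<in>UNIV. \<eta> $ j * (axis i 1 + c *s axis j' 1) $ j)
            = (\<Sum>j\<in>UNIV. \<eta> $ j * axis i 1 $ j) + c * (\<Sum>j\<in>UNIV. \<eta> $ j * axis j' 1 $ j)"
          by (simp add: distrib_left sum.distrib sum_distrib_left mult_ac)
        then show ?thesis by (simp only: 1)
      qed
      have "(\<Sum>q\<in>?L. a q * of_real ((cmod (\<Sum>j\<in>UNIV. \<eta> $ j * w q $ j))\<^sup>2))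
          = of_real ((cmod (\<Sum>j\<in>UNIV. \<eta> $ j * x $ j))\<^sup>2)
            - (\<Sum>i\<in>UNIV. \<Sum>j\<in>UNIV. cnj (x $ i) * x $ j * (cnj (\<eta> $ i) * \<eta> $ j))"
        unfolding split[of "\<lambda>y. of_real ((cmod (\<Sum>j\<in>UNIV. \<eta> $ j * y $ j))\<^sup>2)"] ax complex_polarization by simp
      also have "\<dots> = 0"
        unfolding complex_norm_square by (simp add: sum_product mult_ac) (subst sum.swap, simp add: mult_ac)
      finally show "(\<Sum>q\<in>?L. a q * of_real ((cmod (\<Sum>j\<in>UNIV. \<eta> $ j * w q $ j))\<^sup>2)) = 0" .
    qed (use S in auto)
    then have "?F x = (\<Sum>i\<in>UNIV. \<Sum>j\<in>UNIV. cnj (x $ i) * x $ j * A $ i $ j)"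
      unfolding split by (simp add: A_def)
    also have "\<dots> = cinner x (A *v x)"
      by (simp add: cinner_def matrix_vector_mult_def sum_distrib_left mult_ac)
    finally show ?thesis .
  qed
  then show ?thesis using that by blast
qed

end

section \<open>Complex subspaces\<close>

lemma subspace_of_vec_subspace:
  fixes S :: "(complex ^ 'k) set"
  assumes "vec.subspace S"
  shows "subspace S"
  unfolding subspace_def
proof (intro conjI ballI allI)
  show "0 \<in> S" by (rule vec.subspace_0[OF assms])
  show "x + y \<in> S" if "x \<in> S" "y \<in> S" for x y using assms that by (rule vec.subspace_add)
  show "c *\<^sub>R x \<in> S" if "x \<in> S" for c x
    unfolding of_real_smult[symmetric] using assms that by (rule vec.subspace_scale)
qed

lemma closed_vec_subspace:
  fixes S :: "(complex ^ 'k) set"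
  shows "vec.subspace S \<Longrightarrow> closed S"
  by (intro closed_subspace subspace_of_vec_subspace)

lemma vec_subspace_unit_vector:
  fixes S :: "(complex ^ 'k) set"
  assumes "vec.subspace S" "S \<noteq> {0}"
  obtains x where "x \<in> S" "norm x = 1"
proof -
  obtain y where y: "y \<in> S" "y \<noteq> 0"
    using assms vec.subspace_0[OF assms(1)] by blast
  have "of_real (inverse (norm y)) *s y \<in> S" using assms(1) y(1) by (rule vec.subspace_scale)
  moreover have "norm (of_real (inverse (norm y)) *s y) = 1" using y(2) by (simp add: norm_vector_smult norm_inverse)
  ultimately show ?thesis using that by blast
qed

text \<open>If \<open>G x\<close> and \<open>G y\<close> are 0, the parallelogram identity makes the
  nonnegative numbers \<open>G (x + y)\<close> and \<open>G (x - y)\<close> add up to 0. In the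
  applications \<open>G\<close> is the gap to a maximum.\<close>

lemma vec_subspace_null_set:
  fixes S :: "(complex ^ 'k) set" and G :: "complex ^ 'k \<Rightarrow> real"
  assumes S: "vec.subspace S" and nonneg: "\<And>x. x \<in> S \<Longrightarrow> 0 \<le> G x"
    and scale: "\<And>c x. x \<in> S \<Longrightarrow> G (c *s x) = (cmod c)\<^sup>2 * G x"
    and parallelogram: "\<And>x y. x \<in> S \<Longrightarrow> y \<in> S \<Longrightarrow> G (x + y) + G (x - y) = 2 * G x + 2 * G y"
  shows "vec.subspace {x \<in> S. G x = 0}"
  unfolding vec.subspace_def
proof (intro conjI ballI allI)
  show "0 \<in> {x \<in> S. G x = 0}"
    using vec.subspace_0[OF S] scale[of 0 0] by simp
  show "c *s x \<in> {x \<in> S. G x = 0}" if "x \<in> {x \<in> S. G x = 0}" for c x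
    using that vec.subspace_scale[OF S] by (simp add: scale)
  show "x + y \<in> {x \<in> S. G x = 0}" if "x \<in> {x \<in> S. G x = 0}" "y \<in> {x \<in> S. G x = 0}" for x y
  proof -
    have "x + y \<in> S" "x - y \<in> S" using that S by (auto intro: vec.subspace_add vec.subspace_diff)
    then show ?thesis using parallelogram[of x y] nonneg[of "x + y"] nonneg[of "x - y"] that by auto
  qed
qed

lemma parallelogram_law: "(norm (x + y))\<^sup>2 + (norm (x - y))\<^sup>2 = 2 * (norm x)\<^sup>2 + 2 * (norm y)\<^sup>2"
  for x y :: "complex ^ 'k"
  by (simp add: norm_add_squared norm_diff_squared)

lemma sesquilinear_eq_0:
  fixes B :: "complex ^ 'k \<Rightarrow> complex ^ 'k \<Rightarrow> complex"
  assumes S: "vec.subspace S"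
    and add: "\<And>x y z. B (x + y) z = B x z + B y z" "\<And>x y z. B x (y + z) = B x y + B x z"
    and scale: "\<And>c x y. B (c *s x) y = cnj c * B x y" "\<And>c x y. B x (c *s y) = c * B x y"
    and diag: "\<And>x. x \<in> S \<Longrightarrow> B x x = 0" and xy: "x \<in> S" "y \<in> S"
  shows "B x y = 0"
proof -
  have "B (x + y) (x + y) = 0" using xy S by (intro diag vec.subspace_add)
  then have 1: "B x y + B y x = 0" by (simp add: add diag xy add.commute)
  have "B (x + \<i> *s y) (x + \<i> *s y) = 0" using xy S by (intro diag vec.subspace_add vec.subspace_scale)
  then have "\<i> * (B x y - B y x) = 0" by (simp add: add scale diag xy algebra_simps)
  then show ?thesis using 1 by simp
qed

lemma isometry_cinner:
  assumes S: "vec.subspace S" and iso: "\<And>x. x \<in> S \<Longrightarrow> norm (U *v x) = norm x" and xy: "x \<in> S" "y \<in> S"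
  shows "cinner (U *v x) (U *v y) = cinner x y"
proof -
  have "cinner (U *v x) (U *v y) - cinner x y = 0"
    by (rule sesquilinear_eq_0[OF S _ _ _ _ _ xy, of "\<lambda>x y. cinner (U *v x) (U *v y) - cinner x y"])
      (simp_all add: cinner_add_left cinner_add_right matrix_vector_right_distrib vector_scalar_commute cinner_scale_left
        cinner_scale_right cinner_self iso algebra_simps)
  then show ?thesis by simp
qed

section \<open>Extremal vectors and eigenvectors of isometries\<close>

lemma sphere_attains_sup:
  fixes S :: "(complex ^ 'k) set" and g :: "complex ^ 'k \<Rightarrow> real"
  assumes "vec.subspace S" "S \<noteq> {0}" "continuous_on UNIV g"
  obtains x where "x \<in> S" "norm x = 1" "\<And>y. y \<in> S \<Longrightarrow> norm y = 1 \<Longrightarrow> g y \<le> g x"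
proof -
  have "compact (sphere 0 1 \<inter> S)"
    by (intro compact_Int_closed compact_sphere closed_vec_subspace assms)
  moreover have "sphere 0 1 \<inter> S \<noteq> {}"
    using vec_subspace_unit_vector[OF assms(1,2)] by (metis IntI dist_0_norm empty_iff mem_sphere)
  ultimately obtain x where "x \<in> sphere 0 1 \<inter> S" "\<forall>y\<in>sphere 0 1 \<inter> S. g y \<le> g x"
    using continuous_attains_sup[of "sphere 0 1 \<inter> S" g] continuous_on_subset[OF assms(3)] by blast
  then show ?thesis using that[of x] by auto
qed

lemma homogeneous_le:
  fixes S :: "(complex ^ 'k) set" and g :: "complex ^ 'k \<Rightarrow> real"
  assumes S: "vec.subspace S" and scale: "\<And>c x. g (c *s x) = (cmod c)\<^sup>2 * g x"
    and le: "\<And>y. y \<in> S \<Longrightarrow> norm y = 1 \<Longrightarrow> g y \<le> t" and x: "x \<in> S"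
  shows "g x \<le> t * (norm x)\<^sup>2"
proof (cases "x = 0")
  case True
  then show ?thesis using scale[of 0 0] by simp
next
  case False
  define y where "y = of_real (inverse (norm x)) *s x"
  have "y \<in> S" unfolding y_def using S x by (rule vec.subspace_scale)
  moreover have "norm y = 1" using False by (simp add: y_def norm_vector_smult norm_inverse)
  ultimately have "g y \<le> t" by (rule le)
  moreover have "x = of_real (norm x) *s y" using False by (simp add: y_def vector_smult_assoc)
  then have "g x = (norm x)\<^sup>2 * g y" using scale[of "of_real (norm x)" y] by simp
  ultimately show ?thesis using mult_left_mono[of "g y" t "(norm x)\<^sup>2"] by (simp add: mult.commute)
qed

text \<open>The maximisers of the real part of the numerical range form an invariant subspace.\<close>

lemma isometry_numerical_range_max:
  fixes U :: "complex ^ 'k ^ 'k"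
  assumes S: "vec.subspace S" "S \<noteq> {0}"
    and U: "\<And>x. x \<in> S \<Longrightarrow> U *v x \<in> S" "\<And>x. x \<in> S \<Longrightarrow> norm (U *v x) = norm x"
  obtains S' t where "vec.subspace S'" "S' \<noteq> {0}" "S' \<subseteq> S" "\<And>x. x \<in> S' \<Longrightarrow> U *v x \<in> S'"
    "\<And>x. x \<in> S' \<Longrightarrow> Re (c * cinner x (U *v x)) = t * (norm x)\<^sup>2"
proof -
  define g where "g x = Re (c * cinner x (U *v x))" for x
  have "continuous_on UNIV g" unfolding g_def by (intro continuous_intros)
  from sphere_attains_sup[OF S this] obtain x0
    where x0: "x0 \<in> S" "norm x0 = 1" "\<And>y. y \<in> S \<Longrightarrow> norm y = 1 \<Longrightarrow> g y \<le> g x0" by blast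
  have scale: "g (d *s x) = (cmod d)\<^sup>2 * g x" for d x
  proof -
    have "c * cinner (d *s x) (U *v (d *s x)) = of_real ((cmod d)\<^sup>2) * (c * cinner x (U *v x))"
      unfolding complex_norm_square
      by (simp add: vector_scalar_commute cinner_scale_left cinner_scale_right mult_ac)
    then show ?thesis unfolding g_def by (simp only: Re_complex_of_real times_complex.sel Im_complex_of_real)
  qed
  define G where "G x = g x0 * (norm x)\<^sup>2 - g x" for x
  have G0: "0 \<le> G x" if "x \<in> S" for x
    using homogeneous_le[OF S(1) scale x0(3) that] by (simp add: G_def)
  have "vec.subspace {x \<in> S. G x = 0}"
  proof (rule vec_subspace_null_set[OF S(1) G0])
    fix d x
    show "G (d *s x) = (cmod d)\<^sup>2 * G x"
      by (simp add: G_def scale norm_vector_smult power_mult_distrib algebra_simps)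
  next
    fix x y
    have "g (x + y) + g (x - y) = 2 * g x + 2 * g y"
      by (simp add: g_def matrix_vector_right_distrib matrix_vector_mult_diff_distrib cinner_add_left cinner_add_right
          cinner_diff_left cinner_diff_right algebra_simps)
    moreover have "g x0 * (norm (x + y))\<^sup>2 + g x0 * (norm (x - y))\<^sup>2
        = 2 * (g x0 * (norm x)\<^sup>2) + 2 * (g x0 * (norm y)\<^sup>2)"
      using arg_cong[OF parallelogram_law[of x y], of "(*) (g x0)"] by (simp add: algebra_simps)
    ultimately show "G (x + y) + G (x - y) = 2 * G x + 2 * G y" by (simp add: G_def)
  qed
  moreover have "x0 \<in> {x \<in> S. G x = 0}" using x0 by (simp add: G_def)
  then have "{x \<in> S. G x = 0} \<noteq> {0}" using x0(2) by (metis norm_zero singletonD zero_neq_one)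
  \<comment> \<open>An isometry preserves its own form, <U x, U U x> = <x, U x>, and so it permutes
    the maximisers.\<close>
  moreover have "U *v x \<in> {x \<in> S. G x = 0}" if "x \<in> {x \<in> S. G x = 0}" for x
    using that isometry_cinner[OF S(1) U(2), of x "U *v x"] U by (simp add: G_def g_def)
  moreover have "Re (c * cinner x (U *v x)) = g x0 * (norm x)\<^sup>2" if "x \<in> {x \<in> S. G x = 0}" for x
    using that by (simp add: G_def g_def)
  ultimately show ?thesis
    by (intro that[of "{x \<in> S. G x = 0}" "g x0"]) auto
qed

text \<open>Maximising the real and then the imaginary part leaves a nonzero invariant subspace
  where <x, U x> = l |x|^2. Polarised, this makes U x - l x orthogonal to itself.\<close>

lemma isometry_eigenvector:
  fixes U :: "complex ^ 'k ^ 'k"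
  assumes S: "vec.subspace S" "S \<noteq> {0}"
    and U: "\<And>x. x \<in> S \<Longrightarrow> U *v x \<in> S" "\<And>x. x \<in> S \<Longrightarrow> norm (U *v x) = norm x"
  obtains x l where "x \<in> S" "norm x = 1" "U *v x = l *s x" "cmod l = 1"
proof -
  obtain S1 s where S1: "vec.subspace S1" "S1 \<noteq> {0}" "S1 \<subseteq> S" "\<And>x. x \<in> S1 \<Longrightarrow> U *v x \<in> S1"
    "\<And>x. x \<in> S1 \<Longrightarrow> Re (1 * cinner x (U *v x)) = s * (norm x)\<^sup>2"
    using isometry_numerical_range_max[OF S U, of 1] by metis
  have U1: "\<And>x. x \<in> S1 \<Longrightarrow> norm (U *v x) = norm x" using U(2) S1(3) by blast
  \<comment> \<open>The real part of - \<i> w is the imaginary part of w; invariance of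
    \<open>S1\<close> permits the second maximisation.\<close>
  obtain S2 t where S2: "vec.subspace S2" "S2 \<noteq> {0}" "S2 \<subseteq> S1" "\<And>x. x \<in> S2 \<Longrightarrow> U *v x \<in> S2"
    "\<And>x. x \<in> S2 \<Longrightarrow> Re (- \<i> * cinner x (U *v x)) = t * (norm x)\<^sup>2"
    using isometry_numerical_range_max[OF S1(1,2,4) U1, of "- \<i>"] by metis
  define l where "l = Complex s t"
  have diag: "cinner x (U *v x) - l * cinner x x = 0" if "x \<in> S2" for x
    using S1(5)[of x] S2(5)[of x] S2(3) that
    by (intro complex_eqI) (auto simp: cinner_self l_def simp del: of_real_power)
  obtain x where x: "x \<in> S2" "norm x = 1" using vec_subspace_unit_vector[OF S2(1,2)] .
  define y where "y = U *v x - l *s x"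
  have y: "y \<in> S2" unfolding y_def using S2(1) S2(4)[OF x(1)] vec.subspace_scale[OF S2(1) x(1)]
    by (rule vec.subspace_diff)
  have "cinner y (U *v x) - l * cinner y x = 0"
    by (rule sesquilinear_eq_0[OF S2(1) _ _ _ _ _ y x(1), of "\<lambda>x y. cinner x (U *v y) - l * cinner x y"])
      (simp_all add: cinner_add_left cinner_add_right matrix_vector_right_distrib vector_scalar_commute cinner_scale_left
        cinner_scale_right diag algebra_simps)
  then have "cinner y y = 0"
    by (subst (2) y_def) (simp add: cinner_diff_right cinner_scale_right)
  then have eq: "U *v x = l *s x" by (simp add: y_def cinner_self_eq_0_iff)
  moreover have "x \<in> S" using x S1(3) S2(3) by blast
  moreover have "cmod l = 1"
    using U(2)[OF \<open>x \<in> S\<close>] x(2) by (simp add: eq norm_vector_smult)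
  ultimately show ?thesis using that x(2) by blast
qed

text \<open>A complex subspace contains \<i> w along with w, so the real orthogonal decomposition is
  already Hermitian. Uniqueness of the foot point makes the projection complex linear.\<close>

lemma projection_exists:
  fixes S :: "(complex ^ 'k) set"
  assumes S: "vec.subspace S"
  obtains P :: "complex ^ 'k ^ 'k" where "\<And>x. x \<in> S \<Longrightarrow> P *v x = x"
    "\<And>x. (\<And>y. y \<in> S \<Longrightarrow> cinner y x = 0) \<Longrightarrow> P *v x = 0"
proof -
  have "\<exists>y\<in>S. \<forall>w\<in>S. cinner w (x - y) = 0" for x
  proof -
    obtain y z where yz: "y \<in> span S" "\<And>w. w \<in> span S \<Longrightarrow> orthogonal z w" "x = y + z"
      using orthogonal_subspace_decomp_exists[of S x] by metis
    have sp: "span S = S" using subspace_of_vec_subspace[OF S] by (simp add: span_eq_iff)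
    have re: "Re (cinner w z) = 0" if "w \<in> S" for w
      using yz(2)[of w] that by (simp add: sp Re_cinner orthogonal_def inner_commute)
    have "cinner w z = 0" if "w \<in> S" for w
    proof (rule complex_eqI)
      have "\<i> *s w \<in> S" using S that by (rule vec.subspace_scale)
      then show "Im (cinner w z) = Im 0" using re[of "\<i> *s w"] by (simp add: cinner_scale_left)
    qed (use re that in simp)
    then show ?thesis using yz by (intro bexI[of _ y]) (auto simp: sp)
  qed
  then obtain f where f: "\<And>x. f x \<in> S" "\<And>x w. w \<in> S \<Longrightarrow> cinner w (x - f x) = 0" by metis
  have uniq: "f x = y" if "y \<in> S" "\<And>w. w \<in> S \<Longrightarrow> cinner w (x - y) = 0" for x y
  proof -
    have d: "f x - y \<in> S" using S f(1) that(1) by (rule vec.subspace_diff)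
    have "cinner (f x - y) (f x - y) = cinner (f x - y) (x - y) - cinner (f x - y) (x - f x)"
      by (simp add: cinner_diff_right)
    also have "\<dots> = 0" using that(2)[OF d] f(2)[OF d] by simp
    finally show ?thesis by (simp add: cinner_self_eq_0_iff)
  qed
  have "Vector_Spaces.linear (*s) (*s) f"
  proof
    fix x y :: "complex ^ 'k" and c
    show "f (x + y) = f x + f y"
    proof (rule uniq)
      fix w assume w: "w \<in> S"
      have "x + y - (f x + f y) = (x - f x) + (y - f y)" by simp
      then show "cinner w (x + y - (f x + f y)) = 0" using f(2)[OF w] by (simp only: cinner_add_right) simp
    qed (intro vec.subspace_add[OF S] f)
    show "f (c *s x) = c *s f x"
    proof (rule uniq)
      fix w assume w: "w \<in> S"
      have "c *s x - c *s f x = c *s (x - f x)" by (simp add: vec_eq_iff algebra_simps)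
      then show "cinner w (c *s x - c *s f x) = 0" using f(2)[OF w] by (simp only: cinner_scale_right) simp
    qed (intro vec.subspace_scale[OF S] f)
  qed
  then have "matrix f *v x = f x" for x by (rule matrix_works)
  moreover have "f x = x" if "x \<in> S" for x by (rule uniq) (use that in auto)
  moreover have "f x = 0" if "\<And>y. y \<in> S \<Longrightarrow> cinner y x = 0" for x
    by (rule uniq) (use that vec.subspace_0[OF S] in auto)
  ultimately show ?thesis using that[of "matrix f"] by auto
qed

lemma sum_matrix_vector: "(\<Sum>i\<in>I. A i) *v x = (\<Sum>i\<in>I. A i *v (x :: complex ^ 'k))"
  by (induction I rule: infinite_finite_induct) (simp_all add: matrix_vector_mult_add_rdistrib)

lemma matrix_vector_sum: "A *v (\<Sum>i\<in>I. x i) = (\<Sum>i\<in>I. A *v (x i :: complex ^ 'k))"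
  by (induction I rule: infinite_finite_induct) (simp_all add: matrix_vector_right_distrib)

lemma smult_sum: "c *s (\<Sum>i\<in>I. x i) = (\<Sum>i\<in>I. c *s (x i :: complex ^ 'k))"
  by (induction I rule: infinite_finite_induct) (simp_all add: vector_add_ldistrib)

text \<open>Hermitian orthogonality implies real orthogonality and thus independence over the reals.
  The real dimension is a coarse bound, used to make the orders of the twists finite.\<close>

lemma orthogonal_family_card_le:
  fixes x :: "'i \<Rightarrow> complex ^ 'k"
  assumes "\<And>i. i \<in> I \<Longrightarrow> x i \<noteq> 0" "\<And>i j. i \<in> I \<Longrightarrow> j \<in> I \<Longrightarrow> i \<noteq> j \<Longrightarrow> cinner (x i) (x j) = 0"
  shows "card I \<le> DIM(complex ^ 'k)"
proof -
  have inj: "inj_on x I"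
  proof (rule inj_onI, rule ccontr)
    fix i j assume ij: "i \<in> I" "j \<in> I" "x i = x j" "i \<noteq> j"
    then have "cinner (x i) (x i) = 0" using assms(2) by metis
    then show False using assms(1) ij by (simp add: cinner_self_eq_0_iff)
  qed
  have "pairwise orthogonal (x ` I)"
  proof (rule pairwiseI)
    fix u v assume "u \<in> x ` I" "v \<in> x ` I" "u \<noteq> v"
    then obtain i j where "u = x i" "v = x j" "i \<in> I" "j \<in> I" "i \<noteq> j" by blast
    then show "orthogonal u v" using assms(2) by (simp add: orthogonal_def flip: Re_cinner)
  qed
  moreover have "0 \<notin> x ` I" using assms(1) by force
  ultimately have "independent (x ` I)" by (rule pairwise_orthogonal_independent)
  then have "card (x ` I) \<le> DIM(complex ^ 'k)" using independent_bound by blast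
  then show ?thesis by (simp add: card_image[OF inj])
qed

section \<open>Cycles and twisted commutation\<close>

lemma inj_on_powers_root_of_unity:
  assumes "1 \<le> n"
  shows "inj_on (\<lambda>i. exp (2 * of_real pi * \<i> / of_nat n) ^ i) {..<n}"
    "inj_on (\<lambda>i. exp (2 * of_real pi * \<i> / of_nat n) ^ i) {1..n}"
proof -
  have eq: "exp (2 * of_real pi * \<i> / of_nat n) ^ i = exp (2 * of_real pi * \<i> * of_nat i / of_nat n)" for i
    by (simp add: exp_of_nat_mult[symmetric] mult_ac)
  show "inj_on (\<lambda>i. exp (2 * of_real pi * \<i> / of_nat n) ^ i) {..<n}"
    unfolding eq by (auto simp: inj_on_def complex_root_unity_eq[OF assms])
  show "inj_on (\<lambda>i. exp (2 * of_real pi * \<i> / of_nat n) ^ i) {1..n}"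
    unfolding eq
  proof (rule inj_onI)
    fix i j assume ij: "i \<in> {1..n}" "j \<in> {1..n}"
      "exp (2 * of_real pi * \<i> * of_nat i / of_nat n) = exp (2 * of_real pi * \<i> * of_nat j / of_nat n)"
    then have "i mod n = j mod n" using complex_root_unity_eq[OF assms] by blast
    then show "i = j" using ij(1,2) by (cases "i = n"; cases "j = n") auto
  qed
qed

context normalized
begin

text \<open>Subspaces are closed, so the matrices that map \<open>F\<close> into \<open>G\<close>
  form a closed set.\<close>

lemma AE_maps_iff:
  assumes "vec.subspace G"
  shows "(AE v in \<mu>. (*v) v ` F \<subseteq> G) \<longleftrightarrow> (\<forall>v\<in>msupport \<mu>. \<forall>x\<in>F. v *v x \<in> G)"
proof -
  have "{v. (*v) v ` F \<subseteq> G} = (\<Inter>x\<in>F. (\<lambda>v. v *v x) -` G)" by auto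
  also have "closed \<dots>"
    by (intro closed_INT ballI closed_vimage closed_vec_subspace assms continuous_intros)
  finally show ?thesis by (subst AE_support_iff) auto
qed

lemma invariant_space_iff:
  "invariant_space \<mu> F \<longleftrightarrow> vec.subspace F \<and> F \<noteq> {0} \<and> (\<forall>v\<in>msupport \<mu>. \<forall>x\<in>F. v *v x \<in> F)"
  unfolding invariant_space_def using AE_maps_iff by blast

lemma exists_support_nonzero:
  assumes "x \<noteq> 0"
  shows "\<exists>v\<in>msupport \<mu>. v *v x \<noteq> 0"
proof (rule ccontr)
  assume "\<not> ?thesis"
  then have "AE v in \<mu>. (norm (v *v x))\<^sup>2 = 0" using AE_support by auto
  then have "(LINT v|\<mu>. (norm (v *v x))\<^sup>2) = 0" by (rule integral_eq_zero_AE)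
  then show False using assms by (simp add: integral_norm_squared)
qed

lemma contains_minimal_invariant_space:
  assumes "invariant_space \<mu> F"
  shows "\<exists>G. minimal_invariant_space \<mu> G \<and> G \<subseteq> F"
proof -
  let ?P = "\<lambda>G. invariant_space \<mu> G \<and> G \<subseteq> F"
  obtain G where G: "?P G" "\<And>H. ?P H \<Longrightarrow> vec.dim G \<le> vec.dim H"
    using ex_has_least_nat[of ?P F vec.dim] assms by blast
  have "H = G" if "invariant_space \<mu> H" "H \<subseteq> G" for H
    using that G by (intro vec.subspace_dim_equal) (auto simp: invariant_space_def)
  then show ?thesis using G unfolding minimal_invariant_space_def by blast
qed

end

locale ergodic = normalized \<mu> for \<mu> :: "(complex ^ 'k ^ 'k) measure" +
  assumes Erg: "Erg \<mu>"
begin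

abbreviation "E \<equiv> erg_space \<mu>"

lemma minimal_erg_space: "minimal_invariant_space \<mu> E"
  using Erg unfolding Erg_def erg_space_def by (rule theI')

text \<open>\<open>F\<close> contains a minimal invariant space, which is \<open>E\<close> by
  uniqueness.\<close>

lemma erg_space_subset:
  assumes "invariant_space \<mu> F"
  shows "E \<subseteq> F"
proof -
  obtain G where "minimal_invariant_space \<mu> G" "G \<subseteq> F"
    using contains_minimal_invariant_space[OF assms] by blast
  moreover have "G = E" using Erg minimal_erg_space calculation(1) unfolding Erg_def by blast
  ultimately show ?thesis by simp
qed

lemma E_subspace: "vec.subspace E"
  and E_nonzero: "E \<noteq> {0}"
  and E_invariant: "v \<in> msupport \<mu> \<Longrightarrow> x \<in> E \<Longrightarrow> v *v x \<in> E"
  using minimal_erg_space unfolding minimal_invariant_space_def invariant_space_iff by auto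

text \<open>On \<open>E\<close> the form <x, U x> behaves as an eigenfunction: <v x, U v x> = z <v
  x, v U x>, which integrates to z <x, U x>. Outside \<open>E\<close> nothing is asked of
  \<open>U\<close>.\<close>

definition twist :: "complex \<Rightarrow> complex ^ 'k ^ 'k \<Rightarrow> bool" where
  "twist z U \<longleftrightarrow> cmod z = 1 \<and> (\<forall>x\<in>E. U *v x \<in> E \<and> norm (U *v x) = norm x) \<and>
     (\<forall>v\<in>msupport \<mu>. \<forall>x\<in>E. U *v (v *v x) = z *s (v *v (U *v x)))"

section \<open>The group of twists and its eigenspaces\<close>

definition twists :: "complex set" where
  "twists = {z. \<exists>U. twist z U}"

lemma twists_1: "1 \<in> twists"
  by (auto simp: twists_def twist_def intro!: exI[of _ "mat 1"])

lemma twists_mult: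
  assumes "z \<in> twists" "w \<in> twists"
  shows "z * w \<in> twists"
proof -
  obtain U W where U: "twist z U" and W: "twist w W" using assms by (auto simp: twists_def)
  have "twist (z * w) (U ** W)"
    unfolding twist_def
  proof (intro conjI ballI)
    show "cmod (z * w) = 1" using U W by (simp add: twist_def norm_mult)
    fix x assume x: "x \<in> E"
    then show "(U ** W) *v x \<in> E" "norm ((U ** W) *v x) = norm x"
      using U W by (auto simp: twist_def matrix_vector_mul_assoc[symmetric])
    fix v assume v: "v \<in> msupport \<mu>"
    have "(U ** W) *v (v *v x) = w *s (U *v (v *v (W *v x)))"
      using W v x by (simp add: twist_def matrix_vector_mul_assoc[symmetric] vector_scalar_commute)
    also have "U *v (v *v (W *v x)) = z *s (v *v (U *v (W *v x)))"
      using U W v x by (simp add: twist_def)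
    finally show "(U ** W) *v (v *v x) = (z * w) *s (v *v ((U ** W) *v x))"
      by (simp add: matrix_vector_mul_assoc[symmetric] vector_smult_assoc mult.commute)
  qed
  then show ?thesis by (auto simp: twists_def)
qed

lemma twists_power: "z \<in> twists \<Longrightarrow> z ^ n \<in> twists"
  by (induction n) (auto simp: twists_1 twists_mult)

lemma twists_norm: "z \<in> twists \<Longrightarrow> cmod z = 1"
  by (auto simp: twists_def twist_def)

text \<open>The indices run through all natural numbers and \<open>F i\<close> depends on
  \<open>z ^ i\<close> only, so that no finite order of \<open>z\<close> is presupposed.\<close>

definition eigenchain :: "complex \<Rightarrow> (nat \<Rightarrow> (complex ^ 'k) set) \<Rightarrow> bool" where
  "eigenchain z F \<longleftrightarrow>
    (\<forall>i. vec.subspace (F i) \<and> F i \<subseteq> E \<and> F i \<noteq> {0} \<and> (\<forall>v\<in>msupport \<mu>. \<forall>x\<in>F i. v *v x \<in> F (Suc i))) \<and>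
    (\<forall>i j. z ^ i = z ^ j \<longrightarrow> F i = F j) \<and> (\<forall>i j. z ^ i \<noteq> z ^ j \<longrightarrow> orth_spaces (F i) (F j))"

lemma eigenchainD:
  assumes "eigenchain z F"
  shows "vec.subspace (F i)" "F i \<subseteq> E" "F i \<noteq> {0}"
    "v \<in> msupport \<mu> \<Longrightarrow> x \<in> F i \<Longrightarrow> v *v x \<in> F (Suc i)"
    "z ^ i = z ^ j \<Longrightarrow> F i = F j" "z ^ i \<noteq> z ^ j \<Longrightarrow> orth_spaces (F i) (F j)"
proof -
  note * = assms[unfolded eigenchain_def]
  note 1 = *[THEN conjunct1, rule_format, of i]
  show "vec.subspace (F i)" "F i \<subseteq> E" "F i \<noteq> {0}"
    by (rule 1[THEN conjunct1] 1[THEN conjunct2, THEN conjunct1] 1[THEN conjunct2, THEN conjunct2, THEN conjunct1])+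
  show "v *v x \<in> F (Suc i)" if "v \<in> msupport \<mu>" "x \<in> F i"
    using 1[THEN conjunct2, THEN conjunct2, THEN conjunct2] that by blast
  show "F i = F j" if "z ^ i = z ^ j"
    by (rule *[THEN conjunct2, THEN conjunct1, rule_format, OF that])
  show "orth_spaces (F i) (F j)" if "z ^ i \<noteq> z ^ j"
    by (rule *[THEN conjunct2, THEN conjunct2, rule_format, OF that])
qed

text \<open>The chain consists of the eigenspaces of \<open>U\<close> along the orbit of one eigenvalue.\<close>

lemma twist_eigenchain:
  assumes "z \<in> twists"
  shows "\<exists>F. eigenchain z F"
proof -
  obtain U where U: "twist z U" using assms by (auto simp: twists_def)
  have z: "cmod z = 1" and UE: "\<And>x. x \<in> E \<Longrightarrow> U *v x \<in> E" and iso: "\<And>x. x \<in> E \<Longrightarrow> norm (U *v x) = norm x"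
    and comm: "\<And>v x. v \<in> msupport \<mu> \<Longrightarrow> x \<in> E \<Longrightarrow> U *v (v *v x) = z *s (v *v (U *v x))"
    using U by (auto simp: twist_def)
  obtain x0 l where x0: "x0 \<in> E" "norm x0 = 1" "U *v x0 = l *s x0" "cmod l = 1"
    using isometry_eigenvector[OF E_subspace E_nonzero UE iso] by blast
  define F where "F i = {x \<in> E. U *v x = (z ^ i * l) *s x}" for i :: nat
  have step: "v *v x \<in> F (Suc i)" if "v \<in> msupport \<mu>" "x \<in> F i" for v x i
    using that by (simp add: F_def E_invariant comm vector_scalar_commute vector_smult_assoc mult_ac)
  have sub: "vec.subspace (F i)" for i
    unfolding vec.subspace_def
    using vec.subspace_0[OF E_subspace] vec.subspace_add[OF E_subspace] vec.subspace_scale[OF E_subspace]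
    by (auto simp: F_def matrix_vector_right_distrib vector_scalar_commute vector_smult_assoc vector_add_ldistrib mult_ac)
  \<comment> \<open>By the normalisation, some matrix of the support does not annihilate a given
    nonzero vector, so the chain never dies out.\<close>
  have nz: "\<exists>x\<in>F i. x \<noteq> 0" for i
  proof (induction i)
    case 0
    have "x0 \<in> F 0" "x0 \<noteq> 0" using x0 by (auto simp: F_def)
    then show ?case by blast
  next
    case (Suc i)
    then obtain x where "x \<in> F i" "x \<noteq> 0" by blast
    then show ?case using exists_support_nonzero[of x] step by blast
  qed
  have orth: "cinner x y = 0" if "z ^ i \<noteq> z ^ j" "x \<in> F i" "y \<in> F j" for i j x y
  proof -
    have 1: "cmod (z ^ i * l) = 1" using z x0 by (simp add: norm_mult norm_power)
    have "cinner x y = cinner (U *v x) (U *v y)"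
      using isometry_cinner[OF E_subspace iso, of x y] that by (simp add: F_def)
    also have "\<dots> = cnj (z ^ i * l) * (z ^ j * l) * cinner x y"
      using that by (simp add: F_def cinner_scale_left cinner_scale_right)
    finally have 2: "(cnj (z ^ i * l) * (z ^ j * l) - 1) * cinner x y = 0" by (simp add: algebra_simps)
    \<comment> \<open>Eigenvalues a, b of modulus one with cnj a * b = 1 would coincide.\<close>
    have "cnj (z ^ i * l) * (z ^ j * l) \<noteq> 1"
    proof
      assume "cnj (z ^ i * l) * (z ^ j * l) = 1"
      then have "(z ^ i * l) * cnj (z ^ i * l) * (z ^ j * l) = z ^ i * l" by (simp only: mult.assoc) simp
      then have "z ^ j * l = z ^ i * l" unfolding complex_norm_square[symmetric] 1 by simp
      then show False using that(1) x0(4) by auto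
    qed
    then show ?thesis using 2 by simp
  qed
  have FE: "F i \<subseteq> E" for i by (auto simp: F_def)
  have F0: "F i \<noteq> {0}" for i using nz[of i] by blast
  have Feq: "F i = F j" if "z ^ i = z ^ j" for i j unfolding F_def that by (rule refl)
  have Forth: "orth_spaces (F i) (F j)" if "z ^ i \<noteq> z ^ j" for i j
    unfolding orth_spaces_def using orth[OF that] by blast
  have "eigenchain z F"
    unfolding eigenchain_def
  proof (intro conjI allI impI ballI)
    fix i v x assume "v \<in> msupport \<mu>" "x \<in> F i"
    then show "v *v x \<in> F (Suc i)" by (rule step)
  qed (rule sub FE F0 Feq Forth; assumption)+
  then show ?thesis by blast
qed

text \<open>Distinct powers of \<open>z\<close> belong to orthogonal members of the chain, each of
  which contains a nonzero vector.\<close>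

lemma twist_powers_card:
  assumes "z \<in> twists" "inj_on (\<lambda>i. z ^ i) {..<n}"
  shows "n \<le> DIM(complex ^ 'k)"
proof -
  obtain F where F: "eigenchain z F" using twist_eigenchain[OF assms(1)] by blast
  have "\<exists>x. x \<in> F i \<and> x \<noteq> 0" for i
  proof -
    show ?thesis using vec.subspace_0[OF eigenchainD(1)[OF F]] eigenchainD(3)[OF F, of i] by blast
  qed
  then obtain x where x: "\<And>i. x i \<in> F i" "\<And>i. x i \<noteq> 0" by metis
  have "card {..<n} \<le> DIM(complex ^ 'k)"
  proof (rule orthogonal_family_card_le[of _ x])
    fix i j assume "i \<in> {..<n}" "j \<in> {..<n}" "i \<noteq> j"
    then have "z ^ i \<noteq> z ^ j" using inj_onD[OF assms(2)] by blast
    then have "orth_spaces (F i) (F j)" by (rule eigenchainD(6)[OF F])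
    then show "cinner (x i) (x j) = 0" using x(1) by (simp add: orth_spaces_def)
  qed (rule x(2))
  then show ?thesis by simp
qed

text \<open>The chain closes up after l steps because \<open>z ^ l = 1\<close>, so the sum of its
  first l members is invariant. It lies in \<open>E\<close> and therefore equals
  \<open>E\<close>.\<close>

lemma twist_cycle:
  assumes z: "z \<in> twists" and l: "1 \<le> l" "z ^ l = 1" and inj: "inj_on (\<lambda>i. z ^ i) {1..l}"
  obtains F where "is_cycle \<mu> l F"
proof -
  obtain F where F: "eigenchain z F" using twist_eigenchain[OF z] by blast
  note sub = eigenchainD(1)[OF F] and FE = eigenchainD(2)[OF F] and F0 = eigenchainD(3)[OF F]
    and vF = eigenchainD(4)[OF F]
  have next_F: "F (if i = l then 1 else i + 1) = F (Suc i)" for i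
    using eigenchainD(5)[OF F, of 1 "Suc l"] l by simp
  define D where "D = {\<Sum>i=1..l. x i | x. \<forall>i\<in>{1..l}. x i \<in> F i}"
  have D: "vec.subspace D"
    unfolding vec.subspace_def
  proof (intro conjI ballI allI)
    have "(\<Sum>i=1..l. 0 :: complex ^ 'k) \<in> D"
      unfolding D_def using vec.subspace_0[OF sub] by blast
    then show "0 \<in> D" by simp
  next
    fix a b assume "a \<in> D" "b \<in> D"
    then obtain x y where "a = (\<Sum>i=1..l. x i)" "\<forall>i\<in>{1..l}. x i \<in> F i"
      "b = (\<Sum>i=1..l. y i)" "\<forall>i\<in>{1..l}. y i \<in> F i" by (auto simp: D_def)
    then have "a + b = (\<Sum>i=1..l. x i + y i)" "\<forall>i\<in>{1..l}. x i + y i \<in> F i"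
      by (auto simp: sum.distrib intro: vec.subspace_add[OF sub])
    then show "a + b \<in> D" unfolding D_def by blast
  next
    fix c a assume "a \<in> D"
    then obtain x where "a = (\<Sum>i=1..l. x i)" "\<forall>i\<in>{1..l}. x i \<in> F i" by (auto simp: D_def)
    then have "c *s a = (\<Sum>i=1..l. c *s x i)" "\<forall>i\<in>{1..l}. c *s x i \<in> F i"
      by (auto simp: smult_sum intro: vec.subspace_scale[OF sub])
    then show "c *s a \<in> D" unfolding D_def by blast
  qed
  have FD: "u \<in> D" if "i \<in> {1..l}" "u \<in> F i" for i u
  proof -
    have "u = (\<Sum>j=1..l. if j = i then u else 0)" using that by simp
    moreover have "\<forall>j\<in>{1..l}. (if j = i then u else 0) \<in> F j"
      using that vec.subspace_0[OF sub] by auto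
    ultimately show ?thesis unfolding D_def by blast
  qed
  have "invariant_space \<mu> D"
    unfolding invariant_space_iff
  proof (intro conjI ballI D)
    have "\<exists>x\<in>F 1. x \<noteq> 0" using F0[of 1] vec.subspace_0[OF sub[of 1]] by blast
    then show "D \<noteq> {0}" using FD[of 1] l(1) by auto
    fix v a assume v: "v \<in> msupport \<mu>" and "a \<in> D"
    then obtain x where x: "a = (\<Sum>i=1..l. x i)" "\<forall>i\<in>{1..l}. x i \<in> F i" by (auto simp: D_def)
    have "v *v x i \<in> D" if i: "i \<in> {1..l}" for i
    proof (rule FD)
      show "(if i = l then 1 else i + 1) \<in> {1..l}" using i by auto
      show "v *v x i \<in> F (if i = l then 1 else i + 1)"
        unfolding next_F using vF[OF v] x(2) i by blast
    qed
    then show "v *v a \<in> D" unfolding x(1) matrix_vector_sum by (intro vec.subspace_sum[OF D])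
  qed
  then have "E \<subseteq> D" by (rule erg_space_subset)
  moreover have "D \<subseteq> E"
    unfolding D_def using FE by (auto intro!: vec.subspace_sum[OF E_subspace])
  ultimately have ED: "E = D" by blast
  have "is_cycle \<mu> l F"
    unfolding is_cycle_def
  proof (intro conjI ballI impI)
    fix i j assume "i \<in> {1..l}" "j \<in> {1..l}" "i \<noteq> j"
    then have "z ^ i \<noteq> z ^ j" using inj_onD[OF inj] by blast
    then show "orth_spaces (F i) (F j)" by (rule eigenchainD(6)[OF F])
  next
    show "E = {\<Sum>i=1..l. x i | x. \<forall>i\<in>{1..l}. x i \<in> F i}" using ED by (simp add: D_def)
    have step: "\<forall>i\<in>{1..l}. (*v) v ` F i \<subseteq> F (if i = l then 1 else i + 1)" if "v \<in> msupport \<mu>" for v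
      unfolding next_F using vF[OF that] by blast
    show "AE v in \<mu>. \<forall>i\<in>{1..l}. (*v) v ` F i \<subseteq> F (if i = l then 1 else i + 1)"
      by (rule eventually_mono[OF AE_support step])
  qed (rule l sub FE)+
  then show ?thesis using that by blast
qed

text \<open>Let U multiply the i-th space by w^i. As v raises the index by one, U v = w v U, and w^l
  = 1 makes this consistent with the return from l to 1.\<close>

lemma cycle_twist:
  assumes "is_cycle \<mu> l F"
  shows "exp (2 * of_real pi * \<i> / of_nat l) \<in> twists"
proof -
  define w where "w = exp (2 * of_real pi * \<i> / of_nat l)"
  define \<sigma> where "\<sigma> i = (if i = l then 1 else i + 1)" for i
  have l: "1 \<le> l" and sub: "\<And>i. i \<in> {1..l} \<Longrightarrow> vec.subspace (F i)" and FE: "\<And>i. i \<in> {1..l} \<Longrightarrow> F i \<subseteq> E"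
    and orth: "\<And>i j x y. i \<in> {1..l} \<Longrightarrow> j \<in> {1..l} \<Longrightarrow> i \<noteq> j \<Longrightarrow> x \<in> F i \<Longrightarrow> y \<in> F j \<Longrightarrow> cinner x y = 0"
    and E: "E = {\<Sum>i=1..l. x i | x. \<forall>i\<in>{1..l}. x i \<in> F i}"
    and ae: "AE v in \<mu>. \<forall>i\<in>{1..l}. (*v) v ` F i \<subseteq> F (\<sigma> i)"
    using assms unfolding is_cycle_def orth_spaces_def \<sigma>_def by blast+
  have \<sigma>: "\<sigma> i \<in> {1..l}" if "i \<in> {1..l}" for i using that by (auto simp: \<sigma>_def)
  have wl: "w ^ l = 1" using l by (simp add: w_def exp_of_nat_mult[symmetric] mult.commute)
  have w1: "cmod w = 1" by (simp add: w_def norm_exp_eq_Re Re_divide_of_nat)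
  have w\<sigma>: "w ^ \<sigma> i = w * w ^ i" for i using wl by (simp add: \<sigma>_def)
  have vF: "v *v x \<in> F (\<sigma> i)" if "v \<in> msupport \<mu>" "i \<in> {1..l}" "x \<in> F i" for v i x
  proof -
    have "AE v in \<mu>. (*v) v ` F i \<subseteq> F (\<sigma> i)" using ae that(2) by (auto elim: eventually_mono)
    then show ?thesis using AE_maps_iff[OF sub[OF \<sigma>[OF that(2)]]] that by blast
  qed
  \<comment> \<open>\<open>U\<close> has to be a matrix on the whole space; it is assembled from
    projections, each of which annihilates the other members of the cycle.\<close>
  have "\<exists>P :: complex ^ 'k ^ 'k. (\<forall>x\<in>F i. P *v x = x) \<and> (\<forall>x. (\<forall>y\<in>F i. cinner y x = 0) \<longrightarrow> P *v x = 0)"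
    if "i \<in> {1..l}" for i
    using projection_exists[OF sub[OF that]] by metis
  then obtain P :: "nat \<Rightarrow> complex ^ 'k ^ 'k" where P: "\<And>i x. i \<in> {1..l} \<Longrightarrow> x \<in> F i \<Longrightarrow> P i *v x = x"
    "\<And>i x. i \<in> {1..l} \<Longrightarrow> (\<And>y. y \<in> F i \<Longrightarrow> cinner y x = 0) \<Longrightarrow> P i *v x = 0" by metis
  define U where "U = (\<Sum>i=1..l. mat (w ^ i) ** P i)"
  have UF: "U *v x = w ^ j *s x" if j: "j \<in> {1..l}" and x: "x \<in> F j" for j x
  proof -
    have "P i *v x = 0" if "i \<in> {1..l}" "i \<noteq> j" for i
      by (rule P(2)) (use that j x orth in auto)
    then have "U *v x = (\<Sum>i=1..l. if i = j then w ^ j *s x else 0)"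
      unfolding U_def sum_matrix_vector using j x by (intro sum.cong) (auto simp: mat_mult_vector P(1))
    then show ?thesis using j by simp
  qed
  have "twist w U"
    unfolding twist_def
  proof (intro conjI ballI w1)
    fix x assume "x \<in> E"
    then obtain y where y: "x = (\<Sum>i=1..l. y i)" "\<forall>i\<in>{1..l}. y i \<in> F i" using E by auto
    have Ux: "U *v x = (\<Sum>i=1..l. w ^ i *s y i)"
      unfolding y(1) matrix_vector_sum using y(2) UF by (intro sum.cong) auto
    have "y i \<in> E" if "i \<in> {1..l}" for i using y(2) FE that by blast
    then show "U *v x \<in> E"
      unfolding Ux by (intro vec.subspace_sum[OF E_subspace] vec.subspace_scale[OF E_subspace]) auto
    have pyth: "(norm (\<Sum>i=1..l. u i))\<^sup>2 = (\<Sum>i=1..l. (norm (u i))\<^sup>2)"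
      if "\<forall>i\<in>{1..l}. u i \<in> F i" for u
    proof (rule norm_sum_Pythagorean)
      show "pairwise (\<lambda>i j. orthogonal (u i) (u j)) {1..l}"
        using that orth by (auto simp: pairwise_def orthogonal_def simp flip: Re_cinner)
    qed simp
    have "(norm (U *v x))\<^sup>2 = (\<Sum>i=1..l. (norm (w ^ i *s y i))\<^sup>2)"
      unfolding Ux using y(2) vec.subspace_scale[OF sub] by (intro pyth) blast
    also have "\<dots> = (norm x)\<^sup>2"
      unfolding y(1) pyth[OF y(2)] by (simp add: norm_vector_smult norm_power w1)
    finally have "(norm (U *v x))\<^sup>2 = (norm x)\<^sup>2" .
    then show "norm (U *v x) = norm x" by simp
    fix v assume v: "v \<in> msupport \<mu>"
    have "U *v (v *v x) = (\<Sum>i=1..l. w ^ \<sigma> i *s (v *v y i))"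
      unfolding y(1) matrix_vector_sum using y(2) vF[OF v] \<sigma> by (intro sum.cong refl UF) auto
    also have "\<dots> = w *s (v *v (U *v x))"
      unfolding Ux matrix_vector_sum smult_sum by (simp add: w\<sigma> vector_scalar_commute vector_smult_assoc)
    finally show "U *v (v *v x) = w *s (v *v (U *v x))" .
  qed
  then show ?thesis by (auto simp: twists_def w_def)
qed

section \<open>The order of the twist group equals the period\<close>

lemma twist_order:
  assumes "z \<in> twists"
  obtains n where "1 \<le> n" "n \<le> DIM(complex ^ 'k)" "z ^ n = 1"
proof -
  have "\<not> inj_on (\<lambda>i. z ^ i) {..<Suc (DIM(complex ^ 'k))}"
    using twist_powers_card[OF assms] by (meson Suc_n_not_le_n)
  then obtain i j where ij: "i < j" "j \<le> DIM(complex ^ 'k)" "z ^ i = z ^ j"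
    unfolding inj_on_def by (metis lessThan_iff less_Suc_eq_le linorder_neqE_nat)
  have "z \<noteq> 0" using twists_norm[OF assms] by auto
  then have "z ^ (j - i) = 1" using ij(1,3) by (simp add: power_diff)
  moreover have "1 \<le> j - i" using ij(1) by simp
  moreover have "j - i \<le> DIM(complex ^ 'k)" by (rule order_trans[OF diff_le_self ij(2)])
  ultimately show ?thesis using that[of "j - i"] by simp
qed

text \<open>The twists form a finite group of complex numbers, hence a group of roots of unity.\<close>

lemma twists_eq_roots: "\<exists>n\<ge>1. twists = {z. z ^ n = 1}"
proof -
  have "twists \<subseteq> (\<Union>n\<in>{1..DIM(complex ^ 'k)}. {z. z ^ n = 1})"
  proof
    fix z assume "z \<in> twists"
    then obtain n where "1 \<le> n" "n \<le> DIM(complex ^ 'k)" "z ^ n = 1" by (rule twist_order)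
    then show "z \<in> (\<Union>n\<in>{1..DIM(complex ^ 'k)}. {z. z ^ n = 1})" by (intro UN_I[of n]) auto
  qed
  moreover have "finite (\<Union>n\<in>{1..DIM(complex ^ 'k)}. {z :: complex. z ^ n = 1})"
    by (auto intro: finite_roots_unity)
  ultimately have fin: "finite twists" by (rule finite_subset)
  define n where "n = card twists"
  have n: "1 \<le> n" using fin twists_1 by (auto simp: n_def Suc_le_eq card_gt_0_iff)
  have "z ^ n = 1" if z: "z \<in> twists" for z
  proof -
    have z0: "z \<noteq> 0" using twists_norm[OF z] by auto
    have "(*) z ` twists = twists"
      using fin z twists_mult z0 by (intro endo_inj_surj) (auto simp: inj_on_def)
    \<comment> \<open>Multiplication by \<open>z\<close> permutes the finite group: the product of
      all elements is unchanged and yet acquires the factor z^n.\<close>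
    then have "\<Prod>twists = (\<Prod>x\<in>(*) z ` twists. x)" by simp
    also have "\<dots> = (\<Prod>x\<in>twists. z * x)" using z0 by (subst prod.reindex) (auto simp: inj_on_def)
    also have "\<dots> = z ^ n * \<Prod>twists" by (simp add: prod.distrib n_def)
    finally have "(z ^ n - 1) * \<Prod>twists = 0" by (simp add: algebra_simps)
    moreover have "\<Prod>twists \<noteq> 0" using fin twists_norm by force
    ultimately show ?thesis by simp
  qed
  then have "twists \<subseteq> {z. z ^ n = 1}" by blast
  then have "twists = {z. z ^ n = 1}"
    using card_complex_roots_unity[OF n] finite_roots_unity[OF n] by (intro card_subset_eq) (auto simp: n_def)
  then show ?thesis using n by blast
qed

text \<open>A primitive n-th root of unity gives a cycle of length n. A cycle of length l gives a
  twist with l distinct powers among the n roots, so no cycle is longer.\<close>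

lemma twists_eq_roots_period: "1 \<le> period \<mu> \<and> twists = {z. z ^ period \<mu> = 1}"
proof -
  obtain n where n: "1 \<le> n" "twists = {z. z ^ n = 1}" using twists_eq_roots by blast
  let ?w = "\<lambda>l. exp (2 * of_real pi * \<i> / of_nat l) :: complex"
  let ?C = "{l. \<exists>F. is_cycle \<mu> l F}"
  have root: "?w l ^ l = 1" if "1 \<le> l" for l
    using that by (simp add: exp_of_nat_mult[symmetric] mult.commute)
  have "?w n \<in> twists" using root[OF n(1)] n(2) by blast
  then have nC: "n \<in> ?C"
    using twist_cycle[OF _ n(1) root[OF n(1)] inj_on_powers_root_of_unity(2)[OF n(1)]] by blast
  have le: "l \<le> n" if lC: "l \<in> ?C" for l
  proof -
    obtain F where F: "is_cycle \<mu> l F" using lC by blast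
    then have l: "1 \<le> l" by (simp add: is_cycle_def)
    have "(\<lambda>i. ?w l ^ i) ` {..<l} \<subseteq> {z. z ^ n = 1}"
      using twists_power[OF cycle_twist[OF F]] n(2) by auto
    then have "card ((\<lambda>i. ?w l ^ i) ` {..<l}) \<le> card {z :: complex. z ^ n = 1}"
      by (intro card_mono finite_roots_unity n(1))
    then show ?thesis
      by (simp add: card_image inj_on_powers_root_of_unity(1)[OF l] card_complex_roots_unity[OF n(1)])
  qed
  have "period \<mu> = n"
    unfolding period_def
  proof (rule Max_eqI)
    show "finite ?C" using le by (meson finite_nat_set_iff_bounded_le)
  qed (use le nC in auto)
  then show ?thesis using n by simp
qed

end

section \<open>The peripheral spectrum\<close>

locale ergodic_holder = normalized_holder \<mu> \<alpha> + ergodic \<mu>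
  for \<mu> :: "(complex ^ 'k ^ 'k) measure" and \<alpha> :: real
begin

lemma integrable_form: "integrable \<mu> (\<lambda>v. cinner (v *v x) (A *v (v *v y)))"
proof (rule integrable_dominated)
  show "continuous_on UNIV (\<lambda>v. cinner (v *v x) (A *v (v *v y)))" by (intro continuous_intros)
  fix v :: "complex ^ 'k ^ 'k"
  have "cmod (cinner (v *v x) (A *v (v *v y))) \<le> norm (v *v x) * norm (A *v (v *v y))"
    by (rule cmod_cinner_le)
  also have "\<dots> \<le> (norm v * norm x) * (norm A * (norm v * norm y))"
    by (intro mult_mono norm_matrix_vector_le order_trans[OF norm_matrix_vector_le] mult_left_mono) auto
  finally show "cmod (cinner (v *v x) (A *v (v *v y))) \<le> norm x * norm A * norm y * (norm v)\<^sup>2"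
    by (simp add: power2_eq_square mult_ac)
qed

text \<open>The eigenform equation will be used off the diagonal, at the pair \<open>A *v x\<close>,
  \<open>x\<close>.\<close>

lemma eigenform_polarized:
  assumes "\<And>x. (LINT v|\<mu>. cinner (v *v x) (A *v (v *v x))) = z * cinner x (A *v x)"
  shows "(LINT v|\<mu>. cinner (v *v x) (A *v (v *v y))) = z * cinner x (A *v y)"
proof -
  define B where "B x y = (LINT v|\<mu>. cinner (v *v x) (A *v (v *v y))) - z * cinner x (A *v y)" for x y
  note int_add = Bochner_Integration.integral_add[OF integrable_form integrable_form]
  have "B x y = 0"
  proof (rule sesquilinear_eq_0[OF vec.subspace_UNIV, of B])
    show "B (x + y) w = B x w + B y w" for x y w
      unfolding B_def matrix_vector_right_distrib cinner_add_left int_add by (simp add: distrib_left)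
    show "B x (y + w) = B x y + B x w" for x y w
      unfolding B_def matrix_vector_right_distrib cinner_add_right int_add by (simp add: distrib_left)
    show "B (c *s x) y = cnj c * B x y" for c x y
      unfolding B_def vector_scalar_commute cinner_scale_left by (simp add: right_diff_distrib mult.left_commute)
    show "B x (c *s y) = c * B x y" for c x y
      unfolding B_def vector_scalar_commute cinner_scale_right by (simp add: right_diff_distrib mult.left_commute)
    show "B x x = 0" for x by (simp add: B_def assms)
  qed auto
  then show ?thesis by (simp add: B_def)
qed

text \<open>The space where \<open>A\<close> attains its operator norm is invariant, hence contains \<open>E\<close>, and on it \<open>A\<close>
  commutes with \<open>v\<close> up to the factor \<open>z\<close>.\<close>

lemma eigenform_twist:
  assumes z: "cmod z = 1" and A: "\<exists>x. A *v x \<noteq> 0"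
    and eig: "\<And>x. (LINT v|\<mu>. cinner (v *v x) (A *v (v *v x))) = z * cinner x (A *v x)"
  shows "z \<in> twists"
proof -
  have U0: "(UNIV :: (complex ^ 'k) set) \<noteq> {0}"
  proof -
    obtain x where "A *v x \<noteq> 0" using A by blast
    then have "x \<noteq> 0" by auto
    then show ?thesis by blast
  qed
  have "continuous_on UNIV (\<lambda>x. (norm (A *v x))\<^sup>2)" by (intro continuous_intros)
  from sphere_attains_sup[OF vec.subspace_UNIV U0 this] obtain x0
    where "x0 \<in> UNIV" and x0: "norm x0 = 1"
      "\<And>y. y \<in> UNIV \<Longrightarrow> norm y = 1 \<Longrightarrow> (norm (A *v y))\<^sup>2 \<le> (norm (A *v x0))\<^sup>2" by blast
  define t where "t = (norm (A *v x0))\<^sup>2"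
  have le: "(norm (A *v x))\<^sup>2 \<le> t * (norm x)\<^sup>2" for x
    using homogeneous_le[OF vec.subspace_UNIV, of "\<lambda>x. (norm (A *v x))\<^sup>2" t x] x0(2)
    by (simp add: t_def vector_scalar_commute norm_vector_smult power_mult_distrib)
  have t: "t > 0"
  proof -
    obtain x where "A *v x \<noteq> 0" using A by blast
    then have "0 < t * (norm x)\<^sup>2" using less_le_trans[OF _ le[of x], of 0] by simp
    then show ?thesis by (simp add: zero_less_mult_iff)
  qed
  define G where "G x = t * (norm x)\<^sup>2 - (norm (A *v x))\<^sup>2" for x
  define F where "F = {x \<in> UNIV. G x = 0}"
  have F: "vec.subspace F"
    unfolding F_def
  proof (rule vec_subspace_null_set[OF vec.subspace_UNIV])
    show "0 \<le> G x" for x using le by (simp add: G_def)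
    show "G (c *s x) = (cmod c)\<^sup>2 * G x" for c x
      by (simp add: G_def vector_scalar_commute norm_vector_smult power_mult_distrib algebra_simps)
    show "G (x + y) + G (x - y) = 2 * G x + 2 * G y" for x y
      using arg_cong[OF parallelogram_law[of x y], of "(*) t"] parallelogram_law[of "A *v x" "A *v y"]
      by (simp add: G_def matrix_vector_right_distrib matrix_vector_mult_diff_distrib algebra_simps)
  qed
  have key: "G (v *v x) = 0 \<and> A *v (v *v x) = z *s (v *v (A *v x))" if x: "x \<in> F" and v: "v \<in> msupport \<mu>" for x v
  proof -
    \<comment> \<open>\<open>H v\<close> is the sum of the nonnegative terms
      \<open>G (v *v x)\<close> and |A v x - z v A x|^2. By the eigenform equation its integral is
      \<open>G x\<close>, which is 0 on \<open>F\<close>, so both terms vanish on the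
      support.\<close>
    define H where "H v = t * (norm (v *v x))\<^sup>2 + (norm (v *v (A *v x)))\<^sup>2
      - 2 * Re (cnj z * cinner (v *v (A *v x)) (A *v (v *v x)))" for v :: "complex ^ 'k ^ 'k"
    have H_eq: "H v = G (v *v x) + (norm (A *v (v *v x) - z *s (v *v (A *v x))))\<^sup>2" for v
    proof -
      have "Re (cinner (A *v (v *v x)) (z *s (v *v (A *v x))))
          = Re (cnj (cinner (A *v (v *v x)) (z *s (v *v (A *v x)))))" by simp
      also have "cnj (cinner (A *v (v *v x)) (z *s (v *v (A *v x))))
          = cnj z * cinner (v *v (A *v x)) (A *v (v *v x))"
        by (simp add: cnj_cinner cinner_scale_left)
      finally show ?thesis
        by (simp add: norm_diff_squared H_def G_def norm_vector_smult z)
    qed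
    have G0: "0 \<le> G y" for y using le by (simp add: G_def)
    have int: "integrable \<mu> (\<lambda>v. cnj z * cinner (v *v (A *v x)) (A *v (v *v x)))"
      by (intro integrable_mult_right integrable_form)
    have "H v = 0"
    proof (rule integral_eq_0_support[OF _ _ _ _ v])
      show "integrable \<mu> H"
        unfolding H_def
        by (intro Bochner_Integration.integrable_diff Bochner_Integration.integrable_add integrable_mult_right
            integrable_norm_squared integrable_Re int)
      show "continuous_on UNIV H" unfolding H_def by (intro continuous_intros)
      show "0 \<le> H v" for v unfolding H_eq using G0 by simp
      have "(LINT v|\<mu>. cnj z * cinner (v *v (A *v x)) (A *v (v *v x)))
          = (z * cnj z) * cinner (A *v x) (A *v x)"
        by (simp add: eigenform_polarized[OF eig])
      also have "\<dots> = of_real ((norm (A *v x))\<^sup>2)"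
        unfolding complex_norm_square[symmetric] z by (simp add: cinner_self)
      finally have "(LINT v|\<mu>. Re (cnj z * cinner (v *v (A *v x)) (A *v (v *v x)))) = (norm (A *v x))\<^sup>2"
        using integral_Re[OF int] by (simp only: Re_complex_of_real)
      then have "(LINT v|\<mu>. H v) = t * (norm x)\<^sup>2 + (norm (A *v x))\<^sup>2 - 2 * (norm (A *v x))\<^sup>2"
        unfolding H_def using integrable_Re[OF int]
        by (simp add: integrable_norm_squared integral_norm_squared del: times_complex.sel complex_cnj)
      then show "(LINT v|\<mu>. H v) = 0" using x by (simp add: F_def G_def)
    qed
    then have "G (v *v x) = 0 \<and> (norm (A *v (v *v x) - z *s (v *v (A *v x))))\<^sup>2 = 0"
      unfolding H_eq using G0[of "v *v x"] by (simp add: add_nonneg_eq_0_iff)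
    then show ?thesis by simp
  qed
  have "invariant_space \<mu> F"
    unfolding invariant_space_iff
  proof (intro conjI ballI F)
    have "x0 \<in> F" by (simp add: F_def G_def t_def x0)
    then show "F \<noteq> {0}" using x0(1) by (metis norm_zero singletonD zero_neq_one)
    show "v *v x \<in> F" if "v \<in> msupport \<mu>" "x \<in> F" for v x using key[OF that(2,1)] by (simp add: F_def)
  qed
  then have EF: "E \<subseteq> F" by (rule erg_space_subset)
  have norm_A: "norm (A *v x) = sqrt t * norm x" if "x \<in> E" for x
  proof -
    have "(norm (A *v x))\<^sup>2 = t * (norm x)\<^sup>2" using that EF by (auto simp: F_def G_def)
    then have "norm (A *v x) = sqrt (t * (norm x)\<^sup>2)" by (metis norm_ge_zero real_sqrt_unique)
    then show ?thesis by (simp add: real_sqrt_mult)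
  qed
  \<comment> \<open>Since A v = z v A on \<open>E\<close>, the image of \<open>E\<close> is
    invariant and contains \<open>E\<close>; its dimension is no larger, so \<open>A\<close> maps
    \<open>E\<close> onto itself.\<close>
  let ?AE = "(*v) A ` E"
  have AE_sub: "vec.subspace ?AE"
    unfolding vec.subspace_def
  proof (intro conjI ballI allI)
    show "0 \<in> ?AE" using vec.subspace_0[OF E_subspace] by (intro image_eqI[of _ _ 0]) simp_all
    show "a + b \<in> ?AE" if ab: "a \<in> ?AE" "b \<in> ?AE" for a b
    proof -
      obtain x y where "x \<in> E" "y \<in> E" "a = A *v x" "b = A *v y" using ab by blast
      then show ?thesis using vec.subspace_add[OF E_subspace, of x y]
        by (intro image_eqI[of _ _ "x + y"]) (simp_all add: matrix_vector_right_distrib)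
    qed
    show "c *s a \<in> ?AE" if a: "a \<in> ?AE" for c a
    proof -
      obtain x where "x \<in> E" "a = A *v x" using a by blast
      then show ?thesis using vec.subspace_scale[OF E_subspace, of x c]
        by (intro image_eqI[of _ _ "c *s x"]) (simp_all add: vector_scalar_commute)
    qed
  qed
  have "invariant_space \<mu> ?AE"
    unfolding invariant_space_iff
  proof (intro conjI ballI AE_sub)
    obtain x where x: "x \<in> E" "norm x = 1" using vec_subspace_unit_vector[OF E_subspace E_nonzero] .
    then have "A *v x \<noteq> 0" using norm_A[of x] t by auto
    then show "?AE \<noteq> {0}" using x(1) by blast
    fix v a assume v: "v \<in> msupport \<mu>" and "a \<in> ?AE"
    then obtain x where x: "x \<in> E" "a = A *v x" by blast
    have z0: "z \<noteq> 0" using z by auto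
    have "A *v (v *v x) = z *s (v *v a)" using key[of x v] x v EF by auto
    then have "v *v a = A *v (inverse z *s (v *v x))"
      using z0 by (simp add: vector_scalar_commute vector_smult_assoc)
    moreover have "inverse z *s (v *v x) \<in> E" by (intro vec.subspace_scale[OF E_subspace] E_invariant v x)
    ultimately show "v *v a \<in> ?AE" by blast
  qed
  then have "E \<subseteq> ?AE" by (rule erg_space_subset)
  moreover have "vec.dim ?AE \<le> vec.dim E" by (rule vec.dim_image_le[OF matrix_vector_mul_linear_gen])
  ultimately have E_eq: "E = ?AE" by (rule vec.subspace_dim_equal[OF E_subspace AE_sub])
  define U where "U = mat (of_real (1 / sqrt t)) ** A"
  have U: "U *v x = of_real (1 / sqrt t) *s (A *v x)" for x by (simp add: U_def mat_mult_vector)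
  have "twist z U"
    unfolding twist_def
  proof (intro conjI ballI z)
    fix x assume x: "x \<in> E"
    have "A *v x \<in> E" using E_eq x by blast
    then show "U *v x \<in> E" unfolding U by (rule vec.subspace_scale[OF E_subspace])
    have "norm (U *v x) = (1 / sqrt t) * norm (A *v x)"
      unfolding U norm_vector_smult using t by (simp add: norm_divide)
    then show "norm (U *v x) = norm x" using t by (simp add: norm_A[OF x])
    fix v assume v: "v \<in> msupport \<mu>"
    have "A *v (v *v x) = z *s (v *v (A *v x))" using key[of x v] x v EF by auto
    then show "U *v (v *v x) = z *s (v *v (U *v x))"
      unfolding U by (simp add: vector_scalar_commute vector_smult_assoc mult.commute)
  qed
  then show ?thesis by (auto simp: twists_def)
qed

section \<open>Spectral values of modulus one and twists\<close>

lemma spectrum_imp_twist: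
  assumes "Pur \<mu>" "cmod z = 1" "z \<in> op_spectrum V N T"
  shows "z \<in> twists"
proof -
  obtain f where f: "f \<in> V" "f \<noteq> (\<lambda>X. 0)" "\<And>X. T f X = z * f X"
    using spectrum_imp_eigenfunction[OF assms] by blast
  obtain A where A: "\<And>x. hom_ext f x = cinner x (A *v x)"
    using eigenfunction_quadratic[OF assms(1) f(1) assms(2) f(3)] by blast
  have Tf: "T f = (\<lambda>X. z * f X)" using f(3) by blast
  show ?thesis
  proof (rule eigenform_twist[OF assms(2)])
    obtain X where "f X \<noteq> 0" using f(2) by blast
    then have "A *v unit_rep X \<noteq> 0" using A[of "unit_rep X"] by auto
    then show "\<exists>x. A *v x \<noteq> 0" by blast
    show "(LINT v|\<mu>. cinner (v *v x) (A *v (v *v x))) = z * cinner x (A *v x)" for x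
      using hom_ext_markov_op[of \<mu> f x] by (simp add: Tf hom_ext_cmult A)
  qed
qed

text \<open>Phase-aligned unit representatives differ by at most twice the distance, and the form
  varies by at most \<open>2 * norm U\<close> times their difference, hence the 4.\<close>

lemma holder_bd_form: "holder_bd \<alpha> (norm U) (4 * norm U) (\<lambda>X. cinner (unit_rep X) (U *v unit_rep X))"
  for U :: "complex ^ 'k ^ 'k"
proof -
  let ?g = "\<lambda>X :: 'k proj. cinner (unit_rep X) (U *v unit_rep X)"
  show ?thesis
    unfolding holder_bd_def
  proof (intro conjI allI)
    show "0 \<le> 4 * norm U" by simp
    fix X Y :: "'k proj"
    show "cmod (?g X) \<le> norm U"
      using order_trans[OF cmod_cinner_le[of "unit_rep X" "U *v unit_rep X"]] norm_matrix_vector_le[of U "unit_rep X"]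
      by simp
    define x where "x = unit_rep X"
    obtain c where c: "cmod c = 1" "cinner x (c *s unit_rep Y) = of_real (cmod (cinner x (unit_rep Y)))"
      using phase_exists by blast
    define y where "y = c *s unit_rep Y"
    have n: "norm x = 1" "norm y = 1" by (simp_all add: x_def y_def c norm_vector_smult)
    have "c * cnj c = 1" using c(1) by (simp add: complex_norm_square[symmetric])
    then have "?g Y = cinner y (U *v y)"
      by (simp add: y_def vector_scalar_commute cinner_scale_left cinner_scale_right mult.assoc[symmetric])
    then have "?g X - ?g Y = cinner (x - y) (U *v x) + cinner y (U *v (x - y))"
      by (simp add: x_def cinner_diff_left cinner_diff_right matrix_vector_mult_diff_distrib)
    then have "cmod (?g X - ?g Y) \<le> cmod (cinner (x - y) (U *v x)) + cmod (cinner y (U *v (x - y)))"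
      by (simp only: norm_triangle_ineq)
    also have "\<dots> \<le> norm (x - y) * norm U + norm (x - y) * norm U"
    proof (rule add_mono)
      have "norm (x - y) * norm (U *v x) \<le> norm (x - y) * norm U"
        using norm_matrix_vector_le[of U x] n by (intro mult_left_mono) auto
      then show "cmod (cinner (x - y) (U *v x)) \<le> norm (x - y) * norm U"
        using cmod_cinner_le order_trans by blast
      have "norm y * norm (U *v (x - y)) \<le> norm (x - y) * norm U"
        using norm_matrix_vector_le[of U "x - y"] n by (simp add: mult.commute)
      then show "cmod (cinner y (U *v (x - y))) \<le> norm (x - y) * norm U"
        using cmod_cinner_le order_trans by blast
    qed
    also have "\<dots> = 2 * norm U * norm (x - y)" by simp
    also have "\<dots> \<le> 2 * norm U * (2 * area x y)"
      using c(2) by (intro mult_left_mono norm_diff_le_area[OF n, of "cmod (cinner x (unit_rep Y))"]) (auto simp: y_def)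
    also have "area x y = proj_dist X Y"
      using area_scale[of 1 x c "unit_rep Y"] c(1) by (simp add: x_def y_def proj_dist_eq_area)
    also have "2 * norm U * (2 * proj_dist X Y) \<le> 4 * norm U * proj_dist X Y powr \<alpha>"
      using \<alpha> proj_dist_le_1[of X Y] powr_mono'[of \<alpha> 1 "proj_dist X Y"] by (simp add: mult_left_mono)
    finally show "cmod (?g X - ?g Y) \<le> 4 * norm U * proj_dist X Y powr \<alpha>" .
  qed
qed

text \<open>The form of \<open>U\<close> satisfies the eigenvalue equation on \<open>E\<close>, so
  the pointwise criterion is applied at an eigenvector of \<open>U\<close> in \<open>E\<close>,
  where the form has modulus one.\<close>

lemma twist_imp_spectrum:
  assumes "z \<in> twists"
  shows "z \<in> op_spectrum V N T"
proof -
  obtain U where U: "twist z U" using assms by (auto simp: twists_def)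
  have z: "cmod z = 1" and UE: "\<And>x. x \<in> E \<Longrightarrow> U *v x \<in> E" and iso: "\<And>x. x \<in> E \<Longrightarrow> norm (U *v x) = norm x"
    and comm: "\<And>v x. v \<in> msupport \<mu> \<Longrightarrow> x \<in> E \<Longrightarrow> U *v (v *v x) = z *s (v *v (U *v x))"
    using U by (auto simp: twist_def)
  obtain x0 l where x0: "x0 \<in> E" "norm x0 = 1" "U *v x0 = l *s x0" "cmod l = 1"
    using isometry_eigenvector[OF E_subspace E_nonzero UE iso] by blast
  define g where "g = (\<lambda>X. cinner (unit_rep X) (U *v unit_rep X))"
  have gV: "g \<in> V" unfolding g_def by (rule holder_bd_imp_holder_space[OF holder_bd_form])
  have hom_g: "hom_ext g x = cinner x (U *v x)" for x
  proof (cases "x = 0")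
    case False
    then obtain c where c: "x = c *s unit_rep (abs_proj x)" "cmod c = norm x" by (metis unit_rep_abs_proj)
    have "cinner x (U *v x) = (c * cnj c) * g (abs_proj x)"
      by (subst (1 2) c(1)) (simp add: g_def vector_scalar_commute cinner_scale_left cinner_scale_right)
    also have "\<dots> = hom_ext g x"
      unfolding complex_norm_square[symmetric] c(2) using False by (simp add: hom_ext_def)
    finally show ?thesis by simp
  qed simp
  have iter: "hom_ext ((T ^^ j) g) x = z ^ j * cinner x (U *v x)" if "x \<in> E" for j x
    using that
  proof (induction j arbitrary: x)
    case (Suc j)
    let ?h = "(T ^^ j) g"
    have h: "holder_bd \<alpha> (N ?h) (N ?h) ?h" by (rule bd_norm[OF T_power_in_V[OF gV]])
    have "hom_ext (T ?h) x = (LINT v|\<mu>. hom_ext ?h (v *v x))" by (rule hom_ext_markov_op)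
    also have "\<dots> = (LINT v|\<mu>. z ^ Suc j * cinner (v *v x) (v *v (U *v x)))"
    proof (rule integral_cong_AE)
      show "AE v in \<mu>. hom_ext ?h (v *v x) = z ^ Suc j * cinner (v *v x) (v *v (U *v x))"
        by (rule eventually_mono[OF AE_support])
          (simp add: Suc E_invariant comm cinner_scale_right)
    qed (use integrable_hom_ext[OF h] integrable_cinner in \<open>auto intro!: borel_measurable_integrable\<close>)
    also have "\<dots> = z ^ Suc j * cinner x (U *v x)" by (simp add: integral_cinner)
    finally show ?case by simp
  qed (simp add: hom_g)
  define X where "X = abs_proj x0"
  have x0nz: "x0 \<noteq> 0" using x0(2) by auto
  obtain c where c: "c \<noteq> 0" "x0 = c *s unit_rep X" using unit_rep_abs_proj[OF x0nz] unfolding X_def by metis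
  have "unit_rep X = inverse c *s x0" using c by (simp add: vector_smult_assoc)
  then have uE: "unit_rep X \<in> E" and uU: "U *v unit_rep X = l *s unit_rep X"
    using vec.subspace_scale[OF E_subspace x0(1)] by (simp_all add: vector_scalar_commute x0(3) vector_smult_assoc mult.commute)
  show ?thesis
  proof (rule in_spectrumI[OF z gV])
    show "(T ^^ j) g X = z ^ j * g X" for j
      using iter[OF uE, of j] by (simp add: g_def)
    show "g X \<noteq> 0" using x0(4) by (auto simp: g_def uU cinner_scale_right cinner_self)
  qed
qed

lemma peripheral_spectrum:
  assumes "Pur \<mu>"
  shows "{z \<in> op_spectrum V N T. cmod z = 1} = {z. z ^ period \<mu> = 1}"
proof -
  have "{z \<in> op_spectrum V N T. cmod z = 1} = twists"
    using spectrum_imp_twist[OF assms] twist_imp_spectrum twists_norm by blast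
  then show ?thesis using twists_eq_roots_period by simp
qed

end

theorem lemma4p9:
  fixes \<mu> :: "(complex ^ 'k ^ 'k) measure" and \<alpha> :: real
  assumes "sets \<mu> = sets borel"
    and "integrable \<mu> (\<lambda>v. (onorm ((*v) v))\<^sup>2)"
    and "(LINT v|\<mu>. adj v ** v) = mat 1"
    and "0 < \<alpha>" and "\<alpha> \<le> 1"
    and "Pur \<mu>" and "Erg \<mu>"
  shows "{z \<in> op_spectrum (holder_space \<alpha>) (holder_norm \<alpha>) (markov_op \<mu>). cmod z = 1} =
         {exp (\<i> * of_real (real r / real (period \<mu>) * (2 * pi))) | r. r < period \<mu>}"
proof -
  interpret ergodic_holder \<mu> \<alpha>
    by standard (fact assms)+
  have p: "1 \<le> period \<mu>" using twists_eq_roots_period by blast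
  have "exp (2 * of_real pi * \<i> * of_nat r / of_nat (period \<mu>))
      = exp (\<i> * complex_of_real (real r / real (period \<mu>) * (2 * pi)))" for r
    by (simp add: mult_ac)
  then show ?thesis
    unfolding peripheral_spectrum[OF assms(6)] complex_roots_unity[OF p] by simp
qed

end
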